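(* Assume that $(\Delta-1)\sigma\in L^1(\mathbb R^3)$; that $\Sigma(\theta)$ is positive definite for a.e. $\theta\in\Pi^*\setminus\Gamma^*$ (Wiener condition); and that $\hat\sigma(2\pi m)=0$ for all $m\in\mathbb Z^3\setminus\{0\}$ (Jellium condition). Then there is a constant $C>0$, independent of $\theta$ and of $\tilde Z$, such that for every $\theta\in\Pi^*_+$: (i) $\tilde K(\theta)$ is a selfadjoint operator in $\mathcal X^0(\mathbb T)$ with dense domain $D(\tilde K(\theta))\subset\mathcal X^1(\mathbb T)$; (ii) $\tilde K^{-1}(\theta)$ is a compact selfadjoint operator in $\mathcal X^0(\mathbb T)$, and $$\|\tilde K^{-1}(\theta)\tilde Z\|^2_{\mathcal X^1(\mathbb T)}\le\frac{C}{\varkappa(\theta)}\|\tilde Z\|^2_{\mathcal X^0(\mathbb T)},\qquad \tilde Z\in\mathcal X^0(\mathbb T).$$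
   Context: All spaces are complex. Fix constants $e>0$, $M>0$, $Z>0$, and a real function $\sigma\in L^1(\mathbb R^3)$ with $\int_{\mathbb R^3}\sigma\,dx=eZ$. Put $\hat\sigma(\xi)=\int e^{i\xi\cdot x}\sigma(x)\,dx$, $\Gamma^*=2\pi\mathbb Z^3$, $\Pi^*=[0,2\pi]^3$, $\mathbb T=\mathbb R^3/\mathbb Z^3$, $\psi^0=\sqrt Z$, and $$\Sigma(\theta)=\sum_{m\in\mathbb Z^3}\Big[\frac{\xi\otimes\xi}{|\xi|^2}|\hat\sigma(\xi)|^2\Big]_{\xi=2\pi m+\theta},\qquad \Pi^*_+=\{\theta\in\Pi^*\setminus\Gamma^*:\Sigma(\theta)>0\},$$ where $\xi\otimes\xi=(\xi_i\xi_j)$ and $\Sigma(\theta)>0$ means positive definite. Let $\mathcal X^s(\mathbb T)=H^s(\mathbb T)\oplus H^s(\mathbb T)\oplus\mathbb C^3\oplus\mathbb C^3$. For $\theta\in\Pi^*\setminus\Gamma^*$ let $$\tilde B(\theta)=\begin{pmatrix}2\tilde H^0(\theta)+4e^2\psi^0\tilde G(\theta)\psi^0&0&2\tilde S(\theta)&0\\0&2\tilde H^0(\theta)&0&0\\2\tilde S^*(\theta)&0&\tilde T(\theta)&0\\0&0&0&M^{-1}\end{pmatrix},\qquad J=\begin{pmatrix}0&\frac12&0&0\\-\frac12&0&0&0\\0&0&0&1\\0&0&-1&0\end{pmatrix},$$ with domain $\mathcal X^2(\mathbb T)$ in $\mathcal X^0(\mathbb T)$ for $\tilde B(\theta)$,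 where $\tilde H^0(\theta)=\frac12(i\nabla+\theta)^2$, $\tilde G(\theta)=(i\nabla+\theta)^{-2}$, $\tilde S(\theta)q=e\psi^0\tilde G(\theta)[(\nabla-i\theta)\tilde\sigma(\theta,\cdot)\cdot q]$ for $q\in\mathbb C^3$, $\tilde\sigma(\theta,y)=\sum_{n\in\mathbb Z^3}e^{i\theta\cdot(n+y)}\sigma(n+y)$, $\tilde T(\theta)=\Sigma(\theta)$. Under the stated conditions $\tilde B(\theta)$ is selfadjoint and nonnegative, and for every $\theta\in\Pi^*_+$ one has the positivity $$\langle\tilde Y,\tilde B(\theta)\tilde Y\rangle\ge\varkappa(\theta)\|\tilde Y\|^2_{\mathcal X^1(\mathbb T)},\qquad\tilde Y\in\mathcal X^1(\mathbb T),$$ with some $\varkappa(\theta)>0$ (form extended by continuity, brackets denoting the scalar product of $\mathcal X^0(\mathbb T)$); the function $\varkappa:\Pi^*_+\to(0,\infty)$ in the claim is the one in this bound. Put $\tilde\Lambda(\theta)=\tilde B(\theta)^{1/2}$ and $\tilde K(\theta)=\tilde\Lambda(\theta)\,iJ\,\tilde\Lambda(\theta)$ (natural domain of the composition). *)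

theory Defs
  imports "HOL-Analysis.Analysis"
begin

section \<open>Complex inner product spaces\<close>

text \<open>The complex scalar product \<open>cinner\<close> is antilinear in its first argument.  Its real part is the
  library's real inner product, so norm, metric and topology are those of \<^class>\<open>real_inner\<close>.\<close>

class complex_inner = real_inner +
  fixes scaleC :: "complex \<Rightarrow> 'a \<Rightarrow> 'a"  (infixr \<open>*\<^sub>C\<close> 75)
    and cinner :: "'a \<Rightarrow> 'a \<Rightarrow> complex"
  assumes scaleC_add_right: "a *\<^sub>C (x + y) = a *\<^sub>C x + a *\<^sub>C y"
    and scaleC_add_left: "(a + b) *\<^sub>C x = a *\<^sub>C x + b *\<^sub>C x"
    and scaleC_scaleC: "a *\<^sub>C b *\<^sub>C x = (a * b) *\<^sub>C x"
    and scaleC_of_real: "complex_of_real r *\<^sub>C x = r *\<^sub>R x"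
    and cinner_commute: "cinner x y = cnj (cinner y x)"
    and cinner_add_right: "cinner x (y + z) = cinner x y + cinner x z"
    and cinner_scaleC_right: "cinner x (a *\<^sub>C y) = a * cinner x y"
    and Re_cinner: "Re (cinner x y) = inner x y"

instantiation complex :: complex_inner
begin

definition "a *\<^sub>C x = a * (x :: complex)"
definition "cinner x y = cnj x * (y :: complex)"

instance
  by standard
    (simp_all add: scaleC_complex_def cinner_complex_def algebra_simps scaleR_conv_of_real
      inner_complex_def)

end

instantiation prod :: (complex_inner, complex_inner) complex_inner
begin

definition "a *\<^sub>C x = (a *\<^sub>C fst x, a *\<^sub>C snd x)"
definition "cinner x y = cinner (fst x) (fst y) + cinner (snd x) (snd y)"

instance
proof
  fix x y :: "'a \<times> 'b"
  show "cinner x y = cnj (cinner y x)"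
    by (simp add: cinner_prod_def cinner_commute [of "fst x"] cinner_commute [of "snd x"])
qed (simp_all add: scaleC_prod_def cinner_prod_def inner_prod_def prod_eq_iff scaleC_add_right
      scaleC_add_left scaleC_scaleC scaleC_of_real cinner_add_right cinner_scaleC_right Re_cinner
      distrib_left)

end

instantiation vec :: (complex_inner, finite) complex_inner
begin

definition "a *\<^sub>C x = (\<chi> i. a *\<^sub>C x $ i)"
definition "cinner x y = (\<Sum>i\<in>UNIV. cinner (x $ i) (y $ i))"

instance
proof
  fix x y :: "('a, 'b) vec"
  show "cinner x y = cnj (cinner y x)"
    unfolding cinner_vec_def cnj_sum by (rule sum.cong) (auto intro: cinner_commute)
qed (simp_all add: scaleC_vec_def cinner_vec_def inner_vec_def vec_eq_iff scaleC_add_right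
      scaleC_add_left scaleC_scaleC scaleC_of_real cinner_add_right cinner_scaleC_right Re_cinner
      sum.distrib sum_distrib_left)

end


section \<open>Unbounded operators\<close>

text \<open>An operator is represented by its graph: \<open>Domain A\<close> is its domain, \<open>A O B\<close> the composition
  (first \<open>A\<close>, then \<open>B\<close>) on its natural domain, and the converse of \<open>A\<close> its inverse.\<close>

type_synonym ('a, 'b) operator = "('a \<times> 'b) set"

definition operator_on :: "'a set \<Rightarrow> ('a \<Rightarrow> 'b) \<Rightarrow> ('a, 'b) operator" where
  "operator_on D f = {(x, f x) | x. x \<in> D}"

definition linear_operator :: "('a::complex_inner, 'b::complex_inner) operator \<Rightarrow> bool" where
  "linear_operator A \<longleftrightarrow>
     single_valued A \<and> (0, 0) \<in> A \<and>
     (\<forall>x y x' y'. (x, y) \<in> A \<longrightarrow> (x', y') \<in> A \<longrightarrow> (x + x', y + y') \<in> A) \<and>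
     (\<forall>c x y. (x, y) \<in> A \<longrightarrow> (c *\<^sub>C x, c *\<^sub>C y) \<in> A)"

definition adjoint_operator ::
    "('a::complex_inner, 'b::complex_inner) operator \<Rightarrow> ('b, 'a) operator" where
  "adjoint_operator A = {(u, v). \<forall>(x, y) \<in> A. cinner u y = cinner v x}"

definition selfadjoint :: "('a::complex_inner, 'a) operator \<Rightarrow> bool" where
  "selfadjoint A \<longleftrightarrow>
     linear_operator A \<and> closure (Domain A) = UNIV \<and> adjoint_operator A = A"

definition nonneg_operator :: "('a::complex_inner, 'a) operator \<Rightarrow> bool" where
  "nonneg_operator A \<longleftrightarrow> (\<forall>(x, y) \<in> A. 0 \<le> Re (cinner x y))"

text \<open>A nonnegative selfadjoint operator in a Hilbert space has exactly one nonnegative selfadjoint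
  square root, so the choice is unambiguous.\<close>

definition sqrt_operator :: "('a::complex_inner, 'a) operator \<Rightarrow> ('a, 'a) operator" where
  "sqrt_operator A = (SOME L. selfadjoint L \<and> nonneg_operator L \<and> L O L = A)"

definition compact_operator :: "('a::complex_inner, 'b::complex_inner) operator \<Rightarrow> bool" where
  "compact_operator A \<longleftrightarrow>
     linear_operator A \<and> Domain A = UNIV \<and> compact (closure (A `` ball 0 1))"

definition cadjoint :: "('a::complex_inner \<Rightarrow> 'b::complex_inner) \<Rightarrow> 'b \<Rightarrow> 'a" where
  "cadjoint f = (SOME g. \<forall>x y. cinner (f x) y = cinner x (g y))"


section \<open>The Hilbert space $L^2$ of the torus\<close>

text \<open>The torus $\mathbb{R}^3/\mathbb{Z}^3$ is represented by the fundamental cell $[0,1]^3$, whose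
  faces form a null set.\<close>

abbreviation torus :: "(real^3) measure" where
  "torus \<equiv> lebesgue_on (cbox 0 1)"

definition sq_integrable :: "(real^3 \<Rightarrow> complex) \<Rightarrow> bool" where
  "sq_integrable f \<longleftrightarrow>
     f \<in> borel_measurable torus \<and> integrable torus (\<lambda>x. (cmod (f x))\<^sup>2)"

definition l2rel :: "(real^3 \<Rightarrow> complex) \<Rightarrow> (real^3 \<Rightarrow> complex) \<Rightarrow> bool" where
  "l2rel f g \<longleftrightarrow> sq_integrable f \<and> sq_integrable g \<and> (AE x in torus. f x = g x)"

lemma sq_integrable_mult:
  assumes "sq_integrable f" "sq_integrable g"
  shows "integrable torus (\<lambda>x. cnj (f x) * g x)"
proof (rule Bochner_Integration.integrable_bound)
  show "integrable torus (\<lambda>x. (cmod (f x))\<^sup>2 + (cmod (g x))\<^sup>2)"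
    using assms by (auto simp: sq_integrable_def)
  have [measurable]: "f \<in> borel_measurable torus" "g \<in> borel_measurable torus"
    using assms by (auto simp: sq_integrable_def)
  show "(\<lambda>x. cnj (f x) * g x) \<in> borel_measurable torus"
    by (intro borel_measurable_times borel_measurable_continuous_on [where f = cnj])
       (auto intro: continuous_intros)
  have "a * b \<le> a\<^sup>2 + b\<^sup>2" if "0 \<le> a" "0 \<le> b" for a b :: real
    using sum_squares_bound [of a b] mult_nonneg_nonneg [OF that] by linarith
  then show "AE x in torus. norm (cnj (f x) * g x) \<le> norm ((cmod (f x))\<^sup>2 + (cmod (g x))\<^sup>2)"
    by (intro AE_I2) (simp add: norm_mult)
qed

lemma sq_integrable_zero: "sq_integrable (\<lambda>x. 0)"
  by (simp add: sq_integrable_def)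

lemma sq_integrable_scale: "sq_integrable f \<Longrightarrow> sq_integrable (\<lambda>x. c * f x)"
  by (auto simp: sq_integrable_def norm_mult power_mult_distrib)

lemma sq_integrable_add:
  assumes "sq_integrable f" "sq_integrable g"
  shows "sq_integrable (\<lambda>x. f x + g x)"
proof -
  have [measurable]: "f \<in> borel_measurable torus" "g \<in> borel_measurable torus"
    using assms by (auto simp: sq_integrable_def)
  have "integrable torus (\<lambda>x. (cmod (f x + g x))\<^sup>2)"
  proof (rule Bochner_Integration.integrable_bound)
    show "integrable torus (\<lambda>x. 2 * (cmod (f x))\<^sup>2 + 2 * (cmod (g x))\<^sup>2)"
      using assms by (auto simp: sq_integrable_def)
    have "(cmod (a + b))\<^sup>2 \<le> 2 * (cmod a)\<^sup>2 + 2 * (cmod b)\<^sup>2" for a b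
    proof -
      have "(cmod (a + b))\<^sup>2 \<le> (cmod a + cmod b)\<^sup>2"
        by (intro power_mono norm_triangle_ineq) simp
      also have "\<dots> \<le> 2 * (cmod a)\<^sup>2 + 2 * (cmod b)\<^sup>2"
        using sum_squares_bound [of "cmod a" "cmod b"] by (simp add: power2_sum)
      finally show ?thesis .
    qed
    then show "AE x in torus. norm ((cmod (f x + g x))\<^sup>2)
                 \<le> norm (2 * (cmod (f x))\<^sup>2 + 2 * (cmod (g x))\<^sup>2)"
      by (intro AE_I2) simp
  qed measurable
  then show ?thesis
    by (simp add: sq_integrable_def)
qed

quotient_type l2torus = "real^3 \<Rightarrow> complex" / partial: l2rel
proof (rule part_equivpI)
  show "\<exists>f. l2rel f f"
    by (rule exI [of _ "\<lambda>x. 0"]) (simp add: l2rel_def sq_integrable_zero)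
  show "symp l2rel"
    by (auto simp: symp_def l2rel_def)
  show "transp l2rel"
    by (auto simp: transp_def l2rel_def elim!: AE_mp)
qed

instantiation l2torus :: complex_inner
begin

lift_definition zero_l2torus :: l2torus is "\<lambda>x. 0"
  by (simp add: l2rel_def sq_integrable_zero)

lift_definition plus_l2torus :: "l2torus \<Rightarrow> l2torus \<Rightarrow> l2torus" is "\<lambda>f g x. f x + g x"
  by (auto simp: l2rel_def sq_integrable_add)

lift_definition scaleC_l2torus :: "complex \<Rightarrow> l2torus \<Rightarrow> l2torus" is "\<lambda>c f x. c * f x"
  by (auto simp: l2rel_def sq_integrable_scale)

lift_definition cinner_l2torus :: "l2torus \<Rightarrow> l2torus \<Rightarrow> complex"
  is "\<lambda>f g. \<integral>x. cnj (f x) * g x \<partial>torus"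
proof -
  fix f f' g g' assume "l2rel f f'" "l2rel g g'"
  then show "(\<integral>x. cnj (f x) * g x \<partial>torus) = (\<integral>x. cnj (f' x) * g' x \<partial>torus)"
    by (intro integral_cong_AE)
       (auto simp: l2rel_def dest: borel_measurable_integrable intro!: borel_measurable_integrable
             sq_integrable_mult)
qed

definition "r *\<^sub>R (u :: l2torus) = complex_of_real r *\<^sub>C u"
definition "- (u :: l2torus) = (- 1) *\<^sub>C u"
definition "(u :: l2torus) - v = u + - v"
definition "inner (u :: l2torus) v = Re (cinner u v)"
definition "norm (u :: l2torus) = sqrt (inner u u)"
definition "sgn (u :: l2torus) = inverse (norm u) *\<^sub>R u"
definition "dist (u :: l2torus) v = norm (u - v)"
definition "uniformity = (INF e\<in>{0<..}. principal {(u :: l2torus, v). dist u v < e})"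
definition "open (U :: l2torus set) \<longleftrightarrow> (\<forall>u\<in>U. \<forall>\<^sub>F (u', v) in uniformity. u' = u \<longrightarrow> v \<in> U)"

instance
proof
  fix u v w :: l2torus and a b :: complex and r s :: real
  show add_assoc: "u + v + w = u + (v + w)"
    by transfer (auto simp: l2rel_def sq_integrable_add add.assoc)
  show "u + v = v + u"
    by transfer (auto simp: l2rel_def sq_integrable_add add.commute)
  show "0 + u = u"
    by transfer (auto simp: l2rel_def)
  show "- u + u = 0"
    unfolding uminus_l2torus_def by transfer (auto simp: l2rel_def sq_integrable_zero)
  show "u - v = u + - v"
    by (rule minus_l2torus_def)
  show add_right: "a *\<^sub>C (u + v) = a *\<^sub>C u + a *\<^sub>C v" for a :: complex and u v :: l2torus
    by transfer (auto simp: l2rel_def sq_integrable_add sq_integrable_scale distrib_left)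
  show add_left: "(a + b) *\<^sub>C u = a *\<^sub>C u + b *\<^sub>C u" for a b :: complex and u :: l2torus
    by transfer (auto simp: l2rel_def sq_integrable_add sq_integrable_scale distrib_right)
  show scale_scale: "a *\<^sub>C b *\<^sub>C u = (a * b) *\<^sub>C u" for a b :: complex and u :: l2torus
    by transfer (auto simp: l2rel_def sq_integrable_scale mult.assoc)
  show "complex_of_real r *\<^sub>C u = r *\<^sub>R u"
    by (simp add: scaleR_l2torus_def)
  show "r *\<^sub>R (u + v) = r *\<^sub>R u + r *\<^sub>R v" "(r + s) *\<^sub>R u = r *\<^sub>R u + s *\<^sub>R u"
    "r *\<^sub>R s *\<^sub>R u = (r * s) *\<^sub>R u"
    by (simp_all add: scaleR_l2torus_def add_right add_left scale_scale)
  show "1 *\<^sub>R u = u"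
    unfolding scaleR_l2torus_def by transfer (auto simp: l2rel_def)
  show cinner_comm: "cinner u v = cnj (cinner v u)" for u v :: l2torus
    by transfer (simp add: mult.commute flip: Bochner_Integration.integral_cnj)
  show cinner_add: "cinner u (v + w) = cinner u v + cinner u w" for u v w :: l2torus
    by transfer (simp add: distrib_left l2rel_def sq_integrable_mult)
  show cinner_scale: "cinner u (a *\<^sub>C v) = a * cinner u v" for a and u v :: l2torus
    by transfer (simp add: mult.left_commute)
  show "Re (cinner u v) = inner u v"
    by (simp add: inner_l2torus_def)
  show "inner u v = inner v u"
    unfolding inner_l2torus_def by (subst cinner_comm) simp
  show "inner (u + v) w = inner u w + inner v w"
    unfolding inner_l2torus_def
    by (subst (1 2 3) cinner_comm) (simp add: cinner_add)
  show "inner (r *\<^sub>R u) v = r * inner u v"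
    unfolding inner_l2torus_def scaleR_l2torus_def
    by (subst (1 2) cinner_comm) (simp add: cinner_scale)
  have sq: "cnj z * z = complex_of_real ((cmod z)\<^sup>2)" for z
    by (metis complex_norm_square mult.commute of_real_power)
  show "0 \<le> inner u u"
    unfolding inner_l2torus_def by transfer (simp add: sq del: of_real_power)
  show "inner u u = 0 \<longleftrightarrow> u = 0"
    unfolding inner_l2torus_def
    by transfer
       (auto simp: sq l2rel_def sq_integrable_def integral_nonneg_eq_0_iff_AE
             simp del: of_real_power)
  show "norm u = sqrt (inner u u)"
    by (rule norm_l2torus_def)
  show "sgn u = inverse (norm u) *\<^sub>R u"
    by (rule sgn_l2torus_def)
  show "dist u v = norm (u - v)"
    by (rule dist_l2torus_def)
  show "uniformity = (INF e\<in>{0<..}. principal {(u :: l2torus, v). dist u v < e})"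
    by (rule uniformity_l2torus_def)
  show "open U \<longleftrightarrow> (\<forall>u\<in>U. \<forall>\<^sub>F (u', v) in uniformity. u' = u \<longrightarrow> v \<in> U)" for U :: "l2torus set"
    by (rule open_l2torus_def)
qed

end


section \<open>Fourier coefficients and Sobolev spaces\<close>

definition lattice_point :: "int^3 \<Rightarrow> real^3" where
  "lattice_point m = (\<chi> i. real_of_int (m $ i))"

text \<open>The coefficients \<open>f\<^sub>m\<close> are normalised so that \<open>f(x)\<close> is the sum of the \<open>f\<^sub>m exp(- 2\<pi>i m\<cdot>x)\<close>; hence
  \<open>i\<nabla> + \<theta>\<close> acts on periodic functions and distributions as the multiplication of the Fourier
  coefficients by \<open>2\<pi>m + \<theta>\<close>.\<close>

definition fourier_coeff :: "(real^3 \<Rightarrow> complex) \<Rightarrow> int^3 \<Rightarrow> complex" where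
  "fourier_coeff f m = (\<integral>x. cis (2 * pi * (lattice_point m \<bullet> x)) * f x \<partial>torus)"

lift_definition l2_coeff :: "l2torus \<Rightarrow> int^3 \<Rightarrow> complex" is fourier_coeff
proof
  fix f g :: "real^3 \<Rightarrow> complex" and m
  assume *: "l2rel f g"
  then have [measurable]: "f \<in> borel_measurable torus" "g \<in> borel_measurable torus"
    by (auto simp: l2rel_def sq_integrable_def)
  have [measurable]: "(\<lambda>x. cis (2 * pi * (lattice_point m \<bullet> x))) \<in> borel_measurable torus"
    by (intro measurable_restrict_space1 measurable_completion) 
       (auto intro!: borel_measurable_continuous_onI continuous_intros)
  show "fourier_coeff f m = fourier_coeff g m"
    unfolding fourier_coeff_def
    by (rule integral_cong_AE) (use * in \<open>auto simp: l2rel_def\<close>)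
qed

definition of_coeffs :: "(int^3 \<Rightarrow> complex) \<Rightarrow> l2torus" where
  "of_coeffs c = (THE u. \<forall>m. l2_coeff u m = c m)"

definition sobolev_space :: "real \<Rightarrow> l2torus set" where
  "sobolev_space s =
     {u. (\<lambda>m. (1 + (norm (2 * pi *\<^sub>R lattice_point m))\<^sup>2) powr s * (cmod (l2_coeff u m))\<^sup>2)
           summable_on UNIV}"

definition sobolev_norm :: "real \<Rightarrow> l2torus \<Rightarrow> real" where
  "sobolev_norm s u =
     sqrt (\<Sum>\<^sub>\<infinity>m. (1 + (norm (2 * pi *\<^sub>R lattice_point m))\<^sup>2) powr s * (cmod (l2_coeff u m))\<^sup>2)"

text \<open>The product Hilbert space is a product type; the spaces of higher regularity are subsets of it.\<close>

type_synonym xtorus = "l2torus \<times> l2torus \<times> (complex^3) \<times> (complex^3)"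

definition X_space :: "real \<Rightarrow> xtorus set" where
  "X_space s = sobolev_space s \<times> sobolev_space s \<times> UNIV \<times> UNIV"

definition X_norm :: "real \<Rightarrow> xtorus \<Rightarrow> real" where
  "X_norm s = (\<lambda>(f, g, q, p).
     sqrt ((sobolev_norm s f)\<^sup>2 + (sobolev_norm s g)\<^sup>2 + (norm q)\<^sup>2 + (norm p)\<^sup>2))"

text \<open>The value \<open>b\<close> at \<open>Y\<close> of the quadratic form of \<open>A\<close>, extended by continuity with respect to the
  norm \<open>X_norm 1\<close>.\<close>

definition form_value :: "(xtorus, xtorus) operator \<Rightarrow> xtorus \<Rightarrow> real \<Rightarrow> bool" where
  "form_value A Y b \<longleftrightarrow>
     (\<exists>V W. (\<forall>n. (V n, W n) \<in> A) \<and> (\<lambda>n. X_norm 1 (V n - Y)) \<longlonglongrightarrow> 0 \<and>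
            (\<lambda>n. cinner (V n) (W n)) \<longlonglongrightarrow> complex_of_real b)"


section \<open>Test functions and the distributional Laplacian\<close>

definition partial_deriv :: "'a::euclidean_space \<Rightarrow> ('a \<Rightarrow> real) \<Rightarrow> 'a \<Rightarrow> real" where
  "partial_deriv b f x = deriv (\<lambda>t. f (x + t *\<^sub>R b)) 0"

definition smooth :: "('a::euclidean_space \<Rightarrow> real) \<Rightarrow> bool" where
  "smooth f \<longleftrightarrow>
     (\<forall>bs. set bs \<subseteq> Basis \<longrightarrow>
        continuous_on UNIV (foldr partial_deriv bs f) \<and>
        (\<forall>b\<in>Basis. \<forall>x. (\<lambda>t. foldr partial_deriv bs f (x + t *\<^sub>R b)) differentiable (at 0)))"

definition test_function :: "('a::euclidean_space \<Rightarrow> real) \<Rightarrow> bool" where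
  "test_function \<phi> \<longleftrightarrow> smooth \<phi> \<and> compact (closure {x. \<phi> x \<noteq> 0})"

definition laplacian :: "('a::euclidean_space \<Rightarrow> real) \<Rightarrow> 'a \<Rightarrow> real" where
  "laplacian f x = (\<Sum>b\<in>Basis. partial_deriv b (partial_deriv b f) x)"

definition laplacian_minus_one_in_L1 :: "('a::euclidean_space \<Rightarrow> real) \<Rightarrow> bool" where
  "laplacian_minus_one_in_L1 \<sigma> \<longleftrightarrow>
     (\<exists>g. integrable lebesgue g \<and>
        (\<forall>\<phi>. test_function \<phi> \<longrightarrow>
           (\<integral>x. \<sigma> x * (laplacian \<phi> x - \<phi> x) \<partial>lebesgue) = (\<integral>x. g x * \<phi> x \<partial>lebesgue)))"


section \<open>The ion charge density and the Wiener and Jellium conditions\<close>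

definition fourier_transform :: "(real^3 \<Rightarrow> real) \<Rightarrow> real^3 \<Rightarrow> complex" where
  "fourier_transform \<sigma> \<xi> = (\<integral>x. cis (\<xi> \<bullet> x) * complex_of_real (\<sigma> x) \<partial>lebesgue)"

definition xi :: "real^3 \<Rightarrow> int^3 \<Rightarrow> real^3" where
  "xi \<theta> m = 2 * pi *\<^sub>R lattice_point m + \<theta>"

definition Gamma_star :: "(real^3) set" where
  "Gamma_star = range (\<lambda>m. 2 * pi *\<^sub>R lattice_point m)"

definition Pi_star :: "(real^3) set" where
  "Pi_star = cbox 0 (vec (2 * pi))"

definition Sigma_mat :: "(real^3 \<Rightarrow> real) \<Rightarrow> real^3 \<Rightarrow> complex^3^3" where
  "Sigma_mat \<sigma> \<theta> = (\<chi> i j. \<Sum>\<^sub>\<infinity>m. complex_of_real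
     (xi \<theta> m $ i * xi \<theta> m $ j / (norm (xi \<theta> m))\<^sup>2 * (cmod (fourier_transform \<sigma> (xi \<theta> m)))\<^sup>2))"

definition positive_definite :: "complex^'n^'n \<Rightarrow> bool" where
  "positive_definite A \<longleftrightarrow>
     (\<forall>q. q \<noteq> 0 \<longrightarrow> (\<exists>r>0. cinner q (A *v q) = complex_of_real r))"

definition Pi_star_plus :: "(real^3 \<Rightarrow> real) \<Rightarrow> (real^3) set" where
  "Pi_star_plus \<sigma> = {\<theta> \<in> Pi_star - Gamma_star. positive_definite (Sigma_mat \<sigma> \<theta>)}"

definition Wiener_condition :: "(real^3 \<Rightarrow> real) \<Rightarrow> bool" where
  "Wiener_condition \<sigma> \<longleftrightarrow>
     (AE \<theta> in lebesgue. \<theta> \<in> Pi_star - Gamma_star \<longrightarrow> positive_definite (Sigma_mat \<sigma> \<theta>))"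

definition Jellium_condition :: "(real^3 \<Rightarrow> real) \<Rightarrow> bool" where
  "Jellium_condition \<sigma> \<longleftrightarrow>
     (\<forall>m. m \<noteq> 0 \<longrightarrow> fourier_transform \<sigma> (2 * pi *\<^sub>R lattice_point m) = 0)"


section \<open>The Bloch operators\<close>

definition fourier_multiplier :: "real^3 \<Rightarrow> (real^3 \<Rightarrow> complex) \<Rightarrow> l2torus \<Rightarrow> l2torus" where
  "fourier_multiplier \<theta> a u = of_coeffs (\<lambda>m. a (xi \<theta> m) * l2_coeff u m)"

text \<open>\<open>H0_op\<close> is \<open>(i\<nabla> + \<theta>)\<^sup>2 / 2\<close>, to be applied on \<open>sobolev_space 2\<close> only; \<open>G_op\<close> is the inverse
  of \<open>(i\<nabla> + \<theta>)\<^sup>2\<close>.\<close>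

definition H0_op :: "real^3 \<Rightarrow> l2torus \<Rightarrow> l2torus" where
  "H0_op \<theta> = fourier_multiplier \<theta> (\<lambda>\<xi>. complex_of_real ((norm \<xi>)\<^sup>2 / 2))"

definition G_op :: "real^3 \<Rightarrow> l2torus \<Rightarrow> l2torus" where
  "G_op \<theta> = fourier_multiplier \<theta> (\<lambda>\<xi>. complex_of_real (1 / (norm \<xi>)\<^sup>2))"

definition sigma_tilde :: "(real^3 \<Rightarrow> real) \<Rightarrow> real^3 \<Rightarrow> real^3 \<Rightarrow> complex" where
  "sigma_tilde \<sigma> \<theta> y =
     (\<Sum>\<^sub>\<infinity>n. cis (\<theta> \<bullet> (lattice_point n + y)) * complex_of_real (\<sigma> (lattice_point n + y)))"

text \<open>\<open>(\<nabla> - i\<theta>)\<sigma>\<cdot>q = - i (i\<nabla> + \<theta>)\<sigma>\<cdot>q\<close> is in general a distribution only; hence \<open>G\<close> is applied to its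
  Fourier coefficients.\<close>

definition S_op :: "real \<Rightarrow> real \<Rightarrow> (real^3 \<Rightarrow> real) \<Rightarrow> real^3 \<Rightarrow> complex^3 \<Rightarrow> l2torus" where
  "S_op e Z \<sigma> \<theta> q = (e * sqrt Z) *\<^sub>R of_coeffs (\<lambda>m.
     complex_of_real (1 / (norm (xi \<theta> m))\<^sup>2) *
     (\<Sum>j\<in>UNIV. (- \<i> * complex_of_real (xi \<theta> m $ j) * fourier_coeff (sigma_tilde \<sigma> \<theta>) m) * q $ j))"

definition B_op :: "real \<Rightarrow> real \<Rightarrow> real \<Rightarrow> (real^3 \<Rightarrow> real) \<Rightarrow> real^3 \<Rightarrow> (xtorus, xtorus) operator"
  where
  "B_op e M Z \<sigma> \<theta> = operator_on (X_space 2) (\<lambda>(f, g, q, p).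
     (2 *\<^sub>R H0_op \<theta> f + (4 * e\<^sup>2) *\<^sub>R sqrt Z *\<^sub>R G_op \<theta> (sqrt Z *\<^sub>R f) + 2 *\<^sub>R S_op e Z \<sigma> \<theta> q,
      2 *\<^sub>R H0_op \<theta> g,
      2 *\<^sub>R cadjoint (S_op e Z \<sigma> \<theta>) f + Sigma_mat \<sigma> \<theta> *v q,
      (1 / M) *\<^sub>R p))"

definition J_op :: "xtorus \<Rightarrow> xtorus" where
  "J_op = (\<lambda>(f, g, q, p). ((1/2) *\<^sub>R g, - (1/2) *\<^sub>R f, p, - q))"

definition Lambda_op ::
    "real \<Rightarrow> real \<Rightarrow> real \<Rightarrow> (real^3 \<Rightarrow> real) \<Rightarrow> real^3 \<Rightarrow> (xtorus, xtorus) operator" where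
  "Lambda_op e M Z \<sigma> \<theta> = sqrt_operator (B_op e M Z \<sigma> \<theta>)"

definition K_op ::
    "real \<Rightarrow> real \<Rightarrow> real \<Rightarrow> (real^3 \<Rightarrow> real) \<Rightarrow> real^3 \<Rightarrow> (xtorus, xtorus) operator" where
  "K_op e M Z \<sigma> \<theta> =
     Lambda_op e M Z \<sigma> \<theta> O operator_on UNIV (\<lambda>Y. \<i> *\<^sub>C J_op Y) O Lambda_op e M Z \<sigma> \<theta>"

end

theory Submission
  imports Defs
begin

text \<open>The operator \<open>B\<close> is the inverse of a bounded positive operator \<open>R\<close>: it is symmetric and coercive, and
  after elimination of the field component the equation \<open>B Y = W\<close> becomes an injective linear system in
  \<open>\<complex>\<^sup>3\<close>.  Hence every admissible root is \<open>\<Lambda> = S\<^sup>-\<^sup>1\<close> with a bounded symmetric \<open>S\<close>, \<open>S\<^sup>2 = R\<close>, and \<open>K\<close> is the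
  inverse of the bounded symmetric injective operator \<open>T = S (iJ)\<^sup>-\<^sup>1 S\<close> with dense range.  Compactness
  follows from the compact embedding of \<open>H\<^sup>1\<close> into \<open>L\<^sup>2\<close>.

  Applying coercivity to each factor \<open>S\<close> would only give the bound \<open>C / \<kappa>\<^sup>2\<close>.  One power of \<open>\<kappa>\<close> is gained as
  follows.  With \<open>\<omega> = |2\<pi>m + \<theta>|\<close>, the energy is
  \<open>\<Sum>\<^sub>m \<omega>\<^sup>2 (|f\<^sub>m|\<^sup>2 + |g\<^sub>m|\<^sup>2) + |\<beta>\<^sub>m f\<^sub>m + \<langle>a\<^sub>m, q\<rangle>|\<^sup>2 + |p|\<^sup>2 / M\<close>, where \<open>\<beta>\<^sub>m\<close> is of order \<open>\<omega>\<^sup>-\<^sup>1\<close>.  Its second square bounds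
  \<open>\<parallel>\<omega>\<^sup>-\<^sup>1 f\<parallel>\<^sup>2\<close> by \<open>C / \<kappa>\<close> times the energy, while \<open>\<parallel>\<omega> g\<parallel>\<^sup>2\<close> and \<open>|p|\<^sup>2\<close> are bounded by it without loss.  As \<open>J\<close> pairs
  \<open>f\<close> with \<open>g\<close> and \<open>q\<close> with \<open>p\<close>, this estimates \<open>S (iJ)\<^sup>-\<^sup>1 S\<close> by duality.\<close>

section \<open>Complex inner product spaces\<close>

text \<open>The constant must not see how close \<open>\<theta>\<close> is to the dual lattice.
  There one frequency \<open>2 \<pi> m + \<theta>\<close> becomes arbitrarily short and bounds such
  as that for \<open>G_op\<close> blow up; such bounds serve only to show that objects exist and lie
  in the right spaces. Quantitatively, the weight \<open>1 + |2 \<pi> m|^2\<close> is at most a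
  numerical constant plus \<open>2 \<omega>^2\<close>. The second part is energy. The first part is
  an L2 norm, which a short frequency does not control; it is this L2 norm of the solution for which
  the duality argument is needed. Terms that arrive without a factor \<open>1 / \<kappa>\<close> are
  absorbed by means of \<open>\<kappa> \<le> 1 / M\<close>. The root is defined by choice. A fixed
  point iteration for bounded positive maps, in place of spectral theory, shows that a root exists.
  The argument then works with whichever root was chosen: its square is onto with trivial kernel, so
  it has both properties itself, and selfadjointness makes its inverse symmetric.\<close>

lemma cinner_add_left: "cinner (x + y) z = cinner x z + cinner y z"
  by (subst (1 2 3) cinner_commute) (simp add: cinner_add_right)

lemma scaleC_one [simp]: "1 *\<^sub>C (x::'a::complex_inner) = x"
  using scaleC_of_real[of 1 x] by simp

lemma cinner_scaleC_left: "cinner (a *\<^sub>C x) y = cnj a * cinner x y"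
  by (subst (1 2) cinner_commute) (simp add: cinner_scaleC_right)

lemma cinner_scaleR_left: "cinner (r *\<^sub>R x) y = r *\<^sub>R cinner x y"
  by (simp add: cinner_scaleC_left scaleR_conv_of_real flip: scaleC_of_real)

lemma cinner_scaleR_right: "cinner x (r *\<^sub>R y) = r *\<^sub>R cinner x y"
  by (simp add: cinner_scaleC_right scaleR_conv_of_real flip: scaleC_of_real)

lemma cinner_same: "cinner x x = of_real ((norm x)\<^sup>2)"
proof -
  have "Im (cinner x x) = 0"
    using arg_cong[OF cinner_commute[of x x], of Im] by simp
  then show ?thesis
    by (simp add: complex_eq_iff Re_cinner power2_norm_eq_inner del: of_real_power)
qed

lemma norm_scaleC: "norm (a *\<^sub>C x) = cmod a * norm (x::'a::complex_inner)"
proof -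
  have "complex_of_real ((norm (a *\<^sub>C x))\<^sup>2) = cnj a * a * of_real ((norm x)\<^sup>2)"
    unfolding cinner_same[symmetric] by (simp add: cinner_scaleC_left cinner_scaleC_right mult_ac)
  also have "\<dots> = of_real ((cmod a * norm x)\<^sup>2)"
    using complex_norm_square[of a] by (simp add: power_mult_distrib mult_ac)
  finally have "(norm (a *\<^sub>C x))\<^sup>2 = (cmod a * norm x)\<^sup>2"
    unfolding of_real_eq_iff .
  then show ?thesis
    by (simp add: power2_eq_iff_nonneg)
qed

lemma cmod_cinner_le: "cmod (cinner x y) \<le> norm x * norm y"
proof (cases "cinner x y = 0")
  case False
  \<comment> \<open>A phase factor turns \<open>cinner x y\<close> into its modulus, which reduces
    the claim to the real Cauchy-Schwarz inequality.\<close>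
  define c where "c = cnj (sgn (cinner x y))"
  have c: "cmod c = 1"
    using False by (simp add: c_def norm_sgn)
  have "c * cinner x y = of_real (cmod (cinner x y))"
    using False unfolding c_def sgn_eq 
    by (simp add: field_simps complex_norm_square[symmetric] power2_eq_square[symmetric])
  then have "cmod (cinner x y) = Re (cinner x (c *\<^sub>C y))"
    by (simp add: cinner_scaleC_right)
  also have "\<dots> \<le> norm x * norm (c *\<^sub>C y)"
    unfolding Re_cinner by (rule norm_cauchy_schwarz)
  finally show ?thesis
    by (simp add: norm_scaleC c)
qed simp

lemma bounded_bilinear_cinner: "bounded_bilinear cinner"
  by (rule bounded_bilinear.intro)
     (auto simp: cinner_add_left cinner_add_right cinner_scaleR_left cinner_scaleR_right
       intro!: exI[of _ 1] cmod_cinner_le)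

lemma bounded_bilinear_scaleC: "bounded_bilinear (scaleC :: complex \<Rightarrow> 'a::complex_inner \<Rightarrow> 'a)"
  by (rule bounded_bilinear.intro)
     (auto simp: scaleC_add_left scaleC_add_right scaleC_scaleC scaleR_conv_of_real norm_scaleC mult.commute
       intro!: exI[of _ 1] simp flip: scaleC_of_real)

lemmas cinner_simps [simp] =
  bounded_bilinear.zero_left[OF bounded_bilinear_cinner]
  bounded_bilinear.zero_right[OF bounded_bilinear_cinner]
  bounded_bilinear.minus_left[OF bounded_bilinear_cinner]
  bounded_bilinear.minus_right[OF bounded_bilinear_cinner]
  bounded_bilinear.zero_left[OF bounded_bilinear_scaleC]

lemmas cinner_diff_left = bounded_bilinear.diff_left[OF bounded_bilinear_cinner]
lemmas cinner_diff_right = bounded_bilinear.diff_right[OF bounded_bilinear_cinner]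
lemmas tendsto_cinner = bounded_bilinear.tendsto[OF bounded_bilinear_cinner]

lemma cinner_ext:
  assumes "\<And>y. cinner u y = cinner v y"
  shows "u = v"
proof -
  have "cinner (u - v) (u - v) = 0"
    using assms by (simp add: cinner_diff_left)
  then show ?thesis
    by (simp add: cinner_same)
qed


section \<open>Inverses of symmetric operators\<close>

text \<open>Linearity is not built in: the identity itself forces it, because a vector is determined
  by its scalar products.\<close>

definition symmetric_map :: "('a::complex_inner \<Rightarrow> 'a) \<Rightarrow> bool" where
  "symmetric_map T \<longleftrightarrow> (\<forall>x y. cinner (T x) y = cinner x (T y))"

text \<open>All unbounded operators below take this shape. Working with the everywhere defined map
  \<open>T\<close> replaces domain questions by statements about its range; injectivity of
  \<open>T\<close> makes the graph single valued.\<close>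

definition inverse_graph :: "('b \<Rightarrow> 'a) \<Rightarrow> ('a \<times> 'b) set" where
  "inverse_graph T = {(T w, w) | w. True}"

lemma in_inverse_graph [simp]: "(x, w) \<in> inverse_graph T \<longleftrightarrow> x = T w"
  by (auto simp: inverse_graph_def)

lemma Domain_inverse_graph: "Domain (inverse_graph T) = range T"
  by (auto simp: Domain_iff)

lemma symmetric_mapD: "symmetric_map T \<Longrightarrow> cinner (T x) y = cinner x (T y)"
  by (simp add: symmetric_map_def)

lemma symmetric_map_add:
  assumes "symmetric_map T" shows "T (x + y) = T x + T y"
  by (rule cinner_ext) (simp add: symmetric_mapD[OF assms] cinner_add_left)

lemma symmetric_map_scaleC:
  assumes "symmetric_map T" shows "T (a *\<^sub>C x) = a *\<^sub>C T x"
  by (rule cinner_ext) (simp add: symmetric_mapD[OF assms] cinner_scaleC_left)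

lemma symmetric_map_zero [simp]:
  assumes "symmetric_map T" shows "T 0 = 0"
  using symmetric_map_add[OF assms, of 0 0] by simp

lemma symmetric_map_diff:
  assumes "symmetric_map T" shows "T (x - y) = T x - T y"
  using symmetric_map_add[OF assms, of "x - y" y] by simp

lemma symmetric_map_bounded_linear:
  assumes "symmetric_map T" "\<And>x. norm (T x) \<le> c * norm x"
  shows "bounded_linear T"
  by (rule bounded_linear_intro[where K = c])
     (use assms in \<open>auto simp: symmetric_map_add symmetric_map_scaleC mult.commute simp flip: scaleC_of_real\<close>)

lemma symmetric_map_compose3:
  assumes "symmetric_map S" "symmetric_map J"
  shows "symmetric_map (\<lambda>x. S (J (S x)))"
  using assms by (simp add: symmetric_map_def)

text \<open>A pair \<open>(u, v)\<close> lies in the adjoint iff \<open>u\<close> and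
  \<open>T v\<close> have the same scalar product with every \<open>w\<close>; as \<open>w\<close>
  is arbitrary, this means \<open>u = T v\<close>.\<close>

lemma adjoint_inverse_graph:
  assumes "symmetric_map T"
  shows "adjoint_operator (inverse_graph T) = inverse_graph T"
proof -
  have "(\<forall>w. cinner u w = cinner v (T w)) \<longleftrightarrow> u = T v" for u v
    using symmetric_mapD[OF assms, symmetric] cinner_ext[of u "T v"] by auto
  then show ?thesis
    by (auto simp: adjoint_operator_def inverse_graph_def)
qed

lemma linear_operator_inverse_graph:
  assumes "symmetric_map T" "inj T"
  shows "linear_operator (inverse_graph T)"
  using assms
  by (auto simp: linear_operator_def single_valued_def symmetric_map_add symmetric_map_scaleC
      dest: injD)

lemma selfadjoint_inverse_graph:
  assumes "symmetric_map T" "inj T" "closure (range T) = UNIV"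
  shows "selfadjoint (inverse_graph T)"
  using assms
  by (simp add: selfadjoint_def linear_operator_inverse_graph adjoint_inverse_graph Domain_inverse_graph)

lemma linear_operator_converse_inverse_graph:
  assumes "symmetric_map T"
  shows "linear_operator ((inverse_graph T)\<inverse>)"
  using assms
  by (auto simp: linear_operator_def single_valued_def symmetric_map_add symmetric_map_scaleC)

lemma selfadjoint_converse_inverse_graph:
  assumes "symmetric_map T"
  shows "selfadjoint ((inverse_graph T)\<inverse>)"
proof -
  \<comment> \<open>Inversion swaps the two components of a graph, hence only the two sides of the
    identity that defines the adjoint.\<close>
  have "adjoint_operator (A\<inverse>) = (adjoint_operator A)\<inverse>" for A :: "('a, 'a) operator"
    unfolding adjoint_operator_def by (auto simp: case_prod_beta) force+
  moreover have "Domain ((inverse_graph T)\<inverse>) = UNIV"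
    by auto
  ultimately show ?thesis
    using linear_operator_converse_inverse_graph[OF assms] assms
    by (simp add: selfadjoint_def adjoint_inverse_graph)
qed


section \<open>Square roots\<close>

text \<open>Fixed point iteration for \<open>1 - sqrt (1 - A)\<close>. The iterates are polynomials
  in \<open>A\<close> with nonnegative coefficients, which is behind both the commutation and the
  scalar majorant below.\<close>

fun sqrt_iter :: "'a::banach \<Rightarrow>\<^sub>L 'a \<Rightarrow> nat \<Rightarrow> 'a \<Rightarrow>\<^sub>L 'a" where
  "sqrt_iter A 0 = 0"
| "sqrt_iter A (Suc n) = (1/2) *\<^sub>R (A + (sqrt_iter A n o\<^sub>L sqrt_iter A n))"

text \<open>The same iteration with the scalar 1 for \<open>A\<close>. It increases and stays below
  1, so its increments are summable; they dominate those of \<open>sqrt_iter\<close>.\<close>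

fun sqrt_majorant :: "nat \<Rightarrow> real" where
  "sqrt_majorant 0 = 0"
| "sqrt_majorant (Suc n) = (1 + (sqrt_majorant n)\<^sup>2) / 2"

lemma sqrt_majorant_bounds: "0 \<le> sqrt_majorant n \<and> sqrt_majorant n \<le> 1"
proof (induction n)
  case (Suc n)
  then have "(sqrt_majorant n)\<^sup>2 \<le> 1" by (simp add: power_le_one)
  then show ?case by simp
qed simp

lemma sqrt_majorant_mono: "sqrt_majorant n \<le> sqrt_majorant (Suc n)"
  using sum_squares_bound[of "sqrt_majorant n" 1] by (simp add: power2_eq_square)

lemma summable_sqrt_majorant: "summable (\<lambda>n. sqrt_majorant (Suc n) - sqrt_majorant n)"
proof -
  have "incseq sqrt_majorant"
    by (rule incseq_SucI) (rule sqrt_majorant_mono)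
  then obtain l where "sqrt_majorant \<longlonglongrightarrow> l"
    using incseq_convergent[of sqrt_majorant 1] sqrt_majorant_bounds by metis
  then show ?thesis
    by (rule telescope_summable)
qed

text \<open>Used twice in a row, this shows that any two iterates commute, so that a difference of
  squares of iterates factors.\<close>

lemma blinfun_commute_sqrt_iter:
  assumes "X o\<^sub>L A = A o\<^sub>L X"
  shows "X o\<^sub>L sqrt_iter A n = sqrt_iter A n o\<^sub>L X"
proof (induction n)
  case 0
  show ?case by (auto intro: blinfun_eqI simp: blinfun.zero_left blinfun.zero_right)
next
  case (Suc n)
  have "X (sqrt_iter A n v) = sqrt_iter A n (X v)" for v
    using arg_cong[OF Suc.IH, of "\<lambda>F. blinfun_apply F v"] by simp
  moreover have "X (A v) = A (X v)" for v
    using arg_cong[OF assms, of "\<lambda>F. blinfun_apply F v"] by simp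
  ultimately show ?case
    by (intro blinfun_eqI) (simp add: blinfun.scaleR_left blinfun.scaleR_right blinfun.add_left blinfun.add_right)
qed

lemma sqrt_iter_bounds:
  fixes A :: "'a::banach \<Rightarrow>\<^sub>L 'a"
  assumes "norm A \<le> 1"
  shows "norm (sqrt_iter A n) \<le> sqrt_majorant n"
    and "norm (sqrt_iter A (Suc n) - sqrt_iter A n) \<le> sqrt_majorant (Suc n) - sqrt_majorant n"
proof -
  let ?Y = "sqrt_iter A" and ?y = sqrt_majorant
  show *: "norm (?Y n) \<le> ?y n" for n
  proof (induction n)
    case (Suc n)
    have "norm (A + (?Y n o\<^sub>L ?Y n)) \<le> norm A + norm (?Y n) * norm (?Y n)"
      by (intro order_trans[OF norm_triangle_ineq] add_left_mono norm_blinfun_compose)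
    also have "\<dots> \<le> 1 + ?y n * ?y n"
      using Suc assms sqrt_majorant_bounds[of n] by (intro add_mono mult_mono) auto
    finally show ?case by (simp add: power2_eq_square)
  qed simp
  show "norm (?Y (Suc n) - ?Y n) \<le> ?y (Suc n) - ?y n"
  proof (induction n)
    case 0
    have "(0 :: 'a \<Rightarrow>\<^sub>L 'a) o\<^sub>L 0 = 0"
      by (rule blinfun_eqI) simp
    then show ?case using assms by simp
  next
    case (Suc n)
    have "?Y (Suc n) o\<^sub>L ?Y n = ?Y n o\<^sub>L ?Y (Suc n)"
      by (metis blinfun_commute_sqrt_iter)
    then have comm: "?Y (Suc n) (?Y n v) = ?Y n (?Y (Suc n) v)" for v
      by (metis blinfun_apply_blinfun_compose)
    \<comment> \<open>The recursion turns the increment into a difference of squares; the majorant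
      satisfies the resulting factorisation as an identity of scalars.\<close>
    have "?Y (Suc (Suc n)) - ?Y (Suc n) = (1/2) *\<^sub>R ((?Y (Suc n) + ?Y n) o\<^sub>L (?Y (Suc n) - ?Y n))"
      (is "?l = ?r")
    proof (rule blinfun_eqI)
      fix v
      have "?l v = (1/2) *\<^sub>R (A v + ?Y (Suc n) (?Y (Suc n) v)) - (1/2) *\<^sub>R (A v + ?Y n (?Y n v))"
        by (simp only: sqrt_iter.simps blinfun.diff_left blinfun.scaleR_left blinfun.add_left blinfun_apply_blinfun_compose)
      also have "\<dots> = (1/2) *\<^sub>R (?Y (Suc n) (?Y (Suc n) v) - ?Y n (?Y n v))"
        by (simp add: algebra_simps)
      also have "\<dots> = ?r v"
        by (simp del: sqrt_iter.simps add: blinfun.diff_left blinfun.scaleR_left blinfun.add_left blinfun.diff_right comm)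
      finally show "?l v = ?r v" .
    qed
    also have "norm \<dots> \<le> (1/2) * (norm (?Y (Suc n) + ?Y n) * norm (?Y (Suc n) - ?Y n))"
      using norm_blinfun_compose[of "?Y (Suc n) + ?Y n" "?Y (Suc n) - ?Y n"] by simp
    also have "\<dots> \<le> (1/2) * ((?y (Suc n) + ?y n) * (?y (Suc n) - ?y n))"
      using Suc sqrt_majorant_bounds[of n] sqrt_majorant_bounds[of "Suc n"]
      by (intro mult_left_mono mult_mono order_trans[OF norm_triangle_ineq] add_mono *) auto
    also have "\<dots> = ?y (Suc (Suc n)) - ?y (Suc n)"
      by (simp add: field_simps power2_eq_square)
    finally show ?case .
  qed
qed

text \<open>The iteration solves \<open>Y = (A + Y\<^sup>2) / 2\<close>, that is \<open>(1 - Y)\<^sup>2 = 1 - A\<close>.\<close>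

lemma sqrt_iter_limit:
  fixes A :: "'a::banach \<Rightarrow>\<^sub>L 'a"
  assumes "norm A \<le> 1"
  obtains Y where "sqrt_iter A \<longlonglongrightarrow> Y" "norm Y \<le> 1" "\<And>x. 2 *\<^sub>R Y x = A x + Y (Y x)"
proof -
  have "summable (\<lambda>n. sqrt_iter A (Suc n) - sqrt_iter A n)"
    by (rule summable_comparison_test[OF _ summable_sqrt_majorant])
       (use sqrt_iter_bounds(2)[OF assms] in blast)
  then obtain s where "(\<lambda>n. \<Sum>k<n. sqrt_iter A (Suc k) - sqrt_iter A k) \<longlonglongrightarrow> s"
    unfolding summable_def sums_def by blast
  then have lim: "sqrt_iter A \<longlonglongrightarrow> s"
    by (simp only: sum_lessThan_telescope) simp
  have "norm s \<le> 1"
    by (rule LIMSEQ_le_const2[OF tendsto_norm[OF lim]])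
       (use sqrt_iter_bounds(1)[OF assms] sqrt_majorant_bounds order_trans in blast)
  moreover have "2 *\<^sub>R s x = A x + s (s x)" for x
  proof -
    have "(\<lambda>n. 2 *\<^sub>R sqrt_iter A (Suc n) x) \<longlonglongrightarrow> 2 *\<^sub>R s x"
      by (intro tendsto_intros LIMSEQ_Suc[OF lim])
    moreover have "(\<lambda>n. A x + sqrt_iter A n (sqrt_iter A n x)) \<longlonglongrightarrow> A x + s (s x)"
      by (intro tendsto_intros lim)
    moreover have "2 *\<^sub>R sqrt_iter A (Suc n) x = A x + sqrt_iter A n (sqrt_iter A n x)" for n
      by (simp add: blinfun.scaleR_left blinfun.add_left)
    ultimately show ?thesis
      using LIMSEQ_unique by (metis (no_types, lifting) ext)
  qed
  ultimately show ?thesis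
    using that lim by blast
qed

text \<open>Positivity tested on \<open>x - R x\<close>, together with the contraction bound, gives
  \<open>norm (R x)^2 \<le> inner x (R x)\<close>; expanding the square of \<open>x - R x\<close>
  then finishes.\<close>

lemma positive_map_norm_le:
  fixes R :: "'a::complex_inner \<Rightarrow> 'a"
  assumes sym: "symmetric_map R" and pos: "\<And>x. 0 \<le> Re (cinner x (R x))"
    and bound: "\<And>x. norm (R x) \<le> norm x"
  shows "norm (x - R x) \<le> norm x"
proof -
  have lin: "R (x - y) = R x - R y" for x y
    by (rule symmetric_map_diff[OF sym])
  have "0 \<le> Re (cinner (x - R x) (R (x - R x)))"
    by (rule pos)
  also have "\<dots> = inner x (R x) - 2 * (norm (R x))\<^sup>2 + inner (R x) (R (R x))"
  proof -
    have "inner x (R (R x)) = (norm (R x))\<^sup>2"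
      using symmetric_mapD[OF sym, of x "R x"] by (metis Re_cinner power2_norm_eq_inner)
    then show ?thesis
      by (simp add: Re_cinner lin inner_diff_left inner_diff_right power2_norm_eq_inner)
  qed
  also have "inner (R x) (R (R x)) \<le> norm (R x) * norm (R x)"
    using norm_cauchy_schwarz[of "R x" "R (R x)"] bound[of "R x"] mult_left_mono[OF bound[of "R x"], of "norm (R x)"] by simp
  finally have "(norm (R x))\<^sup>2 \<le> inner x (R x)"
    by (simp add: power2_eq_square)
  moreover have "0 \<le> inner x (R x)"
    using pos[of x] by (simp add: Re_cinner)
  ultimately have "(norm (x - R x))\<^sup>2 \<le> (norm x)\<^sup>2"
    by (simp add: power2_norm_eq_inner inner_diff_left inner_diff_right inner_commute)
  then show ?thesis
    by (simp add: power2_le_iff_abs_le)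
qed

text \<open>After scaling \<open>R\<close> to a contraction, the iteration for
  \<open>A = 1 - R / c\<close> converges to some \<open>Y\<close> with
  \<open>(1 - Y)^2 = R / c\<close>. Symmetry holds for each iterate and survives the limit;
  \<open>norm Y \<le> 1\<close> makes \<open>1 - Y\<close> nonnegative.\<close>

lemma bounded_sqrt_exists:
  fixes R :: "'a::{complex_inner, banach} \<Rightarrow> 'a"
  assumes sym: "symmetric_map R" and pos: "\<And>x. 0 \<le> Re (cinner x (R x))"
    and "c > 0" and bound: "\<And>x. norm (R x) \<le> c * norm x"
  obtains S where "symmetric_map S" "\<And>x. 0 \<le> Re (cinner x (S x))" "\<And>x. S (S x) = R x"
proof -
  define R' where "R' x = (1/c) *\<^sub>R R x" for x
  have R': "symmetric_map R'" "\<And>x. 0 \<le> Re (cinner x (R' x))" "\<And>x. norm (R' x) \<le> norm x"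
    using sym pos bound \<open>c > 0\<close>
    by (auto simp: R'_def symmetric_map_def cinner_scaleR_left cinner_scaleR_right field_simps)
  have "bounded_linear R'"
    by (rule symmetric_map_bounded_linear[where c = 1]) (use R' in auto)
  then have bl: "bounded_linear (\<lambda>x. x - R' x)"
    by (intro bounded_linear_sub bounded_linear_ident)
  define A where "A = Blinfun (\<lambda>x. x - R' x)"
  have A: "A x = x - R' x" for x
    unfolding A_def by (rule bounded_linear_Blinfun_apply[OF bl, THEN fun_cong])
  have "norm A \<le> 1"
    by (rule norm_blinfun_bound) (use positive_map_norm_le[OF R'] A in auto)
  then obtain Y where lim: "sqrt_iter A \<longlonglongrightarrow> Y" and "norm Y \<le> 1"
    and Y: "\<And>x. 2 *\<^sub>R Y x = A x + Y (Y x)"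
    using sqrt_iter_limit by blast
  have Yn: "symmetric_map (sqrt_iter A n)" for n
  proof (induction n)
    case 0
    show ?case by (simp add: symmetric_map_def)
  next
    case (Suc n)
    have "symmetric_map A"
      using symmetric_mapD[OF R'(1)] by (simp add: symmetric_map_def A cinner_diff_left cinner_diff_right)
    then show ?case
      using Suc by (simp add: symmetric_map_def blinfun.scaleR_left blinfun.add_left
          cinner_scaleR_left cinner_scaleR_right cinner_add_left cinner_add_right)
  qed
  have Y_sym: "cinner (Y x) y = cinner x (Y y)" for x y
  proof (rule LIMSEQ_unique)
    show "(\<lambda>n. cinner (sqrt_iter A n x) y) \<longlonglongrightarrow> cinner (Y x) y"
      by (intro tendsto_cinner tendsto_intros lim)
    show "(\<lambda>n. cinner (sqrt_iter A n x) y) \<longlonglongrightarrow> cinner x (Y y)"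
      unfolding symmetric_mapD[OF Yn] by (intro tendsto_cinner tendsto_intros lim)
  qed
  define S where "S x = sqrt c *\<^sub>R (x - Y x)" for x
  show ?thesis
  proof
    show "symmetric_map S"
      by (simp add: symmetric_map_def S_def cinner_scaleR_left cinner_scaleR_right cinner_diff_left
          cinner_diff_right Y_sym)
    fix x
    have "inner x (Y x) \<le> norm x * norm (Y x)"
      by (rule norm_cauchy_schwarz)
    also have "\<dots> \<le> norm x * (1 * norm x)"
      using norm_blinfun[of Y x] \<open>norm Y \<le> 1\<close> 
      by (intro mult_left_mono order_trans[OF norm_blinfun] mult_right_mono) auto
    finally have "inner x (Y x) \<le> inner x x"
      by (simp add: power2_norm_eq_inner flip: power2_eq_square)
    then show "0 \<le> Re (cinner x (S x))"
      using \<open>c > 0\<close> by (simp add: S_def cinner_scaleR_right cinner_diff_right Re_cinner)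
    have "S (S x) = (sqrt c * sqrt c) *\<^sub>R (x - 2 *\<^sub>R Y x + Y (Y x))"
      by (simp add: S_def blinfun.scaleR_right blinfun.diff_right algebra_simps scaleR_2)
    also have "\<dots> = c *\<^sub>R R' x"
      using \<open>c > 0\<close> by (simp add: Y A)
    finally show "S (S x) = R x"
      using \<open>c > 0\<close> by (simp add: R'_def)
  qed
qed

text \<open>The constructed root certifies that the choice in \<open>sqrt_operator\<close> picks a
  root at all. The form of the chosen root is then read off from its square and its
  selfadjointness.\<close>

lemma sqrt_operator_inverse_graph:
  fixes R :: "'a::{complex_inner, banach} \<Rightarrow> 'a"
  assumes sym: "symmetric_map R" and pos: "\<And>x. 0 \<le> Re (cinner x (R x))" and inj: "inj R"
    and "c > 0" and bound: "\<And>x. norm (R x) \<le> c * norm x" and dense: "closure (range R) = UNIV"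
  obtains S where "sqrt_operator (inverse_graph R) = inverse_graph S" "symmetric_map S"
    "\<And>x. S (S x) = R x" "closure (range S) = UNIV"
proof -
  let ?P = "\<lambda>L. selfadjoint L \<and> nonneg_operator L \<and> L O L = inverse_graph R"
  obtain S where S: "symmetric_map S" "\<And>x. 0 \<le> Re (cinner x (S x))" "\<And>x. S (S x) = R x"
    using bounded_sqrt_exists[OF sym pos \<open>c > 0\<close> bound] by blast
  have "inj S"
    by (metis S(3) inj injD injI)
  moreover have "closure (range S) = UNIV"
  proof -
    have "range R \<subseteq> range S"
      using S(3) by (metis image_subsetI rangeI)
    then show ?thesis
      using dense closure_mono by blast
  qed
  ultimately have "selfadjoint (inverse_graph S)"
    by (intro selfadjoint_inverse_graph S)
  moreover have "nonneg_operator (inverse_graph S)"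
    using S(2) unfolding nonneg_operator_def
    by (auto simp: symmetric_mapD[OF S(1)])
  moreover have "inverse_graph S O inverse_graph S = inverse_graph R"
    by (auto simp: S(3) relcomp_unfold)
  ultimately have "?P (inverse_graph S)"
    by blast
  then have P: "?P (sqrt_operator (inverse_graph R))"
    unfolding sqrt_operator_def by (rule someI)
  define L where "L = sqrt_operator (inverse_graph R)"
  have L: "linear_operator L" "closure (Domain L) = UNIV" "adjoint_operator L = L" "L O L = inverse_graph R"
    using P by (auto simp: L_def selfadjoint_def)
  \<comment> \<open>Each pair \<open>(R w, w)\<close> passes through an intermediate point, so every
    \<open>w\<close> lies in the range of \<open>L\<close>.\<close>
  have ex: "\<exists>y. (R w, y) \<in> L \<and> (y, w) \<in> L" for w
    using in_inverse_graph[of "R w" w R] unfolding L(4)[symmetric] by auto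
  \<comment> \<open>Two preimages differ by a kernel vector of \<open>L\<close>, which is also a
    kernel vector of \<open>L O L\<close> and hence equals \<open>R 0 = 0\<close>.\<close>
  have uniq: "y = y'" if "(y, w) \<in> L" "(y', w) \<in> L" for y y' w
  proof -
    have "(y + (- 1) *\<^sub>C y', w + (- 1) *\<^sub>C w) \<in> L" "(0, 0) \<in> L"
      using that L(1) unfolding linear_operator_def by blast+
    moreover have "(- 1) *\<^sub>C v = - v" for v :: 'a
      using scaleC_of_real[of "-1" v] by simp
    ultimately have "(y - y', 0) \<in> L O L"
      by auto
    then show ?thesis
      unfolding L(4) by (simp add: sym)
  qed
  obtain T where T: "\<And>w. (R w, T w) \<in> L" "\<And>w. (T w, w) \<in> L"
    using ex by metis
  have LT: "L = inverse_graph T"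
    using T uniq by (auto simp: inverse_graph_def)
  have "symmetric_map T"
    unfolding symmetric_map_def
  proof (intro allI)
    fix x y
    have "(T x, x) \<in> adjoint_operator L" "(T y, y) \<in> L"
      using T L(3) by auto
    then show "cinner (T x) y = cinner x (T y)"
      unfolding adjoint_operator_def by auto
  qed
  moreover have "T (T w) = R w" for w
    using T(1)[of w] by (simp add: LT)
  ultimately show ?thesis
    using that[of T] LT L(2) by (simp add: L_def Domain_inverse_graph)
qed

lemma closure_image_dense:
  assumes "closure D = UNIV" "continuous_on UNIV f" "closure (range f) = UNIV"
  shows "closure (f ` D) = UNIV"
proof -
  have "f ` closure D \<subseteq> closure (f ` D)"
    by (rule image_closure_subset)
       (use assms(2) closure_subset[of "f ` D"] in \<open>auto intro: continuous_on_subset\<close>)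
  then have "closure (range f) \<subseteq> closure (f ` D)"
    using assms(1) by (simp add: closure_minimal)
  then show ?thesis
    using assms(3) by blast
qed

section \<open>Completeness of the Hilbert space of the torus\<close>

lemma emeasure_torus: "emeasure torus (space torus) = 1"
proof -
  have "emeasure torus (space torus) = emeasure lborel (cbox 0 (1 :: real^3))"
    by (simp add: emeasure_restrict_space)
  also have "\<dots> = ennreal (measure lborel (cbox 0 (1 :: real^3)))"
    by (rule emeasure_eq_ennreal_measure) (metis emeasure_lborel_cbox_finite less_top infinity_ennreal_def)
  also have "measure lborel (cbox 0 (1 :: real^3)) = 1"
    by (subst content_cbox_cart) (auto simp: interval_ne_empty_cart)
  finally show ?thesis
    by simp
qed

lemma measurable_torusI: "f \<in> borel_measurable borel \<Longrightarrow> f \<in> borel_measurable torus"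
  by (intro measurable_restrict_space1 measurable_completion) auto

lemma borel_measurable_torus_continuous:
  "continuous_on UNIV (f :: real^3 \<Rightarrow> 'b::topological_space) \<Longrightarrow> f \<in> borel_measurable torus"
  by (intro measurable_torusI borel_measurable_continuous_onI)

interpretation torus: finite_measure torus
  by (rule finite_measureI) (use emeasure_torus in auto)

lemma measure_torus: "measure torus (space torus) = 1"
  using emeasure_torus by (simp add: measure_def)

lemma l2torus_cases:
  obtains f where "sq_integrable f" "u = abs_l2torus f"
proof
  show "sq_integrable (rep_l2torus u)"
    using Quotient3_rep_reflp[OF Quotient3_l2torus] by (simp add: l2rel_def)
  show "u = abs_l2torus (rep_l2torus u)"
    by (rule Quotient3_abs_rep[OF Quotient3_l2torus, symmetric])
qed

lemma l2rel_refl: "sq_integrable f \<Longrightarrow> l2rel f f"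
  by (simp add: l2rel_def)

lemma abs_l2torus_diff:
  assumes "sq_integrable f" "sq_integrable g"
  shows "abs_l2torus f - abs_l2torus g = abs_l2torus (\<lambda>x. f x - g x)" "sq_integrable (\<lambda>x. f x - g x)"
proof -
  have "sq_integrable (\<lambda>x. - g x)"
    using sq_integrable_scale[of g "-1"] assms by simp
  then show "abs_l2torus f - abs_l2torus g = abs_l2torus (\<lambda>x. f x - g x)"
    using assms unfolding minus_l2torus_def[of "abs_l2torus f"] uminus_l2torus_def[of "abs_l2torus g"]
    by (simp add: scaleC_l2torus.abs_eq plus_l2torus.abs_eq l2rel_refl)
  show "sq_integrable (\<lambda>x. f x - g x)"
    using sq_integrable_add[OF assms(1) sq_integrable_scale[OF assms(2), of "-1"]] by simp
qed

lemma norm_abs_l2torus: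
  assumes "sq_integrable f"
  shows "(norm (abs_l2torus f))\<^sup>2 = (\<integral>x. (cmod (f x))\<^sup>2 \<partial>torus)"
proof -
  have "complex_of_real ((norm (abs_l2torus f))\<^sup>2) = (\<integral>x. cnj (f x) * f x \<partial>torus)"
    unfolding cinner_same[symmetric] by (simp add: cinner_l2torus.abs_eq l2rel_refl assms)
  also have "\<dots> = (\<integral>x. complex_of_real ((cmod (f x))\<^sup>2) \<partial>torus)"
    by (intro Bochner_Integration.integral_cong refl) (metis complex_norm_square mult.commute of_real_power)
  finally show ?thesis
    unfolding integral_complex_of_real of_real_eq_iff .
qed

lemma nn_norm_abs_l2torus:
  assumes "sq_integrable f"
  shows "(\<integral>\<^sup>+x. ennreal ((cmod (f x))\<^sup>2) \<partial>torus) = ennreal ((norm (abs_l2torus f))\<^sup>2)"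
  using assms unfolding norm_abs_l2torus[OF assms]
  by (intro nn_integral_eq_integral) (auto simp: sq_integrable_def)

lemma sq_integrable_integrable:
  assumes "sq_integrable f" shows "integrable torus f"
proof (rule Bochner_Integration.integrable_bound)
  show "integrable torus (\<lambda>x. 1 + (cmod (f x))\<^sup>2)" 
    using assms by (auto simp: sq_integrable_def)
  show "f \<in> borel_measurable torus"
    using assms by (auto simp: sq_integrable_def)
  have "a \<le> 1 + a\<^sup>2" for a :: real
    using sum_squares_bound [of a 1] by (smt (verit) power_one zero_le_power2)
  then show "AE x in torus. norm (f x) \<le> norm (1 + (cmod (f x))\<^sup>2)"
    by (intro AE_I2) simp
qed

text \<open>Cauchy-Schwarz against the constant 1 on a space of measure 1, in the form of the
  integrated inequality \<open>|f| \<le> |f|^2 / (2 t) + t / 2\<close>.\<close>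

lemma integral_norm_le_of_l2:
  assumes "sq_integrable f" "norm (abs_l2torus f) \<le> t" "t > 0"
  shows "(\<integral>\<^sup>+x. ennreal (cmod (f x)) \<partial>torus) \<le> ennreal t"
proof -
  have int: "integrable torus f" "integrable torus (\<lambda>x. (cmod (f x))\<^sup>2)"
    using sq_integrable_integrable[OF assms(1)] assms(1) by (auto simp: sq_integrable_def)
  have "(\<integral>x. cmod (f x) \<partial>torus) \<le> (\<integral>x. (1 / (2 * t)) * (cmod (f x))\<^sup>2 + t / 2 \<partial>torus)"
  proof (rule integral_mono)
    fix x
    show "cmod (f x) \<le> (1 / (2 * t)) * (cmod (f x))\<^sup>2 + t / 2"
      using sum_squares_bound[of "cmod (f x)" t] \<open>t > 0\<close> by (simp add: field_simps power2_eq_square)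
    show "integrable torus (\<lambda>x. cmod (f x))"
      using int(1) by (rule integrable_norm)
    show "integrable torus (\<lambda>x. (1 / (2 * t)) * (cmod (f x))\<^sup>2 + t / 2)"
      by (intro Bochner_Integration.integrable_add integrable_mult_right int(2) torus.integrable_const)
  qed
  also have "\<dots> = (1 / (2 * t)) * (norm (abs_l2torus f))\<^sup>2 + t / 2"
    unfolding norm_abs_l2torus[OF assms(1)]
    by (subst Bochner_Integration.integral_add)
       (use int(2) measure_torus in \<open>simp_all del: space_lebesgue_on\<close>)
  also have "\<dots> \<le> (1 / (2 * t)) * t\<^sup>2 + t / 2"
    using assms by (intro add_right_mono mult_left_mono power_mono) auto
  also have "\<dots> = t"
    using \<open>t > 0\<close> by (simp add: power2_eq_square)
  finally have "(\<integral>x. cmod (f x) \<partial>torus) \<le> t" .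
  then show ?thesis
    by (subst nn_integral_eq_integral) (use int(1) in \<open>simp_all add: ennreal_leI\<close>)
qed

text \<open>Riesz-Fischer argument: geometric decay makes the increments summable in L1, so
  representatives converge almost everywhere; Fatou's lemma bounds the L2 distance to the
  limit.\<close>

lemma l2torus_fast_Cauchy_converges:
  fixes X :: "nat \<Rightarrow> l2torus"
  assumes X: "\<And>m n. n \<le> m \<Longrightarrow> norm (X m - X n) \<le> (1/2) ^ n"
  shows "convergent X"
proof -
  have "\<exists>f. sq_integrable f \<and> X n = abs_l2torus f" for n
    by (metis l2torus_cases)
  then obtain f where f: "\<And>n. sq_integrable (f n)" "\<And>n. X n = abs_l2torus (f n)"
    by metis
  have [measurable]: "f n \<in> borel_measurable torus" for n
    using f(1) by (simp add: sq_integrable_def)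
  have dsq: "sq_integrable (\<lambda>x. f m x - f n x)" for m n
    by (rule abs_l2torus_diff(2)) (rule f)+
  have d: "abs_l2torus (\<lambda>x. f m x - f n x) = X m - X n" for m n
    unfolding f(2) by (rule abs_l2torus_diff(1)[symmetric]) (rule f)+
  have "(\<integral>\<^sup>+x. (\<Sum>n. ennreal (cmod (f (Suc n) x - f n x))) \<partial>torus)
      = (\<Sum>n. \<integral>\<^sup>+x. ennreal (cmod (f (Suc n) x - f n x)) \<partial>torus)"
    by (rule nn_integral_suminf) measurable
  also have "\<dots> \<le> (\<Sum>n. ennreal ((1/2) ^ n))"
    by (intro suminf_le summableI integral_norm_le_of_l2 dsq) (use X d in auto)
  also have "\<dots> = ennreal (\<Sum>n. (1/2) ^ n)"
    by (intro suminf_ennreal2 summable_geometric) auto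
  finally have "(\<integral>\<^sup>+x. (\<Sum>n. ennreal (cmod (f (Suc n) x - f n x))) \<partial>torus) < \<infinity>"
    unfolding infinity_ennreal_def by (rule le_less_trans) (rule ennreal_less_top)
  then have "(\<integral>\<^sup>+x. (\<Sum>n. ennreal (cmod (f (Suc n) x - f n x))) \<partial>torus) \<noteq> \<infinity>"
    by (rule less_imp_neq)
  then have "AE x in torus. (\<Sum>n. ennreal (cmod (f (Suc n) x - f n x))) \<noteq> \<infinity>"
    by (intro nn_integral_PInf_AE) measurable
  then have lim: "AE x in torus. (\<lambda>n. f n x) \<longlonglongrightarrow> lim (\<lambda>n. f n x)"
  proof (rule AE_mp, intro AE_I2 impI)
    fix x assume "(\<Sum>n. ennreal (cmod (f (Suc n) x - f n x))) \<noteq> \<infinity>"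
    then have "summable (\<lambda>n. cmod (f (Suc n) x - f n x))"
      by (intro summable_suminf_not_top) auto
    then have "summable (\<lambda>n. f (Suc n) x - f n x)"
      by (rule summable_norm_cancel)
    then have "convergent (\<lambda>n. \<Sum>k<n. f (Suc k) x - f k x)"
      by (simp only: summable_iff_convergent)
    then have "convergent (\<lambda>n. f n x - f 0 x)"
      by (simp only: sum_lessThan_telescope[of "\<lambda>n. f n x"])
    then have "convergent (\<lambda>n. f n x)"
      by (simp add: convergent_diff_const_right_iff)
    then show "(\<lambda>n. f n x) \<longlonglongrightarrow> lim (\<lambda>n. f n x)"
      by (simp add: convergent_LIMSEQ_iff)
  qed
  \<comment> \<open>Where the sequence diverges the value of \<open>lim\<close> is arbitrary; this
    concerns a null set only.\<close>
  define g where "g x = lim (\<lambda>n. f n x)" for x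
  have [measurable]: "g \<in> borel_measurable torus"
    unfolding g_def by measurable
  have bound: "(\<integral>\<^sup>+x. ennreal ((cmod (g x - f n x))\<^sup>2) \<partial>torus) \<le> ennreal (((1/2) ^ n)\<^sup>2)" for n
  proof -
    have "(\<integral>\<^sup>+x. ennreal ((cmod (g x - f n x))\<^sup>2) \<partial>torus)
        = (\<integral>\<^sup>+x. liminf (\<lambda>m. ennreal ((cmod (f m x - f n x))\<^sup>2)) \<partial>torus)"
    proof (rule nn_integral_cong_AE, rule AE_mp[OF lim], intro AE_I2 impI)
      fix x assume "(\<lambda>m. f m x) \<longlonglongrightarrow> lim (\<lambda>m. f m x)"
      then have "(\<lambda>m. ennreal ((cmod (f m x - f n x))\<^sup>2)) \<longlonglongrightarrow> ennreal ((cmod (g x - f n x))\<^sup>2)"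
        unfolding g_def by (intro tendsto_intros)
      then show "ennreal ((cmod (g x - f n x))\<^sup>2) = liminf (\<lambda>m. ennreal ((cmod (f m x - f n x))\<^sup>2))"
        by (intro lim_imp_Liminf[symmetric] trivial_limit_sequentially)
    qed
    also have "\<dots> \<le> liminf (\<lambda>m. \<integral>\<^sup>+x. ennreal ((cmod (f m x - f n x))\<^sup>2) \<partial>torus)"
      by (rule nn_integral_liminf) measurable
    also have "\<dots> = liminf (\<lambda>m. ennreal ((norm (X m - X n))\<^sup>2))"
      by (simp only: nn_norm_abs_l2torus[OF dsq] d)
    also have "\<dots> \<le> liminf (\<lambda>m. ennreal (((1/2) ^ n)\<^sup>2))"
      by (rule Liminf_mono, rule eventually_sequentiallyI[of n])
         (intro ennreal_leI power_mono X, auto)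
    finally show ?thesis
      by (simp only: Liminf_const[OF trivial_limit_sequentially])
  qed
  have gsq: "sq_integrable (\<lambda>x. g x - f n x)" for n
    unfolding sq_integrable_def
  proof
    show "integrable torus (\<lambda>x. (cmod (g x - f n x))\<^sup>2)"
    proof (rule integrableI_bounded)
      show "(\<integral>\<^sup>+x. ennreal (norm ((cmod (g x - f n x))\<^sup>2)) \<partial>torus) < \<infinity>"
        using le_less_trans[OF bound[of n] ennreal_less_top] by simp
    qed measurable
  qed measurable
  then have g: "sq_integrable g"
    using sq_integrable_add[OF gsq[of 0] f(1)[of 0]] by simp
  have "norm (X n - abs_l2torus g) \<le> (1/2) ^ n" for n
  proof -
    have "ennreal ((norm (abs_l2torus (\<lambda>x. g x - f n x)))\<^sup>2) \<le> ennreal (((1/2) ^ n)\<^sup>2)"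
      using bound[of n] nn_norm_abs_l2torus[OF gsq, of n] by simp
    then have "(norm (abs_l2torus g - X n))\<^sup>2 \<le> ((1/2) ^ n)\<^sup>2"
      by (simp only: ennreal_le_iff zero_le_power2 f(2) abs_l2torus_diff(1)[OF g f(1)])
    then show ?thesis
      by (subst norm_minus_commute) (rule power2_le_imp_le, auto)
  qed
  then have "\<forall>\<^sub>F n in sequentially. norm (X n - abs_l2torus g) \<le> (1/2) ^ n"
    by simp
  moreover have "(\<lambda>n. (1/2 :: real) ^ n) \<longlonglongrightarrow> 0"
    by (rule LIMSEQ_power_zero) simp
  ultimately have "(\<lambda>n. X n - abs_l2torus g) \<longlonglongrightarrow> 0"
    by (rule Lim_null_comparison)
  then have "X \<longlonglongrightarrow> abs_l2torus g"
    by (rule LIM_zero_cancel)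
  then show ?thesis
    by (rule convergentI)
qed

instance l2torus :: banach
proof
  fix X :: "nat \<Rightarrow> l2torus"
  assume "Cauchy X"
  then have "\<exists>M. \<forall>m\<ge>M. \<forall>n\<ge>M. norm (X m - X n) < (1/2) ^ k" for k
    unfolding Cauchy_iff by simp
  then obtain M where M: "\<And>k m n. m \<ge> M k \<Longrightarrow> n \<ge> M k \<Longrightarrow> norm (X m - X n) < (1/2) ^ k"
    by metis
  \<comment> \<open>Partial sums dominate all earlier thresholds, so a single index sequence has the
    geometric rate.\<close>
  define r where "r k = (\<Sum>i\<le>k. M i)" for k
  have rM: "M k \<le> r l" if "k \<le> l" for k l
    unfolding r_def by (rule member_le_sum) (use that in auto)
  have "convergent (\<lambda>k. X (r k))"
    by (rule l2torus_fast_Cauchy_converges) (rule less_imp_le, intro M rM, auto)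
  then obtain u where u: "(\<lambda>k. X (r k)) \<longlonglongrightarrow> u"
    by (auto simp: convergent_def)
  have "X \<longlonglongrightarrow> u"
  proof (rule LIMSEQ_I)
    fix e :: real assume "e > 0"
    then obtain N where N: "\<And>k. k \<ge> N \<Longrightarrow> norm (X (r k) - u) < e / 2"
      using LIMSEQ_D[OF u, of "e/2"] by (metis half_gt_zero)
    obtain K where K: "(1/2) ^ K < e / 2"
      using real_arch_pow_inv[of "e/2" "1/2"] \<open>e > 0\<close> by auto
    show "\<exists>no. \<forall>n\<ge>no. norm (X n - u) < e"
    proof (intro exI[of _ "M K"] allI impI)
      fix n assume "n \<ge> M K"
      then have "norm (X n - X (r (max K N))) < (1/2) ^ K"
        by (intro M rM) auto
      moreover have "norm (X (r (max K N)) - u) < e / 2"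
        by (rule N) simp
      ultimately have "norm ((X n - X (r (max K N))) + (X (r (max K N)) - u)) < e"
        using K by (intro norm_add_less[where r = "e/2" and s = "e/2", simplified]) auto
      then show "norm (X n - u) < e"
        by simp
    qed
  qed
  then show "convergent X"
    by (rule convergentI)
qed

section \<open>Fourier series on the torus\<close>

text \<open>The kernel of \<open>fourier_coeff\<close> is the complex conjugate of this function, so
  coefficients become scalar products with \<open>fourier_vec\<close> in the antilinear
  slot.\<close>

definition fourier_char :: "int^3 \<Rightarrow> real^3 \<Rightarrow> complex" where
  "fourier_char m x = cis (- (2 * pi * (lattice_point m \<bullet> x)))"

definition fourier_vec :: "int^3 \<Rightarrow> l2torus" where
  "fourier_vec m = abs_l2torus (fourier_char m)"

lemma sq_integrable_fourier_char: "sq_integrable (fourier_char m)"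
proof -
  have "fourier_char m \<in> borel_measurable torus"
    unfolding fourier_char_def by (intro borel_measurable_torus_continuous continuous_intros)
  then show ?thesis
    by (auto simp: sq_integrable_def fourier_char_def)
qed

lemma l2_coeff_abs: "sq_integrable f \<Longrightarrow> l2_coeff (abs_l2torus f) m = fourier_coeff f m"
  by (simp add: l2_coeff.abs_eq l2rel_refl)

lemma l2_coeff_eq_cinner: "l2_coeff u m = cinner (fourier_vec m) u"
proof (cases u rule: l2torus_cases)
  case (1 f)
  then show ?thesis
    by (simp add: l2_coeff_abs fourier_vec_def cinner_l2torus.abs_eq l2rel_refl sq_integrable_fourier_char
        fourier_coeff_def fourier_char_def cis_cnj)
qed

lemma l2_coeff_add: "l2_coeff (u + v) m = l2_coeff u m + l2_coeff v m"
  and l2_coeff_diff: "l2_coeff (u - v) m = l2_coeff u m - l2_coeff v m"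
  and l2_coeff_scaleC: "l2_coeff (a *\<^sub>C u) m = a * l2_coeff u m"
  and l2_coeff_scaleR: "l2_coeff (r *\<^sub>R u) m = r *\<^sub>R l2_coeff u m"
  and l2_coeff_zero: "l2_coeff 0 m = 0"
  by (simp_all add: l2_coeff_eq_cinner cinner_add_right cinner_diff_right cinner_scaleC_right
      cinner_scaleR_right)

lemma bounded_linear_l2_coeff: "bounded_linear (\<lambda>u. l2_coeff u m)"
  unfolding l2_coeff_eq_cinner by (rule bounded_bilinear.bounded_linear_right[OF bounded_bilinear_cinner])

lemma continuous_on_l2_coeff [continuous_intros]:
  "continuous_on S f \<Longrightarrow> continuous_on S (\<lambda>x. l2_coeff (f x) m)"
  by (rule bounded_linear.continuous_on[OF bounded_linear_l2_coeff])

section \<open>Orthonormality of the exponentials\<close>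

lemma lborel_integral_prod:
  fixes f :: "'a::euclidean_space \<Rightarrow> real \<Rightarrow> complex"
  assumes "\<And>b. b \<in> Basis \<Longrightarrow> integrable lborel (f b)"
  shows "(\<integral>x. (\<Prod>b\<in>Basis. f b (x \<bullet> b)) \<partial>lborel) = (\<Prod>b\<in>Basis. \<integral>x. f b x \<partial>lborel)"
proof -
  interpret product_sigma_finite "\<lambda>b::'a. lborel :: real measure"
    by standard
  have [measurable]: "f b \<in> borel_measurable borel" if "b \<in> Basis" for b
    using borel_measurable_integrable[OF assms[OF that]] by simp
  have "(\<lambda>x::'a. \<Prod>b\<in>Basis. f b (x \<bullet> b)) \<in> borel_measurable borel"
    by measurable
  moreover have "(\<lambda>g::'a \<Rightarrow> real. \<Sum>b\<in>Basis. g b *\<^sub>R b) \<in> measurable (\<Pi>\<^sub>M b\<in>Basis. lborel) borel"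
    by measurable
  ultimately have "(\<integral>x. (\<Prod>b\<in>Basis. f b (x \<bullet> b)) \<partial>lborel)
      = (\<integral>g. (\<Prod>b\<in>Basis. f b ((\<Sum>b\<in>Basis. g b *\<^sub>R b) \<bullet> b)) \<partial>(\<Pi>\<^sub>M b\<in>Basis. lborel))"
    unfolding lborel_eq[where 'a='a] by (rule integral_distr[rotated])
  also have "\<dots> = (\<integral>g. (\<Prod>b\<in>Basis. f b (g b)) \<partial>(\<Pi>\<^sub>M b\<in>Basis. lborel))"
    by (intro Bochner_Integration.integral_cong refl prod.cong) simp
  also have "\<dots> = (\<Prod>b\<in>Basis. \<integral>x. f b x \<partial>lborel)"
    by (rule product_integral_prod) (use assms in auto)
  finally show ?thesis .
qed

lemma integral_torus_eq_lborel:
  assumes "f \<in> borel_measurable borel"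
  shows "(\<integral>x. f x \<partial>torus) = (\<integral>x. indicator (cbox 0 1) x *\<^sub>R (f x :: complex) \<partial>lborel)"
proof -
  have "(\<integral>x. f x \<partial>torus) = (\<integral>x. indicator (cbox 0 1) x *\<^sub>R f x \<partial>lebesgue)"
    by (rule integral_restrict_space) auto
  also have "\<dots> = (\<integral>x. indicator (cbox 0 1) x *\<^sub>R f x \<partial>lborel)"
    by (rule integral_completion) (use assms in measurable)
  finally show ?thesis .
qed

lemma integral_cis_unit_interval:
  fixes k :: int
  assumes "k \<noteq> 0"
  shows "(\<integral>t. indicator {0..1} t *\<^sub>R cis (2 * pi * (k * t)) \<partial>lborel) = 0"
proof -
  define F where "F t = - (\<i> / (2 * pi * k)) * cis (2 * pi * (k * t))" for t :: real
  have *: "- (\<i> * X * \<i>) = X" for X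
    by (simp add: complex_eq_iff)
  have "(F has_vector_derivative cis (2 * pi * (k * t))) (at t within {0..1})" for t :: real
    unfolding F_def cis_conv_exp
    by (rule has_vector_derivative_real_field derivative_eq_intros refl | simp add: assms * mult.assoc[symmetric])+
  then have "(\<integral>t. indicator {0..1} t *\<^sub>R cis (2 * pi * (k * t)) \<partial>lborel) = F 1 - F 0"
    by (intro integral_FTC_Icc) (auto intro!: continuous_intros)
  also have "\<dots> = 0"
    using cis_multiple_2pi[of "of_int k"] by (simp add: F_def)
  finally show ?thesis .
qed

text \<open>The integral over the cell splits into one-dimensional ones; a coordinate with
  \<open>m $ j \<noteq> 0\<close> contributes an integral over full periods.\<close>

lemma integral_fourier_char:
  assumes "m \<noteq> 0"
  shows "(\<integral>x. cis (2 * pi * (lattice_point m \<bullet> x)) \<partial>torus) = 0"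
proof -
  obtain j where j: "m $ j \<noteq> 0"
    using assms by (auto simp: vec_eq_iff)
  define f where "f b t = indicator {0..1} t *\<^sub>R cis (2 * pi * ((lattice_point m \<bullet> b) * t))"
    for b :: "real^3" and t :: real
  have "(\<integral>x. cis (2 * pi * (lattice_point m \<bullet> x)) \<partial>torus)
      = (\<integral>x. indicator (cbox 0 1) x *\<^sub>R cis (2 * pi * (lattice_point m \<bullet> x)) \<partial>lborel)"
    by (intro integral_torus_eq_lborel borel_measurable_continuous_onI continuous_intros)
  also have "\<dots> = (\<integral>x. (\<Prod>b\<in>Basis. f b (x \<bullet> b)) \<partial>lborel)"
  proof (rule Bochner_Integration.integral_cong[OF refl])
    fix x :: "real^3"
    have one: "1 \<bullet> b = 1" if "b \<in> Basis" for b :: "real^3"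
      using that by (auto simp: Basis_vec_def inner_axis)
    have "(\<Prod>b\<in>Basis. cis (2 * pi * ((lattice_point m \<bullet> b) * (x \<bullet> b))))
        = cis (\<Sum>b\<in>Basis. 2 * pi * ((lattice_point m \<bullet> b) * (x \<bullet> b)))"
      by (simp add: cis_conv_exp exp_sum sum_distrib_left)
    also have "(\<Sum>b\<in>Basis. 2 * pi * ((lattice_point m \<bullet> b) * (x \<bullet> b))) = 2 * pi * (lattice_point m \<bullet> x)"
      by (subst (3) euclidean_inner) (simp add: sum_distrib_left)
    finally have 1: "(\<Prod>b\<in>Basis. cis (2 * pi * ((lattice_point m \<bullet> b) * (x \<bullet> b))))
        = cis (2 * pi * (lattice_point m \<bullet> x))" .
    have 2: "(\<Prod>b\<in>Basis. complex_of_real (indicator {0..1} (x \<bullet> b))) = of_real (indicator (cbox 0 1) x)"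
    proof (cases "x \<in> cbox 0 1")
      case True
      then have "x \<bullet> b \<in> {0..1}" if "b \<in> Basis" for b
        using that one by (auto simp: mem_box)
      then show ?thesis
        using True by (simp add: indicator_def)
    next
      case False
      then obtain b where "b \<in> Basis" "x \<bullet> b \<notin> {0..1}"
        using one by (auto simp: mem_box)
      then show ?thesis
        using False by (auto simp: indicator_def intro!: prod_zero)
    qed
    show "indicator (cbox 0 1) x *\<^sub>R cis (2 * pi * (lattice_point m \<bullet> x)) = (\<Prod>b\<in>Basis. f b (x \<bullet> b))"
      unfolding f_def scaleR_conv_of_real prod.distrib 1 2 ..
  qed
  also have "\<dots> = (\<Prod>b\<in>Basis. \<integral>t. f b t \<partial>lborel)"
    unfolding f_def by (intro lborel_integral_prod borel_integrable_compact continuous_intros compact_Icc)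
  also have "\<dots> = 0"
  proof (rule prod_zero)
    have "lattice_point m \<bullet> axis j 1 = of_int (m $ j)"
      by (simp add: lattice_point_def inner_axis)
    then have "(\<integral>t. f (axis j 1) t \<partial>lborel) = 0"
      unfolding f_def using integral_cis_unit_interval[OF j] by simp
    then show "\<exists>b\<in>Basis. (\<integral>t. f b t \<partial>lborel) = 0"
      by (intro bexI[of _ "axis j 1"]) auto
  qed simp
  finally show ?thesis .
qed

lemma lattice_point_diff: "lattice_point (m - n) = lattice_point m - lattice_point n"
  by (simp add: lattice_point_def vec_eq_iff)

lemma cinner_fourier_vec: "cinner (fourier_vec m) (fourier_vec n) = (if m = n then 1 else 0)"
proof -
  have "cinner (fourier_vec m) (fourier_vec n) = (\<integral>x. cis (2 * pi * (lattice_point (m - n) \<bullet> x)) \<partial>torus)"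
    by (simp add: fourier_vec_def cinner_l2torus.abs_eq l2rel_refl sq_integrable_fourier_char fourier_char_def cis_cnj
        cis_mult lattice_point_diff inner_diff_left algebra_simps)
  also have "\<dots> = (if m = n then 1 else 0)"
  proof (cases "m = n")
    case True
    have "lattice_point 0 = 0"
      by (simp add: lattice_point_def vec_eq_iff)
    then show ?thesis
      using True measure_torus by (simp del: space_lebesgue_on)
  qed (use integral_fourier_char[of "m - n"] in simp)
  finally show ?thesis .
qed

lemma l2_coeff_fourier_vec: "l2_coeff (fourier_vec n) m = (if m = n then 1 else 0)"
  by (simp add: l2_coeff_eq_cinner cinner_fourier_vec)

section \<open>Completeness of the exponentials\<close>

inductive trig_poly :: "(real^3 \<Rightarrow> complex) \<Rightarrow> bool" where
  char: "trig_poly (\<lambda>x. cis (2 * pi * (lattice_point m \<bullet> x)))"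
| add: "trig_poly f \<Longrightarrow> trig_poly g \<Longrightarrow> trig_poly (\<lambda>x. f x + g x)"
| scale: "trig_poly f \<Longrightarrow> trig_poly (\<lambda>x. a * f x)"

lemma trig_poly_const: "trig_poly (\<lambda>x. a)"
proof -
  have "lattice_point 0 = 0"
    by (simp add: lattice_point_def vec_eq_iff)
  then show ?thesis
    using trig_poly.scale[OF trig_poly.char[of 0], of a] by simp
qed

lemma trig_poly_sum:
  assumes "\<And>i. i \<in> I \<Longrightarrow> trig_poly (f i)"
  shows "trig_poly (\<lambda>x. \<Sum>i\<in>I. f i x)"
  using assms by (induction I rule: infinite_finite_induct) (auto intro: trig_poly_const trig_poly.add)

lemma trig_poly_mult:
  assumes "trig_poly f" "trig_poly g"
  shows "trig_poly (\<lambda>x. f x * g x)"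
  using assms(1)
proof induction
  case (char m)
  from assms(2) show ?case
  proof induction
    case (char n)
    have "lattice_point (m + n) = lattice_point m + lattice_point n"
      by (simp add: lattice_point_def vec_eq_iff)
    then show ?case
      using trig_poly.char[of "m + n"] by (simp add: cis_mult inner_add_left algebra_simps)
  next
    case (add f g)
    then show ?case by (simp add: distrib_left trig_poly.add)
  next
    case (scale f a)
    then show ?case using trig_poly.scale[of _ a] by (simp add: mult.left_commute)
  qed
next
  case (add f g)
  then show ?case by (simp add: distrib_right trig_poly.add)
next
  case (scale f a)
  then show ?case using trig_poly.scale[of _ a] by (simp add: mult.assoc)
qed

text \<open>Realises the torus as a compact subset of \<open>complex^3\<close>, so that
  Stone-Weierstrass for polynomials applies; real polynomials on this space pull back to
  trigonometric polynomials.\<close>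

definition torus_embed :: "real^3 \<Rightarrow> complex^3" where
  "torus_embed x = (\<chi> i. cis (2 * pi * x $ i))"

lemma continuous_on_torus_embed: "continuous_on S torus_embed"
  unfolding torus_embed_def by (intro continuous_intros)

lemma trig_poly_polynomial_function:
  assumes "real_polynomial_function p"
  shows "trig_poly (\<lambda>x. complex_of_real (p (torus_embed x)))"
  using assms
proof induction
  case (linear f)
  have b: "trig_poly (\<lambda>x. complex_of_real (torus_embed x \<bullet> b))" if b: "b \<in> Basis" for b
  proof -
    from b obtain j \<beta> where b: "b = axis j \<beta>"
      by (auto simp: Basis_vec_def)
    have lp: "lattice_point (axis j k) = axis j (of_int k)" for k
      by (auto simp: lattice_point_def vec_eq_iff axis_def)
    \<comment> \<open>A real coordinate is the real part of a multiple of \<open>cis\<close>, hence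
      a combination of a character and its conjugate.\<close>
    have "complex_of_real (torus_embed x \<bullet> b)
        = (cnj \<beta> / 2) * cis (2 * pi * (lattice_point (axis j 1) \<bullet> x))
          + (\<beta> / 2) * cis (2 * pi * (lattice_point (axis j (- 1)) \<bullet> x))" for x
    proof -
      have "torus_embed x \<bullet> b = Re (cis (2 * pi * x $ j) * cnj \<beta>)"
        unfolding b torus_embed_def by (simp add: inner_axis inner_complex_def)
      moreover have "axis j 1 \<bullet> x = x $ j" "axis j (- 1) \<bullet> x = - x $ j"
        by (simp_all add: inner_axis')
      ultimately show ?thesis
        by (simp add: lp complex_eq_iff algebra_simps diff_divide_distrib)
    qed
    then show ?thesis
      by (simp only:) (intro trig_poly.intros)
  qed
  have "f z = (\<Sum>b\<in>Basis. f b * (z \<bullet> b))" for z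
  proof -
    have "f z = f (\<Sum>b\<in>Basis. (z \<bullet> b) *\<^sub>R b)"
      by (simp only: euclidean_representation)
    also have "\<dots> = (\<Sum>b\<in>Basis. (z \<bullet> b) * f b)"
      using linear by (simp add: linear_sum bounded_linear.linear linear_cmul)
    finally show ?thesis by (simp add: mult.commute)
  qed
  then have "(\<lambda>x. complex_of_real (f (torus_embed x)))
      = (\<lambda>x. \<Sum>b\<in>Basis. complex_of_real (f b) * complex_of_real (torus_embed x \<bullet> b))"
    by (metis (no_types, lifting) of_real_mult of_real_sum sum.cong)
  then show ?case
    by (simp only:) (intro trig_poly_sum trig_poly.scale b)
next
  case (const c)
  show ?case by (rule trig_poly_const)
next
  case (add f g)
  then show ?case by (simp add: trig_poly.add)
next
  case (mult f g)
  then show ?case by (simp add: trig_poly_mult)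
qed

text \<open>Opposite faces of the closed cell have the same image, so injectivity requires one of
  the two points to be interior.\<close>

lemma torus_embed_eq_iff:
  assumes "x \<in> box 0 1" "y \<in> cbox 0 1" "torus_embed x = torus_embed y"
  shows "x = y"
proof (rule vec_eq_iff[THEN iffD2], rule)
  fix i
  have "cis (2 * pi * x $ i) = cis (2 * pi * y $ i)"
    using assms(3) by (simp add: torus_embed_def vec_eq_iff)
  then obtain n :: int where "2 * pi * x $ i = 2 * pi * y $ i + 2 * pi * n"
    using sin_cos_eq_iff by (auto simp: complex_eq_iff)
  then have "2 * pi * (x $ i) = 2 * pi * (y $ i + n)"
    by (simp add: algebra_simps)
  then have n: "x $ i = y $ i + n"
    by simp
  have "0 < x $ i" "x $ i < 1" "0 \<le> y $ i" "y $ i \<le> 1"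
    using assms(1,2) by (auto simp: mem_box_cart)
  then have "n = 0"
    using n by linarith
  then show "x $ i = y $ i"
    using n by simp
qed

lemma integrable_torus_continuous_mult:
  fixes f :: "real^3 \<Rightarrow> complex"
  assumes "integrable torus f" "continuous_on UNIV \<phi>"
  shows "integrable torus (\<lambda>x. \<phi> x * f x)"
proof -
  have "bounded (\<phi> ` cbox 0 1)"
    using assms(2) by (intro compact_imp_bounded compact_continuous_image)
       (auto intro: continuous_on_subset)
  then obtain B where B: "\<And>x. x \<in> cbox 0 1 \<Longrightarrow> norm (\<phi> x) \<le> B"
    by (auto simp: bounded_iff)
  have [measurable]: "\<phi> \<in> borel_measurable torus" "f \<in> borel_measurable torus"
    using assms by (auto intro: borel_measurable_torus_continuous)
  show ?thesis
  proof (rule Bochner_Integration.integrable_bound)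
    show "integrable torus (\<lambda>x. B * norm (f x))"
      using assms(1) by auto
    show "AE x in torus. norm (\<phi> x * f x) \<le> norm (B * norm (f x))"
    proof (rule AE_I2)
      fix x assume "x \<in> space torus"
      then have "norm (\<phi> x) \<le> B"
        using B by simp
      then show "norm (\<phi> x * f x) \<le> norm (B * norm (f x))"
        using mult_right_mono[OF _ norm_ge_zero, of "norm (\<phi> x)" B "f x"] norm_ge_zero[of "\<phi> x"]
        by (simp add: norm_mult)
    qed
  qed measurable
qed

lemma trig_poly_integral_zero:
  assumes f: "integrable torus f" and zero: "\<And>m. fourier_coeff f m = 0" and "trig_poly \<phi>"
  shows "continuous_on UNIV \<phi> \<and> (\<integral>x. \<phi> x * f x \<partial>torus) = 0"
  using assms(3)
proof induction
  case (char m)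
  show ?case
    using zero[of m] by (auto simp: fourier_coeff_def intro!: continuous_intros)
next
  case (add \<phi> \<psi>)
  then show ?case
    using integrable_torus_continuous_mult[OF f]
    by (auto simp: distrib_right intro!: continuous_intros)
next
  case (scale \<phi> a)
  then show ?case
    by (auto simp: mult.assoc intro!: continuous_intros)
qed

text \<open>Polynomials approximate \<open>h\<close> uniformly on the compact image of the cell, and
  each of them pulls back to a trigonometric polynomial, against which \<open>f\<close> integrates
  to zero.\<close>

lemma continuous_integral_zero:
  fixes h :: "complex^3 \<Rightarrow> real"
  assumes f: "integrable torus f" and zero: "\<And>m. fourier_coeff f m = 0"
    and h: "continuous_on UNIV h"
  shows "(\<integral>x. of_real (h (torus_embed x)) * f x \<partial>torus) = 0"
proof -
  let ?h = "\<lambda>x. complex_of_real (h (torus_embed x))"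
  have hc: "continuous_on UNIV ?h"
    by (intro continuous_intros continuous_on_compose2[OF h] continuous_on_torus_embed) auto
  let ?I = "\<integral>x. norm (f x) \<partial>torus"
  have "norm (\<integral>x. ?h x * f x \<partial>torus) \<le> e * ?I" if "e > 0" for e
  proof -
    have "compact (torus_embed ` cbox 0 1)"
      by (intro compact_continuous_image continuous_on_torus_embed compact_cbox)
    then obtain p where p: "real_polynomial_function p"
      and close: "\<And>z. z \<in> torus_embed ` cbox 0 1 \<Longrightarrow> \<bar>h z - p z\<bar> < e"
      using Stone_Weierstrass_real_polynomial_function[of "torus_embed ` cbox 0 1" h e]
        h \<open>e > 0\<close> continuous_on_subset by (metis subset_UNIV)
    let ?p = "\<lambda>x. complex_of_real (p (torus_embed x))"
    have p0: "continuous_on UNIV ?p" "(\<integral>x. ?p x * f x \<partial>torus) = 0"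
      using trig_poly_integral_zero[OF f zero trig_poly_polynomial_function[OF p]] by auto
    have "(\<integral>x. ?h x * f x \<partial>torus) = (\<integral>x. ?h x * f x \<partial>torus) - (\<integral>x. ?p x * f x \<partial>torus)"
      by (simp add: p0)
    also have "\<dots> = (\<integral>x. ?h x * f x - ?p x * f x \<partial>torus)"
      by (intro Bochner_Integration.integral_diff[symmetric] integrable_torus_continuous_mult f hc p0)
    also have "norm \<dots> \<le> (\<integral>x. e * norm (f x) \<partial>torus)"
    proof (rule Bochner_Integration.integral_norm_bound_integral)
      show "integrable torus (\<lambda>x. ?h x * f x - ?p x * f x)"
        by (intro Bochner_Integration.integrable_diff integrable_torus_continuous_mult f hc p0)
      show "integrable torus (\<lambda>x. e * norm (f x))"
        using f by auto
      fix x assume "x \<in> space torus"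
      then have "cmod (?h x - ?p x) \<le> e"
        using close[of "torus_embed x"] unfolding of_real_diff[symmetric] norm_of_real by fastforce
      then show "norm (?h x * f x - ?p x * f x) \<le> e * norm (f x)"
        unfolding left_diff_distrib[symmetric] norm_mult by (rule mult_right_mono) simp
    qed
    finally show ?thesis
      by simp
  qed
  note le = this
  have "norm (\<integral>x. ?h x * f x \<partial>torus) \<le> 0"
  proof (rule field_le_epsilon)
    fix e :: real assume "e > 0"
    have "?I \<ge> 0" by simp
    \<comment> \<open>The summand 1 keeps the denominator positive when \<open>f\<close> vanishes
      almost everywhere.\<close>
    have "norm (\<integral>x. ?h x * f x \<partial>torus) \<le> e / (?I + 1) * ?I"
      using \<open>e > 0\<close> \<open>?I \<ge> 0\<close> by (intro le) (simp add: add_nonneg_pos)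
    also have "\<dots> = e * (?I / (?I + 1))"
      by simp
    also have "\<dots> \<le> e * 1"
    proof (rule mult_left_mono)
      show "?I / (?I + 1) \<le> 1"
        by (subst divide_le_eq_1_pos) (use \<open>?I \<ge> 0\<close> in linarith, simp)
    qed (use \<open>e > 0\<close> in simp)
    finally show "norm (\<integral>x. ?h x * f x \<partial>torus) \<le> 0 + e"
      by simp
  qed
  then show ?thesis
    by simp
qed

text \<open>The indicator function of a compact set \<open>K\<close> inside the open cell is the limit of continuous
  functions on the torus, because the embedding separates \<open>K\<close> from the rest of the closed cell.\<close>

lemma compact_integral_zero:
  assumes f: "integrable torus f" and zero: "\<And>m. fourier_coeff f m = 0"
    and K: "compact K" "K \<subseteq> box 0 1"
  shows "(\<integral>x. indicator K x *\<^sub>R f x \<partial>torus) = 0"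
proof (cases "K = {}")
  case False
  define h where "h n z = max 0 (1 - real n * infdist z (torus_embed ` K))" for n z
  have hc: "continuous_on UNIV (h n)" for n
    unfolding h_def by (intro continuous_intros)
  have [measurable]: "f \<in> borel_measurable torus"
    using f by auto
  have [measurable]: "(\<lambda>x. h n (torus_embed x)) \<in> borel_measurable torus" for n
    by (intro borel_measurable_torus_continuous continuous_on_compose2[OF hc] continuous_on_torus_embed) auto
  have KS: "K \<in> sets borel"
    using K by (simp add: borel_compact)
  have [measurable]: "(indicator K :: real^3 \<Rightarrow> real) \<in> borel_measurable torus"
    by (intro measurable_torusI borel_measurable_indicator KS)
  have cl: "closed (torus_embed ` K)"
    by (intro compact_imp_closed compact_continuous_image continuous_on_torus_embed K)
  have lim: "(\<lambda>n. h n (torus_embed x)) \<longlonglongrightarrow> indicator K x" if "x \<in> cbox 0 1" for x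
  proof (cases "x \<in> K")
    case True
    then show ?thesis by (simp add: h_def)
  next
    case False
    then have "torus_embed x \<notin> torus_embed ` K"
      using torus_embed_eq_iff that K(2) by (metis image_iff subsetD)
    then have pos: "infdist (torus_embed x) (torus_embed ` K) > 0"
      using \<open>K \<noteq> {}\<close> cl by (intro infdist_pos_not_in_closed) auto
    then obtain N :: nat where N: "1 < real N * infdist (torus_embed x) (torus_embed ` K)"
      using reals_Archimedean3 by blast
    have "h n (torus_embed x) = 0" if "n \<ge> N" for n
    proof -
      have "real N * infdist (torus_embed x) (torus_embed ` K) \<le> real n * infdist (torus_embed x) (torus_embed ` K)"
        using that pos by (intro mult_right_mono) auto
      then show ?thesis
        using N by (simp add: h_def)
    qed
    then show ?thesis
      using False by (intro tendsto_eventually eventually_sequentiallyI[of N]) auto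
  qed
  have "(\<lambda>n. \<integral>x. of_real (h n (torus_embed x)) * f x \<partial>torus) \<longlonglongrightarrow> (\<integral>x. indicator K x *\<^sub>R f x \<partial>torus)"
  proof (rule integral_dominated_convergence[where w = "\<lambda>x. norm (f x)"])
    show "(\<lambda>x. indicator K x *\<^sub>R f x) \<in> borel_measurable torus"
      by measurable
    show "integrable torus (\<lambda>x. norm (f x))"
      using f by auto
    show "AE x in torus. (\<lambda>n. of_real (h n (torus_embed x)) * f x) \<longlonglongrightarrow> indicator K x *\<^sub>R f x"
    proof (rule AE_I2)
      fix x assume "x \<in> space torus"
      then have "(\<lambda>n. h n (torus_embed x)) \<longlonglongrightarrow> indicator K x"
        by (intro lim) simp
      then show "(\<lambda>n. of_real (h n (torus_embed x)) * f x) \<longlonglongrightarrow> indicator K x *\<^sub>R f x"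
        unfolding scaleR_conv_of_real by (intro tendsto_intros)
    qed
    show "AE x in torus. norm (of_real (h n (torus_embed x)) * f x) \<le> norm (f x)" for n
    proof (rule AE_I2)
      fix x
      have "\<bar>h n (torus_embed x)\<bar> \<le> 1"
        using infdist_nonneg[of "torus_embed x" "torus_embed ` K"] by (simp add: h_def)
      then show "norm (of_real (h n (torus_embed x)) * f x) \<le> norm (f x)"
        unfolding norm_mult norm_of_real using mult_right_mono[of "\<bar>h n (torus_embed x)\<bar>" 1 "norm (f x)"] by simp
    qed
  qed measurable
  then show ?thesis
    by (simp add: continuous_integral_zero[OF f zero hc] LIMSEQ_const_iff)
qed simp

lemma null_sets_torus_boundary: "cbox 0 1 - box 0 (1 :: real^3) \<in> null_sets lebesgue"
proof -
  have "negligible (frontier (cbox 0 (1 :: real^3)))"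
    by (rule negligible_convex_frontier) (rule convex_box)
  moreover have "frontier (cbox 0 (1 :: real^3)) = cbox 0 1 - box 0 1"
    by (simp add: frontier_cbox)
  ultimately show ?thesis
    by (simp add: negligible_iff_null_sets)
qed

text \<open>Closed subsets of the set where \<open>Re f > 0\<close> inside the open cell are null,
  because a positive function has integral zero there; inner approximation by closed sets makes the
  whole set null.\<close>

lemma AE_Re_nonpos:
  assumes f: "integrable torus f"
    and zero: "\<And>K. compact K \<Longrightarrow> K \<subseteq> box 0 1 \<Longrightarrow> (\<integral>x. indicator K x *\<^sub>R f x \<partial>torus) = 0"
  shows "AE x in torus. Re (f x) \<le> 0"
proof -
  have [measurable]: "f \<in> borel_measurable torus"
    using f by auto
  define S where "S = {x \<in> box 0 1. Re (f x) > 0}"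
  have sub: "box 0 1 \<subseteq> cbox 0 (1 :: real^3)"
    by (rule box_subset_cbox)
  have "{x \<in> space torus. Re (f x) > 0} \<in> sets torus"
    by measurable
  then have "{x \<in> cbox 0 1. Re (f x) > 0} \<in> sets lebesgue"
    by (simp add: sets_restrict_space_iff)
  moreover have "S = {x \<in> cbox 0 1. Re (f x) > 0} \<inter> box 0 1"
    using sub by (auto simp: S_def)
  ultimately have S: "S \<in> sets lebesgue"
    by auto
  have null: "emeasure lebesgue K = 0" if "closed K" "K \<subseteq> S" for K
  proof -
    have K: "compact K" "K \<subseteq> box 0 1"
      using that bounded_subset[OF bounded_box, of K 0 1] by (auto simp: S_def compact_eq_bounded_closed)
    have KS: "K \<in> sets borel"
      using \<open>closed K\<close> by simp
    have Kt: "K \<in> sets torus"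
      using K sub KS by (auto simp: sets_restrict_space_iff sets_completionI_sets)
    have int: "integrable torus (\<lambda>x. indicator K x *\<^sub>R f x)"
      by (rule integrable_mult_indicator[OF Kt f])
    have "(\<integral>x. Re (indicator K x *\<^sub>R f x) \<partial>torus) = 0"
      using zero[OF K] integral_Re[OF int] by simp
    then have "AE x in torus. Re (indicator K x *\<^sub>R f x) = 0"
    proof (subst (asm) integral_nonneg_eq_0_iff_AE)
      show "integrable torus (\<lambda>x. Re (indicator K x *\<^sub>R f x))"
        by (rule integrable_Re[OF int])
      show "AE x in torus. 0 \<le> Re (indicator K x *\<^sub>R f x)"
        by (rule AE_I2) (use that(2) in \<open>auto simp: S_def indicator_def intro: less_imp_le\<close>)
    qed
    then have "AE x in torus. x \<notin> K"
      by (rule AE_mp, intro AE_I2) (use that(2) in \<open>auto simp: S_def indicator_def\<close>)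
    have "{x \<in> space torus. \<not> x \<notin> K} = K"
      using K sub by auto
    from AE_iff_measurable[OF Kt this] \<open>AE x in torus. x \<notin> K\<close> have "emeasure torus K = 0"
      by (rule iffD1)
    moreover have "emeasure torus K = emeasure lebesgue K"
      by (rule emeasure_restrict_space) (use K sub in auto)
    ultimately show ?thesis
      by simp
  qed
  have "emeasure lebesgue S \<le> ennreal e" if "e > 0" for e
  proof -
    obtain T where T: "closed T" "T \<subseteq> S" "S - T \<in> lmeasurable" "emeasure lebesgue (S - T) < ennreal e"
      using sets_lebesgue_inner_closed[OF S \<open>e > 0\<close>] by blast
    have "emeasure lebesgue S \<le> emeasure lebesgue (S - T) + emeasure lebesgue T"
    proof -
      have "T \<in> sets lebesgue"
        using T by (simp add: sets_completionI_sets)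
      then have "emeasure lebesgue ((S - T) \<union> T) \<le> emeasure lebesgue (S - T) + emeasure lebesgue T"
        using T S by (intro emeasure_subadditive) auto
      moreover have "(S - T) \<union> T = S"
        using T by auto
      ultimately show ?thesis by simp
    qed
    then show ?thesis
      using null[OF T(1,2)] T(4) by simp
  qed
  then have "emeasure lebesgue S = 0"
    by (metis ennreal_le_epsilon add.left_neutral le_zero_eq)
  then have "S \<in> null_sets lebesgue"
    using S by auto
  then have N: "S \<union> (cbox 0 1 - box 0 1) \<in> null_sets lebesgue"
    by (rule null_sets.Un[OF _ null_sets_torus_boundary])
  have "AE x in lebesgue. x \<in> cbox 0 1 \<longrightarrow> Re (f x) \<le> 0"
    using AE_not_in[OF N] by (rule AE_mp) (auto simp: S_def)
  then show ?thesis
    by (simp add: AE_restrict_space_iff)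
qed

lemma AE_zero_of_fourier_coeff_zero:
  assumes f: "integrable torus f" and zero: "\<And>m. fourier_coeff f m = 0"
  shows "AE x in torus. f x = 0"
proof -
  \<comment> \<open>The factors 1, -1, \<i> and -\<i> bound the real and imaginary parts of
    \<open>f\<close> from both sides.\<close>
  have "AE x in torus. Re (a * f x) \<le> 0" for a
  proof (rule AE_Re_nonpos)
    fix K :: "(real^3) set" assume "compact K" "K \<subseteq> box 0 1"
    then show "(\<integral>x. indicator K x *\<^sub>R (a * f x) \<partial>torus) = 0"
      using compact_integral_zero[OF f zero] by (simp flip: mult_scaleR_right)
  qed (use f in auto)
  from this[of 1] this[of "- 1"] this[of \<i>] this[of "- \<i>"] show ?thesis
    by eventually_elim (auto simp: complex_eq_iff)
qed

text \<open>Completeness of the exponential system. It gives the uniqueness behind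
  \<open>of_coeffs\<close> and allows operators to be compared coefficientwise.\<close>

lemma l2torus_eqI:
  assumes "\<And>m. l2_coeff u m = l2_coeff v m"
  shows "u = v"
proof -
  obtain f where f: "sq_integrable f" "u - v = abs_l2torus f"
    by (rule l2torus_cases)
  have "fourier_coeff f m = 0" for m
    using assms by (simp add: l2_coeff_diff flip: l2_coeff_abs[OF f(1)] f(2))
  then have "AE x in torus. f x = 0"
    by (intro AE_zero_of_fourier_coeff_zero sq_integrable_integrable f)
  then have "l2rel f (\<lambda>x. 0)"
    using f by (simp add: l2rel_def sq_integrable_zero)
  then have "abs_l2torus f = 0"
    unfolding zero_l2torus_def using Quotient3_rel_abs[OF Quotient3_l2torus] by blast
  then show ?thesis
    using f by simp
qed

section \<open>Riesz-Fischer and Parseval\<close>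

lemma cinner_sum_left: "cinner (\<Sum>i\<in>I. f i) y = (\<Sum>i\<in>I. cinner (f i) y)"
  by (rule linear_sum[OF bounded_linear.linear[OF bounded_bilinear.bounded_linear_left[OF bounded_bilinear_cinner]]])

lemma cinner_sum_right: "cinner y (\<Sum>i\<in>I. f i) = (\<Sum>i\<in>I. cinner y (f i))"
  by (rule linear_sum[OF bounded_linear.linear[OF bounded_bilinear.bounded_linear_right[OF bounded_bilinear_cinner]]])

lemma l2_coeff_sum_fourier_vec:
  assumes "finite F"
  shows "l2_coeff (\<Sum>n\<in>F. c n *\<^sub>C fourier_vec n) m = (if m \<in> F then c m else 0)"
proof -
  have "l2_coeff (\<Sum>n\<in>F. c n *\<^sub>C fourier_vec n) m = (\<Sum>n\<in>F. if m = n then c n else 0)"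
    unfolding l2_coeff_eq_cinner cinner_sum_right cinner_scaleC_right cinner_fourier_vec
    by (intro sum.cong) auto
  then show ?thesis
    using assms by simp
qed

lemma norm_sum_fourier_vec:
  assumes "finite F"
  shows "(norm (\<Sum>m\<in>F. c m *\<^sub>C fourier_vec m))\<^sup>2 = (\<Sum>m\<in>F. (cmod (c m))\<^sup>2)"
proof -
  have "complex_of_real ((norm (\<Sum>m\<in>F. c m *\<^sub>C fourier_vec m))\<^sup>2) = (\<Sum>m\<in>F. cnj (c m) * c m)"
    unfolding cinner_same[symmetric]
    by (subst cinner_sum_left) (auto simp: cinner_scaleC_left l2_coeff_sum_fourier_vec[OF assms]
        simp flip: l2_coeff_eq_cinner intro!: sum.cong)
  also have "\<dots> = of_real (\<Sum>m\<in>F. (cmod (c m))\<^sup>2)"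
    unfolding of_real_sum by (intro sum.cong refl) (metis complex_norm_square mult.commute of_real_power)
  finally show ?thesis
    unfolding of_real_eq_iff .
qed

text \<open>By orthonormality the squared norm of a finite section is a sum of squared moduli, so
  the Cauchy criterion passes from the scalars to the vectors.\<close>

lemma l2_series_summable:
  assumes "(\<lambda>m. (cmod (c m))\<^sup>2) summable_on UNIV"
  shows "(\<lambda>m. c m *\<^sub>C fourier_vec m) summable_on UNIV"
proof -
  let ?f = "\<lambda>m. c m *\<^sub>C fourier_vec m" and ?s = "\<lambda>F. \<Sum>m\<in>F. (cmod (c m))\<^sup>2"
  obtain L where L: "(?s \<longlongrightarrow> L) (finite_subsets_at_top UNIV)"
    using assms unfolding summable_on_def has_sum_def by blast
  have "\<exists>P. eventually P (finite_subsets_at_top UNIV) \<and>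
              (\<forall>F F'. P F \<and> P F' \<longrightarrow> dist (sum ?f F) (sum ?f F') < e)" if "e > 0" for e
  proof -
    \<comment> \<open>Two sums within \<open>d\<close> of the limit differ by less than
      \<open>2 d = (e / 2)^2\<close>.\<close>
    define d where "d = e\<^sup>2 / 8"
    have "d > 0"
      using that by (simp add: d_def)
    then have "\<forall>\<^sub>F F in finite_subsets_at_top UNIV. dist (?s F) L < d"
      using L by (simp add: tendsto_iff)
    then obtain F0 where F0: "finite F0" "\<And>F. finite F \<Longrightarrow> F0 \<subseteq> F \<Longrightarrow> dist (?s F) L < d"
      unfolding eventually_finite_subsets_at_top by auto
    let ?P = "\<lambda>F. finite F \<and> F0 \<subseteq> F"
    have near: "norm (sum ?f G - sum ?f F) < e / 2" if "?P F" "?P G" "F \<subseteq> G" for F G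
    proof -
      have "sum ?f G - sum ?f F = sum ?f (G - F)" "?s G - ?s F = ?s (G - F)"
        using that by (simp_all add: sum_diff)
      then have "(norm (sum ?f G - sum ?f F))\<^sup>2 = ?s G - ?s F"
        using that by (simp add: norm_sum_fourier_vec)
      also have "\<dots> < 2 * d"
        using F0(2)[of F] F0(2)[of G] that by (simp add: dist_real_def)
      also have "\<dots> = (e / 2)\<^sup>2"
        by (simp add: d_def power2_eq_square)
      finally show ?thesis
        by (rule power2_less_imp_less) (use \<open>e > 0\<close> in simp)
    qed
    have "dist (sum ?f F) (sum ?f G) < e" if "?P F" "?P G" for F G
    proof -
      have "norm (sum ?f (F \<union> G) - sum ?f F) < e / 2" "norm (sum ?f (F \<union> G) - sum ?f G) < e / 2"
        using that near[of F "F \<union> G"] near[of G "F \<union> G"] by blast+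
      then show ?thesis
        unfolding dist_norm[symmetric] by (rule dist_triangle_half_r)
    qed
    moreover have "eventually ?P (finite_subsets_at_top UNIV)"
      unfolding eventually_finite_subsets_at_top using F0(1) by auto
    ultimately show ?thesis
      by blast
  qed
  then have "cauchy_filter (filtermap (sum ?f) (finite_subsets_at_top UNIV))"
    by (simp add: cauchy_filter_metric_filtermap)
  moreover have "complete (UNIV :: l2torus set)"
    by (meson Cauchy_convergent UNIV_I complete_def convergent_def)
  ultimately obtain u where "(sum ?f \<longlongrightarrow> u) (finite_subsets_at_top UNIV)"
    using complete_uniform[where S=UNIV] by (force simp add: filterlim_def)
  then show ?thesis
    using summable_on_def has_sum_def by blast
qed

text \<open>Existence comes from the convergent series, uniqueness from \<open>l2torus_eqI\<close>.
  The description in \<open>of_coeffs\<close> denotes something only for square summable families,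
  so every use below establishes that first.\<close>

lemma l2_coeff_of_coeffs:
  assumes "(\<lambda>m. (cmod (c m))\<^sup>2) summable_on UNIV"
  shows "l2_coeff (of_coeffs c) m = c m"
proof -
  obtain u where u: "((\<lambda>m. c m *\<^sub>C fourier_vec m) has_sum u) UNIV"
    using l2_series_summable[OF assms] by (auto simp: summable_on_def)
  have "l2_coeff u m = c m" for m
  proof -
    have "((\<lambda>n. l2_coeff (c n *\<^sub>C fourier_vec n) m) has_sum l2_coeff u m) UNIV"
      by (rule has_sum_bounded_linear[OF bounded_linear_l2_coeff u])
    moreover have "((\<lambda>n. l2_coeff (c n *\<^sub>C fourier_vec n) m) has_sum c m) UNIV"
      by (rule has_sum_finite_neutralI[of "{m}"])
         (auto simp: l2_coeff_scaleC l2_coeff_fourier_vec)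
    ultimately show ?thesis
      by (rule has_sum_unique)
  qed
  moreover from this have "of_coeffs c = u"
    unfolding of_coeffs_def by (intro the_equality allI) (simp_all add: l2torus_eqI)
  ultimately show ?thesis by simp
qed

lemma bessel:
  assumes "finite F"
  shows "(\<Sum>m\<in>F. (cmod (l2_coeff u m))\<^sup>2) \<le> (norm u)\<^sup>2"
proof -
  let ?s = "\<Sum>m\<in>F. l2_coeff u m *\<^sub>C fourier_vec m"
  have "cinner ?s u = (\<Sum>m\<in>F. cnj (l2_coeff u m) * l2_coeff u m)"
    by (simp add: cinner_sum_left cinner_scaleC_left l2_coeff_eq_cinner)
  also have "\<dots> = of_real (\<Sum>m\<in>F. (cmod (l2_coeff u m))\<^sup>2)"
    unfolding of_real_sum by (intro sum.cong refl) (metis complex_norm_square mult.commute of_real_power)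
  finally have "inner ?s u = (norm ?s)\<^sup>2"
    unfolding norm_sum_fourier_vec[OF assms] Re_cinner[symmetric] by simp
  then have "(norm (u - ?s))\<^sup>2 = (norm u)\<^sup>2 - (norm ?s)\<^sup>2"
    by (simp add: power2_norm_eq_inner inner_diff_left inner_diff_right inner_commute)
  then show ?thesis
    using norm_sum_fourier_vec[OF assms, of "l2_coeff u"] zero_le_power2[of "norm (u - ?s)"] by linarith
qed

lemma summable_l2_coeff: "(\<lambda>m. (cmod (l2_coeff u m))\<^sup>2) summable_on UNIV"
  by (rule nonneg_bdd_above_summable_on) (auto intro!: bdd_aboveI[where M = "(norm u)\<^sup>2"] bessel)

text \<open>The series converges by Bessel's inequality; its sum has the coefficients of
  \<open>u\<close> and equals \<open>u\<close> by completeness.\<close>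

lemma has_sum_fourier: "((\<lambda>m. l2_coeff u m *\<^sub>C fourier_vec m) has_sum u) UNIV"
proof -
  obtain v where v: "((\<lambda>m. l2_coeff u m *\<^sub>C fourier_vec m) has_sum v) UNIV"
    using l2_series_summable[OF summable_l2_coeff] by (auto simp: summable_on_def)
  have "l2_coeff v m = l2_coeff u m" for m
  proof (rule has_sum_unique)
    show "((\<lambda>n. l2_coeff (l2_coeff u n *\<^sub>C fourier_vec n) m) has_sum l2_coeff v m) UNIV"
      by (rule has_sum_bounded_linear[OF bounded_linear_l2_coeff v])
    show "((\<lambda>n. l2_coeff (l2_coeff u n *\<^sub>C fourier_vec n) m) has_sum l2_coeff u m) UNIV"
      by (rule has_sum_finite_neutralI[of "{m}"])
         (auto simp: l2_coeff_scaleC l2_coeff_fourier_vec)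
  qed
  then have "v = u"
    by (rule l2torus_eqI)
  then show ?thesis
    using v by simp
qed

lemma parseval: "((\<lambda>m. cnj (l2_coeff u m) * l2_coeff v m) has_sum cinner u v) UNIV"
  using has_sum_bounded_linear[OF bounded_bilinear.bounded_linear_left[OF bounded_bilinear_cinner, of v] has_sum_fourier[of u]]
  by (simp add: cinner_scaleC_left l2_coeff_eq_cinner)

lemma cnj_mult_self: "cnj z * z = of_real ((cmod z)\<^sup>2)"
  by (metis complex_norm_square mult.commute of_real_power)

lemma parseval_norm: "((\<lambda>m. (cmod (l2_coeff u m))\<^sup>2) has_sum (norm u)\<^sup>2) UNIV"
proof -
  have "((\<lambda>m. complex_of_real ((cmod (l2_coeff u m))\<^sup>2)) has_sum of_real ((norm u)\<^sup>2)) UNIV"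
    using parseval[of u u] by (simp only: cinner_same cnj_mult_self)
  from has_sum_Re[OF this] show ?thesis
    by simp
qed

lemma norm_tail_tendsto_zero:
  "((\<lambda>F. norm (u - (\<Sum>m\<in>F. l2_coeff u m *\<^sub>C fourier_vec m))) \<longlongrightarrow> 0) (finite_subsets_at_top UNIV)"
proof -
  have "((\<lambda>F. \<Sum>m\<in>F. l2_coeff u m *\<^sub>C fourier_vec m) \<longlongrightarrow> u) (finite_subsets_at_top UNIV)"
    using has_sum_fourier[of u] by (simp add: has_sum_def)
  then have "((\<lambda>F. norm (u - (\<Sum>m\<in>F. l2_coeff u m *\<^sub>C fourier_vec m))) \<longlongrightarrow> norm (u - u)) (finite_subsets_at_top UNIV)"
    by (intro tendsto_intros)
  then show ?thesis
    by simp
qed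


section \<open>Periodisation\<close>

text \<open>Half-open cells partition the space, while \<open>torus\<close> uses the closed cell;
  the two fundamental domains differ by a null set.\<close>

definition unit_cell :: "int^3 \<Rightarrow> (real^3) set" where
  "unit_cell n = {x. \<forall>i. \<lfloor>x $ i\<rfloor> = n $ i}"

lemma sets_unit_cell: "unit_cell n \<in> sets borel"
proof -
  have "unit_cell n = (\<Inter>i. {x. of_int (n $ i) \<le> x $ i} \<inter> {x. x $ i < of_int (n $ i) + 1})"
    by (auto simp: unit_cell_def floor_eq_iff)
  also have "\<dots> \<in> sets borel"
    by (intro sets.countable_INT' sets.Int borel_closed borel_open closed_Collect_le open_Collect_less
        continuous_intros) auto
  finally show ?thesis .
qed

lemma Union_unit_cell: "(\<Union>n. unit_cell n) = UNIV"
proof -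
  have "x \<in> unit_cell (\<chi> i. \<lfloor>x $ i\<rfloor>)" for x
    by (simp add: unit_cell_def)
  then show ?thesis by blast
qed

lemma disjoint_unit_cell: "m \<noteq> n \<Longrightarrow> unit_cell m \<inter> unit_cell n = {}"
  by (auto simp: unit_cell_def vec_eq_iff)

lemma translate_unit_cell: "lattice_point n + y \<in> unit_cell n \<longleftrightarrow> y \<in> unit_cell 0"
  by (simp add: unit_cell_def lattice_point_def add.commute[of "of_int _"] floor_add_int[symmetric])

lemma lebesgue_translation:
  "distr lebesgue lebesgue (\<lambda>x. a + x) = (lebesgue :: 'a::euclidean_space measure)"
  "(\<lambda>x. a + x) \<in> measurable lebesgue (lebesgue :: 'a::euclidean_space measure)"
proof -
  have T: "(\<lambda>x. a + (\<Sum>j\<in>Basis. (1 * (x \<bullet> j)) *\<^sub>R j)) = (\<lambda>x. a + x)"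
    by (simp add: euclidean_representation)
  show "(\<lambda>x. a + x) \<in> measurable lebesgue (lebesgue :: 'a::euclidean_space measure)"
    using lebesgue_affine_measurable[of "\<lambda>_. 1" a] unfolding T by simp
  show "distr lebesgue lebesgue (\<lambda>x. a + x) = (lebesgue :: 'a::euclidean_space measure)"
    using lebesgue_affine_euclidean[of "\<lambda>_. 1" a] unfolding T by (simp add: density_1)
qed

lemma AE_torus_unit_cell: "AE x in lebesgue. x \<in> cbox 0 1 \<longleftrightarrow> x \<in> unit_cell 0"
proof -
  have *: "x \<in> box 0 1 \<Longrightarrow> x \<in> unit_cell 0" "x \<in> unit_cell 0 \<Longrightarrow> x \<in> cbox 0 1" for x
    by (auto simp: unit_cell_def mem_box_cart floor_eq_iff less_imp_le)
  show ?thesis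
    using AE_not_in[OF null_sets_torus_boundary] by (rule AE_mp) (intro AE_I2, use * in auto)
qed

lemma integral_torus_translate:
  fixes h :: "real^3 \<Rightarrow> complex"
  assumes h: "integrable lebesgue h"
  shows "integrable torus (\<lambda>y. h (lattice_point n + y))"
    "(\<integral>y. h (lattice_point n + y) \<partial>torus) = (\<integral>x. indicator (unit_cell n) x *\<^sub>R h x \<partial>lebesgue)"
proof -
  let ?a = "lattice_point n"
  have [measurable]: "h \<in> borel_measurable lebesgue"
    using h by auto
  note T [measurable] = lebesgue_translation(2)[of ?a]
  have U: "unit_cell n \<in> sets lebesgue" "unit_cell 0 \<in> sets lebesgue"
    using sets_unit_cell by (auto intro: sets_completionI_sets)
  have [measurable]: "(\<lambda>y. h (?a + y)) \<in> borel_measurable lebesgue"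
    by (rule measurable_compose[OF T]) measurable
  have int: "integrable lebesgue (\<lambda>x. indicator (unit_cell n) x *\<^sub>R h x)"
    by (rule integrable_mult_indicator[OF U(1) h])
  have "integrable lebesgue (\<lambda>y. h (?a + y))"
    using h lebesgue_translation(1)[of ?a] integrable_distr[OF T, of h] by simp
  then have "integrable lebesgue (\<lambda>y. indicator (cbox 0 1) y *\<^sub>R h (?a + y))"
    by (intro integrable_mult_indicator) auto
  then show "integrable torus (\<lambda>y. h (?a + y))"
    by (subst integrable_restrict_space) auto
  have "(\<integral>x. indicator (unit_cell n) x *\<^sub>R h x \<partial>lebesgue)
      = (\<integral>y. indicator (unit_cell n) (?a + y) *\<^sub>R h (?a + y) \<partial>lebesgue)"
    by (subst (1) lebesgue_translation(1)[of ?a, symmetric], subst integral_distr[OF T])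
       (use int in auto)
  also have "\<dots> = (\<integral>y. indicator (cbox 0 1) y *\<^sub>R h (?a + y) \<partial>lebesgue)"
  proof (rule integral_cong_AE)
    show "(\<lambda>y. indicator (unit_cell n) (?a + y) *\<^sub>R h (?a + y)) \<in> borel_measurable lebesgue"
      using U(2) by (simp add: indicator_def translate_unit_cell)
    show "(\<lambda>y. indicator (cbox 0 1) y *\<^sub>R h (?a + y)) \<in> borel_measurable lebesgue"
      by (intro borel_measurable_scaleR borel_measurable_indicator) auto
    show "AE y in lebesgue. indicator (unit_cell n) (?a + y) *\<^sub>R h (?a + y) = indicator (cbox 0 1) y *\<^sub>R h (?a + y)"
      using AE_torus_unit_cell by (rule AE_mp) (auto simp: indicator_def translate_unit_cell)
  qed
  also have "\<dots> = (\<integral>y. h (?a + y) \<partial>torus)"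
    by (rule integral_restrict_space[symmetric]) auto
  finally show "(\<integral>y. h (?a + y) \<partial>torus) = (\<integral>x. indicator (unit_cell n) x *\<^sub>R h x \<partial>lebesgue)" ..
qed

lemma infinite_UNIV_int3: "infinite (UNIV :: (int^3) set)"
proof -
  have "inj (\<lambda>k::int. (vec k :: int^3))"
    by (auto simp: inj_def vec_eq_iff)
  then show ?thesis
    using infinite_UNIV_int finite_imageD[of "\<lambda>k::int. (vec k :: int^3)" UNIV] finite_subset[OF subset_UNIV]
    by blast
qed

text \<open>Integrability makes the lattice sum absolutely convergent almost everywhere and allows
  summation and integration to be exchanged; the translated cells then reassemble to the whole
  space.\<close>

lemma integral_periodisation:
  fixes h :: "real^3 \<Rightarrow> complex"
  assumes h: "integrable lebesgue h"
  shows "(\<integral>y. (\<Sum>\<^sub>\<infinity>n. h (lattice_point n + y)) \<partial>torus) = (\<integral>x. h x \<partial>lebesgue)"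
proof -
  \<comment> \<open>An enumeration of the lattice gives access to the convergence theorems for
    ordinary series.\<close>
  define b where "b = (from_nat_into UNIV :: nat \<Rightarrow> int^3)"
  have b: "bij b"
    unfolding b_def by (rule bij_betw_from_nat_into[OF countableI_type infinite_UNIV_int3])
  have U: "unit_cell n \<in> sets lebesgue" for n
    using sets_unit_cell by (auto intro: sets_completionI_sets)
  have UN: "(\<Union>k. unit_cell (b k)) = UNIV"
    using Union_unit_cell bij_is_surj[OF b] by (metis UN_extend_simps(10))
  have disj: "unit_cell (b i) \<inter> unit_cell (b j) = {}" if "i \<noteq> j" for i j
    using that bij_is_inj[OF b] by (intro disjoint_unit_cell) (auto dest: injD)
  have hn: "integrable lebesgue (\<lambda>x. complex_of_real (norm (h x)))"
    using h by auto
  have nt: "(\<integral>y. norm (h (lattice_point n + y)) \<partial>torus) = (\<integral>x. indicator (unit_cell n) x *\<^sub>R norm (h x) \<partial>lebesgue)" for n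
  proof -
    have "complex_of_real (\<integral>y. norm (h (lattice_point n + y)) \<partial>torus)
        = of_real (\<integral>x. indicator (unit_cell n) x *\<^sub>R norm (h x) \<partial>lebesgue)"
      using integral_torus_translate(2)[OF hn, of n]
      by (simp add: scaleR_conv_of_real flip: of_real_mult integral_complex_of_real)
    then show ?thesis
      unfolding of_real_eq_iff .
  qed
  have sum: "summable (\<lambda>k. \<integral>y. norm (h (lattice_point (b k) + y)) \<partial>torus)"
  proof (rule bounded_imp_summable)
    fix k
    show "0 \<le> (\<integral>y. norm (h (lattice_point (b k) + y)) \<partial>torus)"
      by simp
    have "(\<Sum>i\<le>k. \<integral>y. norm (h (lattice_point (b i) + y)) \<partial>torus)
        = (\<integral>x. (\<Sum>i\<le>k. indicator (unit_cell (b i)) x *\<^sub>R norm (h x)) \<partial>lebesgue)"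
      unfolding nt by (intro Bochner_Integration.integral_sum[symmetric] integrable_mult_indicator U integrable_norm h)
    also have "\<dots> \<le> (\<integral>x. norm (h x) \<partial>lebesgue)"
    proof (rule integral_mono)
      show "integrable lebesgue (\<lambda>x. \<Sum>i\<le>k. indicator (unit_cell (b i)) x *\<^sub>R norm (h x))"
        by (intro Bochner_Integration.integrable_sum integrable_mult_indicator U integrable_norm h)
      show "integrable lebesgue (\<lambda>x. norm (h x))"
        using h by auto
      fix x
      have "(\<Sum>i\<le>k. indicator (unit_cell (b i)) x) = (indicator (\<Union>i\<le>k. unit_cell (b i)) x :: real)"
        by (rule indicator_UN_disjoint[symmetric]) (auto simp: disjoint_family_on_def disj)
      also have "\<dots> \<le> 1"
        by (rule indicator_le_1)
      finally show "(\<Sum>i\<le>k. indicator (unit_cell (b i)) x *\<^sub>R norm (h x)) \<le> norm (h x)"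
        unfolding scaleR_sum_left[symmetric] by (simp add: mult_left_le_one_le sum_nonneg)
    qed
    finally show "(\<Sum>i\<le>k. \<integral>y. norm (h (lattice_point (b i) + y)) \<partial>torus) \<le> (\<integral>x. norm (h x) \<partial>lebesgue)" .
  qed
  have AE_sum: "AE y in torus. summable (\<lambda>k. norm (h (lattice_point (b k) + y)))"
  proof -
    have [measurable]: "(\<lambda>y. h (lattice_point (b k) + y)) \<in> borel_measurable torus" for k
      using integral_torus_translate(1)[OF h] by auto
    have "(\<integral>\<^sup>+y. (\<Sum>k. ennreal (norm (h (lattice_point (b k) + y)))) \<partial>torus)
        = (\<Sum>k. \<integral>\<^sup>+y. ennreal (norm (h (lattice_point (b k) + y))) \<partial>torus)"
      by (rule nn_integral_suminf) measurable
    also have "\<dots> = (\<Sum>k. ennreal (\<integral>y. norm (h (lattice_point (b k) + y)) \<partial>torus))"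
      by (intro suminf_cong nn_integral_eq_integral integrable_norm integral_torus_translate(1)[OF h]) auto
    also have "\<dots> = ennreal (\<Sum>k. \<integral>y. norm (h (lattice_point (b k) + y)) \<partial>torus)"
      by (intro suminf_ennreal2 sum) auto
    finally have "(\<integral>\<^sup>+y. (\<Sum>k. ennreal (norm (h (lattice_point (b k) + y)))) \<partial>torus) \<noteq> \<infinity>"
      by simp
    then have "AE y in torus. (\<Sum>k. ennreal (norm (h (lattice_point (b k) + y)))) \<noteq> \<infinity>"
      by (intro nn_integral_PInf_AE) measurable
    then show ?thesis
    proof (rule AE_mp, intro AE_I2 impI)
      fix y assume "(\<Sum>k. ennreal (norm (h (lattice_point (b k) + y)))) \<noteq> \<infinity>"
      then show "summable (\<lambda>k. norm (h (lattice_point (b k) + y)))"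
        by (intro summable_suminf_not_top) auto
    qed
  qed
  have eq: "AE y in torus. (\<Sum>\<^sub>\<infinity>n. h (lattice_point n + y)) = (\<Sum>k. h (lattice_point (b k) + y))"
    using AE_sum
  proof (rule AE_mp, intro AE_I2 impI)
    fix y assume "summable (\<lambda>k. norm (h (lattice_point (b k) + y)))"
    then have "((\<lambda>k. h (lattice_point (b k) + y)) has_sum (\<Sum>k. h (lattice_point (b k) + y))) UNIV"
      by - (rule norm_summable_imp_has_sum[OF _ summable_sums[OF summable_norm_cancel]])
    then have "(\<Sum>\<^sub>\<infinity>k. h (lattice_point (b k) + y)) = (\<Sum>k. h (lattice_point (b k) + y))"
      by (rule infsumI)
    then show "(\<Sum>\<^sub>\<infinity>n. h (lattice_point n + y)) = (\<Sum>k. h (lattice_point (b k) + y))"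
      using infsum_reindex_bij_betw[OF b, of "\<lambda>n. h (lattice_point n + y)"] by simp
  qed
  have int_sum: "integrable torus (\<lambda>y. \<Sum>k. h (lattice_point (b k) + y))"
    by (rule integrable_suminf[OF integral_torus_translate(1)[OF h] AE_sum sum])
  have "(\<integral>y. (\<Sum>\<^sub>\<infinity>n. h (lattice_point n + y)) \<partial>torus) = (\<integral>y. (\<Sum>k. h (lattice_point (b k) + y)) \<partial>torus)"
  proof -
    \<comment> \<open>The unordered sum is known to agree with the series only almost everywhere;
      its measurability is inherited from the series because Lebesgue measure is complete.\<close>
    let ?f = "\<lambda>y. indicator (cbox 0 1) y *\<^sub>R (\<Sum>\<^sub>\<infinity>n. h (lattice_point n + y))"
    let ?g = "\<lambda>y. indicator (cbox 0 1) y *\<^sub>R (\<Sum>k. h (lattice_point (b k) + y))"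
    have "integrable lebesgue ?g"
      using int_sum by (subst (asm) integrable_restrict_space) auto
    then have g: "?g \<in> borel_measurable lebesgue"
      by auto
    have "AE y in lebesgue. y \<in> cbox 0 1 \<longrightarrow>
        (\<Sum>\<^sub>\<infinity>n. h (lattice_point n + y)) = (\<Sum>k. h (lattice_point (b k) + y))"
      using eq by (subst (asm) AE_restrict_space_iff) auto
    then have ae: "AE y in lebesgue. ?g y = ?f y"
      by (rule AE_mp) (intro AE_I2, auto simp: indicator_def)
    then have f: "?f \<in> borel_measurable lebesgue"
      using g by (rule borel_measurable_AE[rotated])
    have "integral\<^sup>L lebesgue ?g = integral\<^sup>L lebesgue ?f"
      by (rule integral_cong_AE[OF g f ae])
    then show ?thesis
      by (simp add: integral_restrict_space)
  qed
  also have "\<dots> = (\<Sum>k. \<integral>y. h (lattice_point (b k) + y) \<partial>torus)"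
    by (rule integral_suminf[OF integral_torus_translate(1)[OF h] AE_sum sum])
  also have "\<dots> = (\<Sum>k. \<integral>x. indicator (unit_cell (b k)) x *\<^sub>R h x \<partial>lebesgue)"
    by (simp add: integral_torus_translate(2)[OF h])
  also have "\<dots> = (\<integral>x. h x \<partial>lebesgue)"
    using lebesgue_integral_countable_add[of "\<lambda>k. unit_cell (b k)" lebesgue h] U disj h UN
    by (simp add: set_lebesgue_integral_def set_integrable_def)
  finally show ?thesis .
qed

section \<open>Sobolev spaces\<close>

definition sobolev_weight :: "int^3 \<Rightarrow> real" where
  "sobolev_weight m = 1 + (norm (2 * pi *\<^sub>R lattice_point m))\<^sup>2"

text \<open>The scalar multiplication binds more tightly than the componentwise multiplication by \<open>2\<close>.\<close>

lemma two_pi_scaleR: "2 * pi *\<^sub>R v = (2 * pi) *\<^sub>R (v :: real^3)"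
  by (simp add: vec_eq_iff)

lemma sobolev_weight_ge_1: "1 \<le> sobolev_weight m"
  by (simp add: sobolev_weight_def)

lemma sobolev_weight_nonneg [simp]: "0 \<le> sobolev_weight m"
  by (simp add: sobolev_weight_def)

lemma in_sobolev_space_2:
  "u \<in> sobolev_space 2 \<longleftrightarrow> (\<lambda>m. (cmod (of_real (sobolev_weight m) * l2_coeff u m))\<^sup>2) summable_on UNIV"
proof -
  have "(1 + (norm (2 * pi *\<^sub>R lattice_point m))\<^sup>2) powr 2 * (cmod (l2_coeff u m))\<^sup>2
      = (cmod (of_real (sobolev_weight m) * l2_coeff u m))\<^sup>2" for m
    using sobolev_weight_ge_1[of m] unfolding sobolev_weight_def[symmetric]
    by (simp add: norm_mult power_mult_distrib)
  then show ?thesis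
    by (simp add: sobolev_space_def)
qed

lemma sobolev_space_1_eq:
  "sobolev_space 1 = {u. (\<lambda>m. sobolev_weight m * (cmod (l2_coeff u m))\<^sup>2) summable_on UNIV}"
  using sobolev_weight_ge_1 by (simp add: sobolev_space_def sobolev_weight_def)

lemma sobolev_norm_1_eq:
  "(sobolev_norm 1 u)\<^sup>2 = (\<Sum>\<^sub>\<infinity>m. sobolev_weight m * (cmod (l2_coeff u m))\<^sup>2)"
proof -
  have "sobolev_norm 1 u = sqrt (\<Sum>\<^sub>\<infinity>m. sobolev_weight m * (cmod (l2_coeff u m))\<^sup>2)"
    by (simp add: sobolev_norm_def sobolev_weight_def add_nonneg_nonneg)
  moreover have "0 \<le> (\<Sum>\<^sub>\<infinity>m. sobolev_weight m * (cmod (l2_coeff u m))\<^sup>2)"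
    by (rule infsum_nonneg) (simp add: sobolev_weight_def)
  ultimately show ?thesis
    by simp
qed

lemma sobolev_space_2_subset_1: "sobolev_space 2 \<subseteq> sobolev_space 1"
proof
  fix u assume u: "u \<in> sobolev_space 2"
  have "(\<lambda>m. sobolev_weight m * (cmod (l2_coeff u m))\<^sup>2) summable_on UNIV"
  proof (rule summable_on_comparison_test)
    show "(\<lambda>m. (cmod (of_real (sobolev_weight m) * l2_coeff u m))\<^sup>2) summable_on UNIV"
      using u by (simp only: in_sobolev_space_2)
    fix m
    have "sobolev_weight m * 1 \<le> sobolev_weight m * sobolev_weight m"
      using sobolev_weight_ge_1[of m] by (intro mult_left_mono) auto
    then show "sobolev_weight m * (cmod (l2_coeff u m))\<^sup>2 \<le> (cmod (of_real (sobolev_weight m) * l2_coeff u m))\<^sup>2"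
      using mult_right_mono[of "sobolev_weight m" "(sobolev_weight m)\<^sup>2" "(cmod (l2_coeff u m))\<^sup>2"]
      by (simp add: norm_mult power_mult_distrib power2_eq_square[of "sobolev_weight m"])
  qed simp_all
  then show "u \<in> sobolev_space 1"
    by (simp add: sobolev_space_1_eq)
qed

lemma X_space_2_subset_1: "X_space 2 \<subseteq> X_space 1"
  using sobolev_space_2_subset_1 by (auto simp: X_space_def)

text \<open>Finite parts of the square of \<open>X_norm 1\<close>. Unlike that norm they are
  continuous on the whole space, and a common bound on them amounts to membership in
  \<open>X_space 1\<close> with the same bound on the norm.\<close>

definition h1_sum :: "(int^3) set \<Rightarrow> xtorus \<Rightarrow> real" where
  "h1_sum F = (\<lambda>(f, g, q, p).
     (\<Sum>m\<in>F. sobolev_weight m * ((cmod (l2_coeff f m))\<^sup>2 + (cmod (l2_coeff g m))\<^sup>2)) + (norm q)\<^sup>2 + (norm p)\<^sup>2)"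

lemma h1_sum_le_X_norm:
  assumes "Y \<in> X_space 1" "finite F"
  shows "h1_sum F Y \<le> (X_norm 1 Y)\<^sup>2"
proof -
  obtain f g q p where Y: "Y = (f, g, q, p)" by (cases Y)
  have fg: "f \<in> sobolev_space 1" "g \<in> sobolev_space 1"
    using assms by (auto simp: X_space_def Y)
  have le: "(\<Sum>m\<in>F. sobolev_weight m * (cmod (l2_coeff u m))\<^sup>2) \<le> (sobolev_norm 1 u)\<^sup>2"
    if "u \<in> sobolev_space 1" for u
    unfolding sobolev_norm_1_eq
    using that assms(2) by (intro finite_sum_le_infsum) (auto simp: sobolev_space_1_eq)
  show ?thesis
    using le[OF fg(1)] le[OF fg(2)] by (simp add: Y h1_sum_def X_norm_def distrib_left sum.distrib)
qed

lemma X_space_1_of_h1_sum: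
  assumes le: "\<And>F. finite F \<Longrightarrow> h1_sum F Y \<le> c"
  shows "Y \<in> X_space 1" "(X_norm 1 Y)\<^sup>2 \<le> c"
proof -
  obtain f g q p where Y: "Y = (f, g, q, p)" by (cases Y)
  let ?h = "\<lambda>u m. sobolev_weight m * (cmod (l2_coeff u m))\<^sup>2"
  have nn: "0 \<le> ?h u m" for u m
    by simp
  have le': "sum (?h f) F + sum (?h g) F \<le> c - (norm q)\<^sup>2 - (norm p)\<^sup>2" if "finite F" for F
    using le[OF that] by (simp add: Y h1_sum_def distrib_left sum.distrib)
  have "sum (?h f) F \<le> c - (norm q)\<^sup>2 - (norm p)\<^sup>2" "sum (?h g) F \<le> c - (norm q)\<^sup>2 - (norm p)\<^sup>2" if "finite F" for F
    using le'[OF that] sum_nonneg[of F "?h f"] sum_nonneg[of F "?h g"] nn by (smt (verit))+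
  then have summ: "?h f summable_on UNIV" "?h g summable_on UNIV"
    by (intro nonneg_bdd_above_summable_on nn bdd_aboveI[where M = "c - (norm q)\<^sup>2 - (norm p)\<^sup>2"]; auto)+
  then show "Y \<in> X_space 1"
    by (auto simp: X_space_def Y sobolev_space_1_eq)
  have "infsum (?h f) UNIV + infsum (?h g) UNIV = (\<Sum>\<^sub>\<infinity>m. ?h f m + ?h g m)"
    by (rule infsum_add[symmetric]) (rule summ)+
  also have "\<dots> \<le> c - (norm q)\<^sup>2 - (norm p)\<^sup>2"
    by (rule infsum_le_finite_sums) (use summ le' in \<open>auto intro: summable_on_add simp: sum.distrib\<close>)
  finally have "(sobolev_norm 1 f)\<^sup>2 + (sobolev_norm 1 g)\<^sup>2 \<le> c - (norm q)\<^sup>2 - (norm p)\<^sup>2"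
    by (simp only: sobolev_norm_1_eq)
  then show "(X_norm 1 Y)\<^sup>2 \<le> c"
    by (simp add: Y X_norm_def)
qed

lemma continuous_on_h1_sum: "continuous_on UNIV (h1_sum F)"
  unfolding h1_sum_def case_prod_unfold
  by (intro continuous_intros)

lemma closure_sobolev_space_2: "closure (sobolev_space 2) = UNIV"
proof (rule UNIV_eq_I[symmetric])
  fix u
  show "u \<in> closure (sobolev_space 2)"
    unfolding closure_approachable
  proof (intro allI impI)
    fix \<epsilon> :: real assume "\<epsilon> > 0"
    then have "\<forall>\<^sub>F F in finite_subsets_at_top UNIV. norm (u - (\<Sum>m\<in>F. l2_coeff u m *\<^sub>C fourier_vec m)) < \<epsilon>"
      using order_tendstoD(2)[OF norm_tail_tendsto_zero[of u]] by blast
    then obtain F where F: "finite F" "norm (u - (\<Sum>m\<in>F. l2_coeff u m *\<^sub>C fourier_vec m)) < \<epsilon>"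
      unfolding eventually_finite_subsets_at_top by blast
    let ?v = "\<Sum>m\<in>F. l2_coeff u m *\<^sub>C fourier_vec m"
    have "(\<lambda>m. (cmod (of_real (sobolev_weight m) * l2_coeff ?v m))\<^sup>2) summable_on UNIV"
      unfolding l2_coeff_sum_fourier_vec[OF F(1)]
      by (rule finite_nonzero_values_imp_summable_on) (rule finite_subset[OF _ F(1)], auto)
    then have "?v \<in> sobolev_space 2"
      by (simp only: in_sobolev_space_2)
    then show "\<exists>v\<in>sobolev_space 2. dist v u < \<epsilon>"
      using F(2) by (metis dist_norm norm_minus_commute)
  qed
qed

lemma closure_X_space_2: "closure (X_space 2) = UNIV"
  by (simp add: X_space_def closure_Times closure_sobolev_space_2)

text \<open>For integers the modulus is at most the square, so a bound on the weight confines
  \<open>m\<close> to a cube.\<close>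

lemma finite_sobolev_weight_le: "finite {m. sobolev_weight m \<le> R}"
proof -
  define k where "k = \<lceil>\<bar>R\<bar>\<rceil>"
  have "\<bar>m $ i\<bar> \<le> k" if "sobolev_weight m \<le> R" for m i
  proof -
    have "\<bar>real_of_int (m $ i)\<bar> \<le> (real_of_int (m $ i))\<^sup>2"
    proof -
      have "\<bar>m $ i\<bar> * 1 \<le> \<bar>m $ i\<bar> * \<bar>m $ i\<bar>"
      proof (cases "m $ i = 0")
        case False
        then show ?thesis
          by (intro mult_left_mono) linarith+
      qed simp
      then show ?thesis
        by (metis abs_mult_self_eq mult.right_neutral of_int_abs of_int_le_iff of_int_mult power2_eq_square)
    qed
    also have "\<dots> \<le> (norm (lattice_point m))\<^sup>2"
      using component_le_norm_cart[of "lattice_point m" i] 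
      by (simp add: lattice_point_def abs_le_square_iff[symmetric])
    also have "\<dots> \<le> (norm (2 * pi *\<^sub>R lattice_point m))\<^sup>2"
    proof (rule power_mono)
      have "1 * norm (lattice_point m) \<le> (2 * pi) * norm (lattice_point m)"
        using pi_ge_two by (intro mult_right_mono) auto
      then show "norm (lattice_point m) \<le> norm (2 * pi *\<^sub>R lattice_point m)"
        unfolding two_pi_scaleR by simp
    qed simp
    also have "\<dots> \<le> \<bar>R\<bar>"
      using that by (simp add: sobolev_weight_def)
    finally show ?thesis
      unfolding k_def by linarith
  qed
  then have "{m. sobolev_weight m \<le> R} \<subseteq> (\<lambda>f. \<chi> i. f i) ` (UNIV \<rightarrow>\<^sub>E {- k..k})"
  proof (intro subsetI)
    fix m assume *: "m \<in> {m. sobolev_weight m \<le> R}" "\<And>m i. sobolev_weight m \<le> R \<Longrightarrow> \<bar>m $ i\<bar> \<le> k"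
    show "m \<in> (\<lambda>f. \<chi> i. f i) ` (UNIV \<rightarrow>\<^sub>E {- k..k})"
      using * by (intro image_eqI[of _ _ "\<lambda>i. m $ i"]) (auto simp: abs_le_iff minus_le_iff)
  qed
  moreover have "finite ((UNIV :: 3 set) \<rightarrow>\<^sub>E {- k..k})"
    by (intro finite_PiE) auto
  ultimately show ?thesis
    using finite_subset by blast
qed

lemma compact_trig_span:
  assumes "finite F"
  shows "compact {\<Sum>m\<in>F. c m *\<^sub>C fourier_vec m | c. \<forall>m. cmod (c m) \<le> r}"
  using assms
proof induction
  case empty
  have "{\<Sum>m\<in>{}. c m *\<^sub>C fourier_vec m | c. \<forall>m. cmod (c m) \<le> r} \<subseteq> {0}"
    by auto
  then show ?case
    using finite_imp_compact finite_subset by blast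
next
  case (insert n F)
  let ?S = "\<lambda>F. {\<Sum>m\<in>F. c m *\<^sub>C fourier_vec m | c. \<forall>m. cmod (c m) \<le> r}"
  have "?S (insert n F) = (\<lambda>(a :: complex, v). a *\<^sub>C fourier_vec n + v) ` (cball 0 r \<times> ?S F)" (is "?l = ?r")
  proof
    show "?l \<subseteq> ?r"
      using insert.hyps by force
    show "?r \<subseteq> ?l"
    proof clarify
      fix a :: complex and c :: "int^3 \<Rightarrow> complex" assume a: "a \<in> cball 0 r" and c: "\<forall>m. cmod (c m) \<le> r"
      have "a *\<^sub>C fourier_vec n + (\<Sum>m\<in>F. c m *\<^sub>C fourier_vec m) = (\<Sum>m\<in>insert n F. (c(n := a)) m *\<^sub>C fourier_vec m)"
        using insert.hyps by (auto intro!: sum.cong)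
      then show "\<exists>c'. a *\<^sub>C fourier_vec n + (\<Sum>m\<in>F. c m *\<^sub>C fourier_vec m) = (\<Sum>m\<in>insert n F. c' m *\<^sub>C fourier_vec m) \<and>
          (\<forall>m. cmod (c' m) \<le> r)"
        using a c by (intro exI[of _ "c(n := a)"]) auto
    qed
  qed
  moreover have "compact ?r"
    unfolding case_prod_unfold
    by (intro compact_continuous_image compact_Times compact_cball insert.IH continuous_intros
        bounded_bilinear.continuous_on[OF bounded_bilinear_scaleC])
  ultimately show ?case
    by simp
qed

text \<open>Rellich's theorem with explicit tails: frequencies of weight above \<open>R\<close>
  carry squared norm at most \<open>\<bar>c\<bar> / R\<close>, and the remaining finite section
  ranges over a compact set. Bounding partial sums instead of the full norm makes closedness
  immediate.\<close>

lemma compact_sobolev_ball: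
  "compact {u. \<forall>F. finite F \<longrightarrow> (\<Sum>m\<in>F. sobolev_weight m * (cmod (l2_coeff u m))\<^sup>2) \<le> c}" (is "compact ?K")
  unfolding compact_eq_totally_bounded
proof
  have "?K = (\<Inter>F\<in>Collect finite. {u. (\<Sum>m\<in>F. sobolev_weight m * (cmod (l2_coeff u m))\<^sup>2) \<le> c})"
    by auto
  also have "closed \<dots>"
    by (intro closed_INT ballI closed_Collect_le continuous_intros)
  finally show "complete ?K"
    by (simp add: complete_eq_closed)
  show "\<forall>\<epsilon>>0. \<exists>k. finite k \<and> ?K \<subseteq> (\<Union>x\<in>k. ball x \<epsilon>)"
  proof (intro allI impI)
    fix \<epsilon> :: real assume "\<epsilon> > 0"
    \<comment> \<open>Chosen so that the tail has norm at most
      \<open>\<epsilon> / 4\<close>.\<close>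
    define R where "R = 1 + 16 * \<bar>c\<bar> / \<epsilon>\<^sup>2"
    define F where "F = {m. sobolev_weight m \<le> R}"
    have R: "R > 0" "\<bar>c\<bar> / R \<le> (\<epsilon> / 4)\<^sup>2"
      using \<open>\<epsilon> > 0\<close> by (auto simp: R_def add_pos_nonneg field_simps power2_eq_square)
    have F: "finite F"
      unfolding F_def by (rule finite_sobolev_weight_le)
    let ?S = "{\<Sum>m\<in>F. a m *\<^sub>C fourier_vec m | a. \<forall>m. cmod (a m) \<le> sqrt \<bar>c\<bar>}"
    have "\<exists>k. finite k \<and> ?S \<subseteq> (\<Union>x\<in>k. ball x (\<epsilon> / 2))"
      using compact_trig_span[OF F, of "sqrt \<bar>c\<bar>"] \<open>\<epsilon> > 0\<close> unfolding compact_eq_totally_bounded by simp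
    then obtain k where k: "finite k" "?S \<subseteq> (\<Union>x\<in>k. ball x (\<epsilon> / 2))"
      by blast
    have "?K \<subseteq> (\<Union>x\<in>k. ball x \<epsilon>)"
    proof
      fix u assume u: "u \<in> ?K"
      let ?v = "\<Sum>m\<in>F. l2_coeff u m *\<^sub>C fourier_vec m"
      have "cmod (l2_coeff u m) \<le> sqrt \<bar>c\<bar>" for m
      proof (rule real_le_rsqrt)
        have "1 * (cmod (l2_coeff u m))\<^sup>2 \<le> sobolev_weight m * (cmod (l2_coeff u m))\<^sup>2"
          by (rule mult_right_mono[OF sobolev_weight_ge_1]) simp
        also have "\<dots> \<le> c"
          using u by (auto dest: spec[of _ "{m}"])
        finally show "(cmod (l2_coeff u m))\<^sup>2 \<le> \<bar>c\<bar>"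
          by simp
      qed
      then have "?v \<in> ?S"
        by blast
      then obtain x where x: "x \<in> k" "dist x ?v < \<epsilon> / 2"
        using k(2) by (auto simp: subset_eq)
      have "(norm (u - ?v))\<^sup>2 \<le> (\<epsilon> / 4)\<^sup>2"
      proof (rule has_sum_le_finite_sums[OF parseval_norm])
        fix G :: "(int^3) set" assume G: "finite G"
        have "(\<Sum>m\<in>G. (cmod (l2_coeff (u - ?v) m))\<^sup>2) \<le> (\<Sum>m\<in>G. (1 / R) * (sobolev_weight m * (cmod (l2_coeff u m))\<^sup>2))"
        proof (rule sum_mono)
          fix m
          show "(cmod (l2_coeff (u - ?v) m))\<^sup>2 \<le> (1 / R) * (sobolev_weight m * (cmod (l2_coeff u m))\<^sup>2)"
          proof (cases "m \<in> F")
            case True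
            then have "l2_coeff (u - ?v) m = 0"
              by (simp add: l2_coeff_diff l2_coeff_sum_fourier_vec[OF F])
            then show ?thesis
              using R(1) sobolev_weight_ge_1[of m] by simp
          next
            case False
            then have "1 \<le> (1 / R) * sobolev_weight m"
              using R(1) by (simp add: F_def field_simps)
            then have "1 * (cmod (l2_coeff u m))\<^sup>2 \<le> ((1 / R) * sobolev_weight m) * (cmod (l2_coeff u m))\<^sup>2"
              by (rule mult_right_mono) simp
            then show ?thesis
              using False by (simp add: l2_coeff_diff l2_coeff_sum_fourier_vec[OF F])
          qed
        qed
        also have "\<dots> = (1 / R) * (\<Sum>m\<in>G. sobolev_weight m * (cmod (l2_coeff u m))\<^sup>2)"
          by (rule sum_distrib_left[symmetric])
        also have "\<dots> \<le> (1 / R) * \<bar>c\<bar>"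
          using u G R(1) by (intro mult_left_mono) (auto intro: order_trans[OF _ abs_ge_self])
        finally show "(\<Sum>m\<in>G. (cmod (l2_coeff (u - ?v) m))\<^sup>2) \<le> (\<epsilon> / 4)\<^sup>2"
          using R(2) by simp
      qed
      then have "norm (u - ?v) \<le> \<epsilon> / 4"
        by (rule power2_le_imp_le) (use \<open>\<epsilon> > 0\<close> in simp)
      then have "dist u ?v < \<epsilon> / 2"
        using \<open>\<epsilon> > 0\<close> by (simp add: dist_norm)
      then have "dist x u < \<epsilon>"
        by (rule dist_triangle_half_l[OF x(2)])
      then show "u \<in> (\<Union>x\<in>k. ball x \<epsilon>)"
        using x(1) by auto
    qed
    then show "\<exists>k. finite k \<and> ?K \<subseteq> (\<Union>x\<in>k. ball x \<epsilon>)"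
      using k(1) by blast
  qed
qed

lemma compact_closure_h1_bounded:
  assumes "\<And>Y F. Y \<in> A \<Longrightarrow> finite F \<Longrightarrow> h1_sum F Y \<le> c"
  shows "compact (closure A)"
proof -
  let ?K = "{u. \<forall>F. finite F \<longrightarrow> (\<Sum>m\<in>F. sobolev_weight m * (cmod (l2_coeff u m))\<^sup>2) \<le> c}"
  let ?C = "?K \<times> ?K \<times> cball (0 :: complex^3) (sqrt c) \<times> cball (0 :: complex^3) (sqrt c)"
  have C: "compact ?C"
    by (intro compact_Times compact_sobolev_ball compact_cball)
  have "A \<subseteq> ?C"
  proof
    fix Y assume Y: "Y \<in> A"
    obtain f g q p where eq: "Y = (f, g, q, p)" by (cases Y)
    have nn: "0 \<le> (\<Sum>m\<in>F. sobolev_weight m * (cmod (l2_coeff u m))\<^sup>2)" for F u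
      by (intro sum_nonneg) simp
    have le: "(\<Sum>m\<in>F. sobolev_weight m * (cmod (l2_coeff f m))\<^sup>2) + (\<Sum>m\<in>F. sobolev_weight m * (cmod (l2_coeff g m))\<^sup>2)
        + (norm q)\<^sup>2 + (norm p)\<^sup>2 \<le> c" if "finite F" for F
      using assms[OF Y that] by (simp add: eq h1_sum_def distrib_left sum.distrib)
    have "f \<in> ?K" "g \<in> ?K"
    proof -
      have "(\<Sum>m\<in>F. sobolev_weight m * (cmod (l2_coeff f m))\<^sup>2) \<le> c"
        "(\<Sum>m\<in>F. sobolev_weight m * (cmod (l2_coeff g m))\<^sup>2) \<le> c" if "finite F" for F
        using le[OF that] nn[where F = F and u = f] nn[where F = F and u = g]
          zero_le_power2[of "norm q"] zero_le_power2[of "norm p"] by linarith+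
      then show "f \<in> ?K" "g \<in> ?K"
        by auto
    qed
    moreover have "(norm q)\<^sup>2 \<le> c" "(norm p)\<^sup>2 \<le> c"
      using le[of "{}"] zero_le_power2[of "norm q"] zero_le_power2[of "norm p"] by (simp_all, linarith+)
    then have "norm q \<le> sqrt c" "norm p \<le> sqrt c"
      by (auto intro: real_le_rsqrt)
    ultimately show "Y \<in> ?C"
      by (simp add: eq)
  qed
  then have "closure A \<subseteq> ?C"
    by (rule closure_minimal) (rule compact_imp_closed[OF C])
  then show ?thesis
    using compact_Int_closed[OF C closed_closure[of A]] by (simp add: inf.absorb2)
qed

section \<open>The Bloch operators\<close>

lemma has_sum_finite_sum:
  fixes f :: "'i \<Rightarrow> 'a \<Rightarrow> 'b::topological_comm_monoid_add"
  assumes "\<And>i. i \<in> I \<Longrightarrow> (f i has_sum s i) A"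
  shows "((\<lambda>x. \<Sum>i\<in>I. f i x) has_sum (\<Sum>i\<in>I. s i)) A"
  using assms by (induction I rule: infinite_finite_induct) (auto intro: has_sum_add has_sum_0)

lemma square_summable_mult:
  fixes c \<phi> :: "'i \<Rightarrow> complex"
  assumes "(\<lambda>m. (cmod (c m))\<^sup>2) summable_on UNIV" "\<And>m. cmod (\<phi> m) \<le> C"
  shows "(\<lambda>m. (cmod (\<phi> m * c m))\<^sup>2) summable_on UNIV"
proof (rule summable_on_comparison_test)
  show "(\<lambda>m. C\<^sup>2 * (cmod (c m))\<^sup>2) summable_on UNIV"
    using assms(1) by (rule summable_on_cmult_right)
  fix m
  have "(cmod (\<phi> m))\<^sup>2 \<le> C\<^sup>2"
    using assms(2) by (rule power_mono) simp
  then show "(cmod (\<phi> m * c m))\<^sup>2 \<le> C\<^sup>2 * (cmod (c m))\<^sup>2"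
    unfolding norm_mult power_mult_distrib by (rule mult_right_mono) simp
qed simp

lemma norm_add_square_le: "(norm (x + y))\<^sup>2 \<le> 2 * (norm x)\<^sup>2 + 2 * (norm (y :: 'a::real_normed_vector))\<^sup>2"
proof -
  have "(norm (x + y))\<^sup>2 \<le> (norm x + norm y)\<^sup>2"
    by (intro power_mono norm_triangle_ineq) simp
  also have "\<dots> \<le> 2 * (norm x)\<^sup>2 + 2 * (norm y)\<^sup>2"
    using sum_squares_bound[of "norm x" "norm y"] by (simp add: power2_sum)
  finally show ?thesis .
qed

lemma cmod_fourier_transform_le: 
  assumes "integrable lebesgue \<sigma>"
  shows "cmod (fourier_transform \<sigma> \<xi>) \<le> (\<integral>x. \<bar>\<sigma> x\<bar> \<partial>lebesgue)"
proof -
  have "cmod (fourier_transform \<sigma> \<xi>) \<le> (\<integral>x. cmod (cis (\<xi> \<bullet> x) * of_real (\<sigma> x)) \<partial>lebesgue)"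
    unfolding fourier_transform_def by (rule integral_norm_bound)
  then show ?thesis
    by (simp add: norm_mult)
qed

text \<open>Poisson summation: a character is 1 on lattice vectors, so it can be moved under the
  lattice sum, where it combines with the phase of \<open>\<theta>\<close> to one exponential on the
  whole space.\<close>

lemma fourier_coeff_sigma_tilde:
  assumes "integrable lebesgue \<sigma>"
  shows "fourier_coeff (sigma_tilde \<sigma> \<theta>) m = fourier_transform \<sigma> (xi \<theta> m)"
proof -
  let ?h = "\<lambda>x. cis (xi \<theta> m \<bullet> x) * complex_of_real (\<sigma> x)"
  have "(\<lambda>x. cis (xi \<theta> m \<bullet> x)) \<in> borel_measurable lebesgue"
    by (intro measurable_completion) (auto intro!: borel_measurable_continuous_onI continuous_intros)
  then have h: "integrable lebesgue ?h"
    using assms by (intro Bochner_Integration.integrable_bound[OF assms]) (auto simp: norm_mult)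
  have "cis (2 * pi * (lattice_point m \<bullet> y)) * sigma_tilde \<sigma> \<theta> y
      = (\<Sum>\<^sub>\<infinity>n. ?h (lattice_point n + y))" for y
  proof -
    have "?h (lattice_point n + y) = cis (2 * pi * (lattice_point m \<bullet> y)) *
        (cis (\<theta> \<bullet> (lattice_point n + y)) * complex_of_real (\<sigma> (lattice_point n + y)))" for n
    proof -
      have "lattice_point m \<bullet> lattice_point n = of_int (\<Sum>i\<in>UNIV. m $ i * n $ i)"
        by (simp add: inner_vec_def lattice_point_def)
      then have "cis (2 * pi * (lattice_point m \<bullet> lattice_point n)) = 1"
        by (simp only: cis_multiple_2pi Ints_of_int)
      moreover have "xi \<theta> m \<bullet> (lattice_point n + y) = 2 * pi * (lattice_point m \<bullet> lattice_point n)
          + (2 * pi * (lattice_point m \<bullet> y) + \<theta> \<bullet> (lattice_point n + y))"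
        unfolding xi_def two_pi_scaleR by (simp add: inner_add_left inner_add_right algebra_simps)
      ultimately show ?thesis
        by (simp flip: cis_mult)
    qed
    then show ?thesis
      unfolding sigma_tilde_def by (simp only: infsum_cmult_right')
  qed
  then show ?thesis
    unfolding fourier_coeff_def fourier_transform_def
    using integral_periodisation[OF h] by simp
qed

section \<open>Fourier symbols and the energy form\<close>

locale bloch =
  fixes e M Z :: real and \<sigma> :: "real^3 \<Rightarrow> real" and \<theta> :: "real^3"
  assumes pos: "e > 0" "M > 0" "Z > 0" and \<sigma>: "integrable lebesgue \<sigma>"
    and \<theta>: "\<theta> \<in> Pi_star_plus \<sigma>"
begin

definition \<omega> :: "int^3 \<Rightarrow> real" where "\<omega> m = norm (xi \<theta> m)"

definition \<beta> :: "int^3 \<Rightarrow> real" where "\<beta> m = 2 * e * sqrt Z / \<omega> m"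

text \<open>Scaled so that the rank one matrices of these vectors sum to \<open>Sigma_mat\<close>
  and \<open>cinner (a_vec m) q\<close> is the symbol of \<open>S_op\<close> up to
  \<open>\<beta> m / 2\<close>. The conjugate compensates the antilinear first slot, which also
  turns \<i> into the factor -\<i> of \<open>S_op\<close>.\<close>

definition a_vec :: "int^3 \<Rightarrow> complex^3" where
  "a_vec m = (\<chi> j. of_real (xi \<theta> m $ j / \<omega> m) * (\<i> * cnj (fourier_transform \<sigma> (xi \<theta> m))))"

lemma \<omega>_pos: "\<omega> m > 0"
proof -
  have "xi \<theta> m \<noteq> 0"
  proof
    assume "xi \<theta> m = 0"
    then have "\<theta> = 2 * pi *\<^sub>R lattice_point (- m)"
      by (simp add: xi_def lattice_point_def vec_eq_iff) (metis add.commute minus_add_cancel add.right_neutral)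
    then have "\<theta> \<in> Gamma_star"
      unfolding Gamma_star_def by blast
    then show False
      using \<theta> by (simp add: Pi_star_plus_def)
  qed
  then show ?thesis
    by (simp add: \<omega>_def)
qed

text \<open>Three coordinates in \<open>[0, 2 \<pi>]\<close>; this is the source of the numbers
  \<open>24 \<pi>^2\<close> below.\<close>

lemma \<theta>_norm: "(norm \<theta>)\<^sup>2 \<le> 12 * pi\<^sup>2"
proof -
  have "(\<theta> $ i)\<^sup>2 \<le> (2 * pi)\<^sup>2" for i
    using \<theta> by (intro power_mono) (auto simp: Pi_star_plus_def Pi_star_def mem_box_cart)
  then have "(\<Sum>i\<in>UNIV. (\<theta> $ i)\<^sup>2) \<le> (\<Sum>i\<in>(UNIV::3 set). (2 * pi)\<^sup>2)"
    by (intro sum_mono)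
  then show ?thesis
    unfolding power2_norm_eq_inner inner_vec_def by (simp add: power2_eq_square)
qed

lemma \<omega>_le_weight: "(\<omega> m)\<^sup>2 \<le> (2 + 24 * pi\<^sup>2) * sobolev_weight m"
proof -
  have "(\<omega> m)\<^sup>2 \<le> 2 * (norm (2 * pi *\<^sub>R lattice_point m))\<^sup>2 + 2 * (norm \<theta>)\<^sup>2"
    unfolding \<omega>_def xi_def by (rule norm_add_square_le)
  also have "\<dots> \<le> 2 * sobolev_weight m + 24 * pi\<^sup>2 * 1"
    using \<theta>_norm by (simp add: sobolev_weight_def)
  also have "\<dots> \<le> 2 * sobolev_weight m + 24 * pi\<^sup>2 * sobolev_weight m"
    by (intro add_left_mono mult_left_mono sobolev_weight_ge_1) simp
  finally show ?thesis
    by (simp add: distrib_right)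
qed

text \<open>Uniform in \<open>\<theta>\<close>. An additive constant has to appear because
  \<open>\<omega> m\<close> may be arbitrarily small while the weight is at least 1.\<close>

lemma weight_le_\<omega>: "sobolev_weight m \<le> (1 + 24 * pi\<^sup>2) + 2 * (\<omega> m)\<^sup>2"
proof -
  have "(norm (2 * pi *\<^sub>R lattice_point m))\<^sup>2 = (norm (xi \<theta> m + - \<theta>))\<^sup>2"
    by (simp add: xi_def)
  also have "\<dots> \<le> 2 * (\<omega> m)\<^sup>2 + 2 * (norm \<theta>)\<^sup>2"
    using norm_add_square_le[of "xi \<theta> m" "- \<theta>"] by (simp add: \<omega>_def)
  finally show ?thesis
    using \<theta>_norm by (simp add: sobolev_weight_def)
qed

text \<open>Distinct frequencies are at least \<open>2 \<pi>\<close> apart, hence more than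
  \<open>1 + 1\<close>.\<close>

lemma \<omega>_less_1_unique:
  assumes "\<omega> m < 1" "\<omega> n < 1"
  shows "m = n"
proof (rule ccontr)
  assume "m \<noteq> n"
  then obtain i where i: "m $ i \<noteq> n $ i"
    by (auto simp: vec_eq_iff)
  have "xi \<theta> m - xi \<theta> n = (2 * pi) *\<^sub>R lattice_point (m - n)"
    unfolding xi_def two_pi_scaleR lattice_point_diff by (simp add: algebra_simps)
  then have "\<bar>(2 * pi) * real_of_int (m $ i - n $ i)\<bar> \<le> norm (xi \<theta> m - xi \<theta> n)"
    using component_le_norm_cart[of "(2 * pi) *\<^sub>R lattice_point (m - n)" i] by (simp add: lattice_point_def)
  also have "\<dots> \<le> \<omega> m + \<omega> n"
    unfolding \<omega>_def by (rule norm_triangle_ineq4)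
  finally have "(2 * pi) * \<bar>real_of_int (m $ i - n $ i)\<bar> < 2"
    using assms by (simp add: abs_mult)
  moreover have "(2 * pi) * 1 \<le> (2 * pi) * \<bar>real_of_int (m $ i - n $ i)\<bar>"
    using i by (intro mult_left_mono) (linarith, simp)
  ultimately show False
    using pi_ge_two by linarith
qed

text \<open>If some frequency is shorter than 1 it is the only one, and its length serves. The bound
  depends on \<open>\<theta>\<close>, so it is used for summability and mapping properties but never
  in the final constant.\<close>

lemma \<omega>_lower_bound: obtains \<delta> where "\<delta> > 0" "\<And>m. \<delta> \<le> \<omega> m"
proof (cases "\<exists>n. \<omega> n < 1")
  case True
  then obtain n where "\<omega> n < 1" ..
  then have "\<omega> n \<le> \<omega> m" for m
    using \<omega>_less_1_unique[of m n] by force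
  then show ?thesis
    using that \<omega>_pos by blast
next
  case False
  then show ?thesis
    using that[of 1] by (simp add: not_less)
qed

lemma norm_a_vec: "norm (a_vec m) = cmod (fourier_transform \<sigma> (xi \<theta> m))"
proof -
  let ?s = "fourier_transform \<sigma> (xi \<theta> m)"
  have "(norm (a_vec m))\<^sup>2 = (\<Sum>j\<in>UNIV. (cmod (a_vec m $ j))\<^sup>2)"
    by (simp add: power2_norm_eq_inner inner_vec_def)
  also have "\<dots> = (\<Sum>j\<in>UNIV. (xi \<theta> m $ j)\<^sup>2 * ((cmod ?s)\<^sup>2 / (\<omega> m)\<^sup>2))"
    by (intro sum.cong refl) (simp add: a_vec_def norm_mult norm_divide power_mult_distrib power_divide)
  also have "\<dots> = (\<omega> m)\<^sup>2 * ((cmod ?s)\<^sup>2 / (\<omega> m)\<^sup>2)"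
    unfolding sum_distrib_right[symmetric] \<omega>_def power2_norm_eq_inner[of "xi \<theta> m"] inner_vec_def
    by (simp add: power2_eq_square)
  finally show ?thesis
    using \<omega>_pos[of m] by (simp add: power2_eq_iff_nonneg)
qed

lemma Sigma_mat_entry:
  "Sigma_mat \<sigma> \<theta> $ i $ j = (\<Sum>\<^sub>\<infinity>m. a_vec m $ i * cnj (a_vec m $ j))"
proof -
  have "complex_of_real (xi \<theta> m $ i * xi \<theta> m $ j / (norm (xi \<theta> m))\<^sup>2 * (cmod (fourier_transform \<sigma> (xi \<theta> m)))\<^sup>2)
      = a_vec m $ i * cnj (a_vec m $ j)" for m
    unfolding of_real_mult[of _ "(cmod _)\<^sup>2"] cnj_mult_self[symmetric]
    by (simp add: a_vec_def \<omega>_def power2_eq_square mult_ac)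
  then show ?thesis
    by (simp add: Sigma_mat_def)
qed

text \<open>The sum defining a diagonal entry of the matrix converges, since its value would be \<open>0\<close>
  otherwise, contrary to positive definiteness.\<close>

lemma summable_norm_a_vec: "(\<lambda>m. (norm (a_vec m))\<^sup>2) summable_on UNIV"
proof -
  have diag: "(\<lambda>m. (cmod (a_vec m $ i))\<^sup>2) summable_on UNIV" for i
  proof (rule ccontr)
    assume *: "\<not> (\<lambda>m. (cmod (a_vec m $ i))\<^sup>2) summable_on UNIV"
    have eq: "a_vec m $ i * cnj (a_vec m $ i) = of_real ((cmod (a_vec m $ i))\<^sup>2)" for m
      using cnj_mult_self[of "a_vec m $ i"] by (simp only: mult.commute)
    have "\<not> (\<lambda>m. a_vec m $ i * cnj (a_vec m $ i)) summable_on UNIV"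
    proof
      assume "(\<lambda>m. a_vec m $ i * cnj (a_vec m $ i)) summable_on UNIV"
      from summable_on_Re[OF this] show False
        using * unfolding eq by simp
    qed
    then have "Sigma_mat \<sigma> \<theta> $ i $ i = 0"
      unfolding Sigma_mat_entry by (rule infsum_not_exists)
    then have "cinner (axis i 1) (Sigma_mat \<sigma> \<theta> *v axis i 1) = 0"
      by (simp add: cinner_vec_def cinner_complex_def matrix_vector_mult_def axis_def if_distrib
          if_distribR cong: if_cong)
    moreover have "axis i (1::complex) \<noteq> 0"
      by (simp add: axis_eq_0_iff)
    moreover have "positive_definite (Sigma_mat \<sigma> \<theta>)"
      using \<theta> by (simp add: Pi_star_plus_def)
    ultimately show False
      unfolding positive_definite_def by (metis less_irrefl of_real_eq_0_iff)
  qed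
  have "((\<lambda>m. \<Sum>i\<in>UNIV. (cmod (a_vec m $ i))\<^sup>2) has_sum (\<Sum>i\<in>UNIV. \<Sum>\<^sub>\<infinity>m. (cmod (a_vec m $ i))\<^sup>2)) UNIV"
    by (rule has_sum_finite_sum) (rule has_sum_infsum[OF diag])
  moreover have "(\<Sum>i\<in>UNIV. (cmod (a_vec m $ i))\<^sup>2) = (norm (a_vec m))\<^sup>2" for m
    by (simp add: power2_norm_eq_inner inner_vec_def)
  ultimately show ?thesis
    by (auto simp: summable_on_def)
qed

text \<open>The summable squared norms of \<open>a_vec\<close> dominate every entry, so the matrix
  is an absolutely convergent sum of rank one matrices.\<close>

lemma Sigma_mat_has_sum:
  "((\<lambda>m. cnj (cinner (a_vec m) q') * cinner (a_vec m) q) has_sum cinner q' (Sigma_mat \<sigma> \<theta> *v q)) UNIV"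
proof -
  have entry: "((\<lambda>m. a_vec m $ i * cnj (a_vec m $ j)) has_sum Sigma_mat \<sigma> \<theta> $ i $ j) UNIV" for i j
    unfolding Sigma_mat_entry
  proof (rule has_sum_infsum, rule abs_summable_summable, rule summable_on_comparison_test[OF summable_norm_a_vec])
    fix m
    have "norm (a_vec m $ i) * norm (a_vec m $ j) \<le> norm (a_vec m) * norm (a_vec m)"
      by (intro mult_mono Finite_Cartesian_Product.norm_nth_le) auto
    then show "norm (a_vec m $ i * cnj (a_vec m $ j)) \<le> (norm (a_vec m))\<^sup>2"
      by (simp add: norm_mult power2_eq_square)
  qed simp
  have "((\<lambda>m. \<Sum>i\<in>UNIV. \<Sum>j\<in>UNIV. cnj (q' $ i) * (a_vec m $ i * cnj (a_vec m $ j)) * q $ j) has_sum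
      (\<Sum>i\<in>UNIV. \<Sum>j\<in>UNIV. cnj (q' $ i) * Sigma_mat \<sigma> \<theta> $ i $ j * q $ j)) UNIV"
    by (intro has_sum_finite_sum has_sum_cmult_left has_sum_cmult_right entry)
  moreover have "(\<Sum>i\<in>UNIV. \<Sum>j\<in>UNIV. cnj (q' $ i) * (a_vec m $ i * cnj (a_vec m $ j)) * q $ j)
      = cnj (cinner (a_vec m) q') * cinner (a_vec m) q" for m
    unfolding cinner_vec_def cinner_complex_def cnj_sum sum_product by (simp add: mult_ac)
  moreover have "(\<Sum>i\<in>UNIV. \<Sum>j\<in>UNIV. cnj (q' $ i) * Sigma_mat \<sigma> \<theta> $ i $ j * q $ j)
      = cinner q' (Sigma_mat \<sigma> \<theta> *v q)"
    by (simp add: cinner_vec_def cinner_complex_def matrix_vector_mult_def sum_distrib_left mult_ac)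
  ultimately show ?thesis
    by simp
qed

lemma summable_cinner_a_vec: "(\<lambda>m. (cmod (cinner (a_vec m) q))\<^sup>2) summable_on UNIV"
proof (rule summable_on_comparison_test)
  show "(\<lambda>m. (norm q)\<^sup>2 * (norm (a_vec m))\<^sup>2) summable_on UNIV"
    by (intro summable_on_cmult_right summable_norm_a_vec)
  fix m
  have "(cmod (cinner (a_vec m) q))\<^sup>2 \<le> (norm (a_vec m) * norm q)\<^sup>2"
    by (intro power_mono cmod_cinner_le) simp
  then show "(cmod (cinner (a_vec m) q))\<^sup>2 \<le> (norm q)\<^sup>2 * (norm (a_vec m))\<^sup>2"
    by (simp add: power_mult_distrib mult.commute)
qed simp

lemma l2_coeff_S_op:
  "l2_coeff (S_op e Z \<sigma> \<theta> q) m = of_real (\<beta> m / 2) * cinner (a_vec m) q"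
proof -
  obtain \<delta> where \<delta>: "\<delta> > 0" "\<And>m. \<delta> \<le> \<omega> m"
    using \<omega>_lower_bound by blast
  define c where "c m = of_real (1 / \<omega> m) * cinner (a_vec m) q" for m
  have "complex_of_real (1 / (norm (xi \<theta> m))\<^sup>2) *
     (\<Sum>j\<in>UNIV. (- \<i> * complex_of_real (xi \<theta> m $ j) * fourier_coeff (sigma_tilde \<sigma> \<theta>) m) * q $ j) = c m" for m
    unfolding c_def fourier_coeff_sigma_tilde[OF \<sigma>]
    by (simp add: cinner_vec_def cinner_complex_def a_vec_def sum_distrib_left \<omega>_def power2_eq_square mult_ac)
  moreover have "(\<lambda>m. (cmod (c m))\<^sup>2) summable_on UNIV"
    unfolding c_def
  proof (rule square_summable_mult[where C = "1 / \<delta>", OF summable_cinner_a_vec])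
    fix m
    show "cmod (of_real (1 / \<omega> m)) \<le> 1 / \<delta>"
      unfolding norm_of_real using \<delta> \<omega>_pos[of m] by (simp add: frac_le)
  qed
  ultimately have "l2_coeff (S_op e Z \<sigma> \<theta> q) m = (e * sqrt Z) *\<^sub>R c m"
    unfolding S_op_def by (simp add: l2_coeff_scaleR l2_coeff_of_coeffs)
  then show ?thesis
    by (simp add: c_def \<beta>_def scaleR_conv_of_real)
qed

lemma S_op_expand: "S_op e Z \<sigma> \<theta> q = (\<Sum>j\<in>UNIV. q $ j *\<^sub>C S_op e Z \<sigma> \<theta> (axis j 1))"
proof (rule l2torus_eqI)
  fix m
  have "cinner (a_vec m) q = (\<Sum>j\<in>UNIV. q $ j * cinner (a_vec m) (axis j 1))"
    by (simp add: cinner_vec_def cinner_complex_def axis_def if_distrib mult.commute cong: if_cong)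
  then show "l2_coeff (S_op e Z \<sigma> \<theta> q) m = l2_coeff (\<Sum>j\<in>UNIV. q $ j *\<^sub>C S_op e Z \<sigma> \<theta> (axis j 1)) m"
    by (simp add: linear_sum[OF bounded_linear.linear[OF bounded_linear_l2_coeff]] l2_coeff_scaleC
        l2_coeff_S_op sum_distrib_left mult_ac)
qed

text \<open>\<open>cadjoint\<close> is a choice. A witness exists because the domain is finite
  dimensional: its components are the scalar products with the images of the unit vectors.\<close>

lemma cadjoint_S_op: "cinner (S_op e Z \<sigma> \<theta> q) u = cinner q (cadjoint (S_op e Z \<sigma> \<theta>) u)"
proof -
  let ?g = "\<lambda>u. \<chi> j. cinner (S_op e Z \<sigma> \<theta> (axis j 1)) u"
  have "cinner (S_op e Z \<sigma> \<theta> q) u = cinner q (?g u)" for q u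
    by (subst S_op_expand) (simp add: cinner_sum_left cinner_scaleC_left cinner_vec_def cinner_complex_def)
  then have "\<forall>q u. cinner (S_op e Z \<sigma> \<theta> q) u = cinner q (?g u)"
    by (intro allI)
  from someI[of "\<lambda>g. \<forall>q u. cinner (S_op e Z \<sigma> \<theta> q) u = cinner q (g u)", OF this]
  show ?thesis
    unfolding cadjoint_def by (elim allE)
qed

definition B_fun :: "xtorus \<Rightarrow> xtorus" where
  "B_fun = (\<lambda>(f, g, q, p).
     (2 *\<^sub>R H0_op \<theta> f + (4 * e\<^sup>2) *\<^sub>R sqrt Z *\<^sub>R G_op \<theta> (sqrt Z *\<^sub>R f) + 2 *\<^sub>R S_op e Z \<sigma> \<theta> q,
      2 *\<^sub>R H0_op \<theta> g,
      2 *\<^sub>R cadjoint (S_op e Z \<sigma> \<theta>) f + Sigma_mat \<sigma> \<theta> *v q,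
      (1 / M) *\<^sub>R p))"

lemma B_op_eq: "B_op e M Z \<sigma> \<theta> = operator_on (X_space 2) B_fun"
  by (simp add: B_op_def B_fun_def)

text \<open>The symbol is unbounded, but its quotient by the Sobolev weight is a bounded multiplier,
  applied to the square summable weighted coefficients.\<close>

lemma l2_coeff_H0_op:
  assumes "f \<in> sobolev_space 2"
  shows "l2_coeff (H0_op \<theta> f) m = of_real ((\<omega> m)\<^sup>2 / 2) * l2_coeff f m"
proof -
  have "(\<lambda>m. (cmod (of_real ((\<omega> m)\<^sup>2 / 2 / sobolev_weight m) * (of_real (sobolev_weight m) * l2_coeff f m)))\<^sup>2) summable_on UNIV"
  proof (rule square_summable_mult[where C = "1 + 12 * pi\<^sup>2"])
    show "(\<lambda>m. (cmod (of_real (sobolev_weight m) * l2_coeff f m))\<^sup>2) summable_on UNIV"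
      using assms by (simp only: in_sobolev_space_2)
    fix m
    have w: "sobolev_weight m > 0"
      using sobolev_weight_ge_1[of m] by linarith
    have "(\<omega> m)\<^sup>2 / 2 / sobolev_weight m \<le> 1 + 12 * pi\<^sup>2"
      using \<omega>_le_weight[of m] w by (simp add: divide_le_eq distrib_right)
    moreover have "0 \<le> (\<omega> m)\<^sup>2 / 2 / sobolev_weight m"
      using w by simp
    ultimately show "cmod (of_real ((\<omega> m)\<^sup>2 / 2 / sobolev_weight m)) \<le> 1 + 12 * pi\<^sup>2"
      unfolding norm_of_real by (simp only: abs_of_nonneg)
  qed
  moreover have "of_real ((\<omega> m)\<^sup>2 / 2 / sobolev_weight m) * (of_real (sobolev_weight m) * l2_coeff f m)
      = of_real ((\<omega> m)\<^sup>2 / 2) * l2_coeff f m" for m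
    using sobolev_weight_ge_1[of m] by (auto simp: field_simps)
  ultimately have "(\<lambda>m. (cmod (of_real ((\<omega> m)\<^sup>2 / 2) * l2_coeff f m))\<^sup>2) summable_on UNIV"
    by (simp only:)
  from l2_coeff_of_coeffs[OF this] show ?thesis
    by (simp add: H0_op_def fourier_multiplier_def \<omega>_def)
qed

lemma l2_coeff_G_op: "l2_coeff (G_op \<theta> f) m = of_real (1 / (\<omega> m)\<^sup>2) * l2_coeff f m"
proof -
  obtain \<delta> where \<delta>: "\<delta> > 0" "\<And>m. \<delta> \<le> \<omega> m"
    using \<omega>_lower_bound by blast
  have "(\<lambda>m. (cmod (of_real (1 / (\<omega> m)\<^sup>2) * l2_coeff f m))\<^sup>2) summable_on UNIV"
  proof (rule square_summable_mult[where C = "1 / \<delta>\<^sup>2"])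
    fix m
    have "\<delta>\<^sup>2 \<le> (\<omega> m)\<^sup>2"
      using \<delta> by (intro power_mono) auto
    then show "cmod (of_real (1 / (\<omega> m)\<^sup>2)) \<le> 1 / \<delta>\<^sup>2"
      unfolding norm_of_real using \<delta>(1) by (simp add: frac_le)
  qed (rule summable_l2_coeff)
  from l2_coeff_of_coeffs[OF this] show ?thesis
    by (simp add: G_op_def fourier_multiplier_def \<omega>_def)
qed

text \<open>The linear form that completes the square: its squared modulus unites the
  \<open>G_op\<close> term, the two cross terms with \<open>S_op\<close> and the matrix
  \<open>Sigma_mat\<close>.\<close>

definition r_coeff :: "l2torus \<Rightarrow> complex^3 \<Rightarrow> int^3 \<Rightarrow> complex" where
  "r_coeff f q m = of_real (\<beta> m) * l2_coeff f m + cinner (a_vec m) q"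

lemma l2_coeff_B_fun_1:
  assumes "f \<in> sobolev_space 2"
  shows "l2_coeff (fst (B_fun (f, g, q, p))) m
      = of_real ((\<omega> m)\<^sup>2) * l2_coeff f m + of_real (\<beta> m) * r_coeff f q m"
proof -
  have "(4 * e\<^sup>2) * (sqrt Z * (1 / (\<omega> m)\<^sup>2 * sqrt Z)) = (\<beta> m)\<^sup>2"
    using pos by (simp add: \<beta>_def power_divide power_mult_distrib)
  then have *: "of_real (4 * e\<^sup>2) * (of_real (sqrt Z) * (of_real (1 / (\<omega> m)\<^sup>2) * (of_real (sqrt Z) * z)))
      = of_real ((\<beta> m)\<^sup>2) * z" for z :: complex
    by (metis mult.assoc of_real_mult)
  show ?thesis
    unfolding B_fun_def prod.case fst_conv l2_coeff_add l2_coeff_scaleR l2_coeff_H0_op[OF assms]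
      l2_coeff_G_op l2_coeff_S_op scaleR_conv_of_real *
    by (simp add: r_coeff_def algebra_simps power2_eq_square)
qed

text \<open>In Fourier coefficients the form becomes one lattice sum with visibly Hermitian
  summands. Symmetry follows by swapping the arguments, the energy by equating them; the
  \<open>p\<close> part carries no lattice index and is split off.\<close>

lemma form_has_sum:
  assumes "(f, g, q, p) \<in> X_space 2"
  shows "((\<lambda>m. of_real ((\<omega> m)\<^sup>2) * (cnj (l2_coeff f' m) * l2_coeff f m + cnj (l2_coeff g' m) * l2_coeff g m)
            + cnj (r_coeff f' q' m) * r_coeff f q m)
          has_sum (cinner (f', g', q', p') (B_fun (f, g, q, p)) - (1 / M) *\<^sub>R cinner p' p)) UNIV"
proof -
  have fg: "f \<in> sobolev_space 2" "g \<in> sobolev_space 2"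
    using assms by (auto simp: X_space_def)
  have 1: "((\<lambda>m. cnj (l2_coeff f' m) * (of_real ((\<omega> m)\<^sup>2) * l2_coeff f m + of_real (\<beta> m) * r_coeff f q m))
      has_sum cinner f' (fst (B_fun (f, g, q, p)))) UNIV"
    using parseval[of f' "fst (B_fun (f, g, q, p))"] by (simp only: l2_coeff_B_fun_1[OF fg(1)])
  have 2: "((\<lambda>m. cnj (l2_coeff g' m) * (of_real ((\<omega> m)\<^sup>2) * l2_coeff g m)) has_sum cinner g' (2 *\<^sub>R H0_op \<theta> g)) UNIV"
    using parseval[of g' "2 *\<^sub>R H0_op \<theta> g"]
    by (simp add: l2_coeff_scaleR l2_coeff_H0_op[OF fg(2)] scaleR_conv_of_real)
  have 3: "((\<lambda>m. 2 * (cnj (of_real (\<beta> m / 2) * cinner (a_vec m) q') * l2_coeff f m))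
      has_sum 2 * cinner q' (cadjoint (S_op e Z \<sigma> \<theta>) f)) UNIV"
    using has_sum_cmult_right[OF parseval[of "S_op e Z \<sigma> \<theta> q'" f], of 2]
    by (simp only: l2_coeff_S_op cadjoint_S_op)
  note 4 = Sigma_mat_has_sum[of q' q]
  have "((\<lambda>m. cnj (l2_coeff f' m) * (of_real ((\<omega> m)\<^sup>2) * l2_coeff f m + of_real (\<beta> m) * r_coeff f q m)
          + cnj (l2_coeff g' m) * (of_real ((\<omega> m)\<^sup>2) * l2_coeff g m)
          + (2 * (cnj (of_real (\<beta> m / 2) * cinner (a_vec m) q') * l2_coeff f m)
             + cnj (cinner (a_vec m) q') * cinner (a_vec m) q))
      has_sum (cinner f' (fst (B_fun (f, g, q, p))) + cinner g' (2 *\<^sub>R H0_op \<theta> g)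
          + (2 * cinner q' (cadjoint (S_op e Z \<sigma> \<theta>) f) + cinner q' (Sigma_mat \<sigma> \<theta> *v q)))) UNIV"
    by (intro has_sum_add 1 2 3 4)
  moreover have "cinner f' (fst (B_fun (f, g, q, p))) + cinner g' (2 *\<^sub>R H0_op \<theta> g)
          + (2 * cinner q' (cadjoint (S_op e Z \<sigma> \<theta>) f) + cinner q' (Sigma_mat \<sigma> \<theta> *v q))
      = cinner (f', g', q', p') (B_fun (f, g, q, p)) - (1 / M) *\<^sub>R cinner p' p"
    by (simp add: cinner_prod_def B_fun_def cinner_add_right cinner_scaleR_right scaleR_conv_of_real[where 'a = complex])
  moreover have "cnj (l2_coeff f' m) * (of_real ((\<omega> m)\<^sup>2) * l2_coeff f m + of_real (\<beta> m) * r_coeff f q m)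
          + cnj (l2_coeff g' m) * (of_real ((\<omega> m)\<^sup>2) * l2_coeff g m)
          + (2 * (cnj (of_real (\<beta> m / 2) * cinner (a_vec m) q') * l2_coeff f m)
             + cnj (cinner (a_vec m) q') * cinner (a_vec m) q)
      = of_real ((\<omega> m)\<^sup>2) * (cnj (l2_coeff f' m) * l2_coeff f m + cnj (l2_coeff g' m) * l2_coeff g m)
            + cnj (r_coeff f' q' m) * r_coeff f q m" for m
    by (simp add: r_coeff_def algebra_simps)
  ultimately show ?thesis
    by simp
qed

lemma B_fun_symmetric:
  assumes "Y \<in> X_space 2" "Y' \<in> X_space 2"
  shows "cinner (B_fun Y') Y = cinner Y' (B_fun Y)"
proof -
  obtain f g q p where Y: "Y = (f, g, q, p)" by (cases Y)
  obtain f' g' q' p' where Y': "Y' = (f', g', q', p')" by (cases Y')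
  have flip: "cnj (of_real x * (cnj a * b + cnj c * d) + cnj r * s) = of_real x * (cnj b * a + cnj d * c) + cnj s * r"
    for x a b c d r s
    by (simp add: mult.commute)
  note 1 = form_has_sum[OF assms(1)[unfolded Y], of f' g' q' p']
  note 2 = has_sum_cnj_iff[THEN iffD2, OF form_has_sum[OF assms(2)[unfolded Y'], of f g q p], unfolded flip]
  have "cinner Y' (B_fun Y) - (1 / M) *\<^sub>R cinner p' p = cnj (cinner Y (B_fun Y') - (1 / M) *\<^sub>R cinner p p')"
    unfolding Y Y' by (rule has_sum_unique[OF 1 2])
  then show ?thesis
    by (simp add: cinner_commute[of p' p] cinner_commute[of "B_fun Y'" Y])
qed

definition energy_sum :: "(int^3) set \<Rightarrow> xtorus \<Rightarrow> real" where
  "energy_sum F = (\<lambda>(f, g, q, p).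
     (\<Sum>m\<in>F. (\<omega> m)\<^sup>2 * ((cmod (l2_coeff f m))\<^sup>2 + (cmod (l2_coeff g m))\<^sup>2) + (cmod (r_coeff f q m))\<^sup>2)
       + (norm p)\<^sup>2 / M)"

lemma energy_sum_le:
  assumes "Y \<in> X_space 2" "finite F"
  shows "energy_sum F Y \<le> Re (cinner Y (B_fun Y))"
proof -
  obtain f g q p where Y: "Y = (f, g, q, p)" by (cases Y)
  have eq: "of_real ((\<omega> m)\<^sup>2) * (cnj (l2_coeff f m) * l2_coeff f m + cnj (l2_coeff g m) * l2_coeff g m)
            + cnj (r_coeff f q m) * r_coeff f q m
      = complex_of_real ((\<omega> m)\<^sup>2 * ((cmod (l2_coeff f m))\<^sup>2 + (cmod (l2_coeff g m))\<^sup>2) + (cmod (r_coeff f q m))\<^sup>2)" for m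
    by (simp only: cnj_mult_self of_real_add of_real_mult)
  have "((\<lambda>m. (\<omega> m)\<^sup>2 * ((cmod (l2_coeff f m))\<^sup>2 + (cmod (l2_coeff g m))\<^sup>2) + (cmod (r_coeff f q m))\<^sup>2)
      has_sum Re (cinner Y (B_fun Y) - (1 / M) *\<^sub>R cinner p p)) UNIV"
    using has_sum_Re[OF form_has_sum[OF assms(1)[unfolded Y], of f g q p], unfolded eq] by (simp add: Y)
  then have "(\<Sum>m\<in>F. (\<omega> m)\<^sup>2 * ((cmod (l2_coeff f m))\<^sup>2 + (cmod (l2_coeff g m))\<^sup>2) + (cmod (r_coeff f q m))\<^sup>2)
      \<le> Re (cinner Y (B_fun Y) - (1 / M) *\<^sub>R cinner p p)"
    by (rule finite_sum_le_has_sum) (use assms(2) in auto)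
  then show ?thesis
    by (simp add: Y energy_sum_def cinner_same)
qed

end

lemma in_operator_on: "P \<in> operator_on D f \<longleftrightarrow> fst P \<in> D \<and> snd P = f (fst P)"
  by (cases P) (auto simp: operator_on_def)

lemma zero_in_sobolev_space_2: "0 \<in> sobolev_space 2"
  by (simp add: in_sobolev_space_2 l2_coeff_zero)

section \<open>Coercivity and the bounded inverse\<close>

locale bloch_coercive = bloch +
  fixes \<kappa> :: real
  assumes \<kappa>_pos: "\<kappa> > 0"
    and \<kappa>_bound: "\<And>Y b. Y \<in> X_space 1 \<Longrightarrow> form_value (B_op e M Z \<sigma> \<theta>) Y b \<Longrightarrow> b \<ge> \<kappa> * (X_norm 1 Y)\<^sup>2"
begin

lemma cinner_B_fun_real:
  assumes "Y \<in> X_space 2"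
  shows "cinner Y (B_fun Y) = of_real (Re (cinner Y (B_fun Y)))"
  using B_fun_symmetric[OF assms assms] arg_cong[OF cinner_commute[of Y "B_fun Y"], of Im]
  by (simp add: complex_eq_iff)

text \<open>On the domain the extended form is reached by a constant sequence. That the diagonal
  value is real matters, since \<open>form_value\<close> speaks of real limits.\<close>

lemma coercive:
  assumes Y: "Y \<in> X_space 2"
  shows "\<kappa> * (X_norm 1 Y)\<^sup>2 \<le> Re (cinner Y (B_fun Y))"
proof (rule \<kappa>_bound)
  show "Y \<in> X_space 1"
    using Y X_space_2_subset_1 by blast
  have zero: "X_norm 1 (Y - Y) = 0"
  proof -
    have "sobolev_norm 1 0 = 0"
      by (simp add: sobolev_norm_def l2_coeff_zero)
    then have "X_norm 1 (0, 0, 0, 0) = 0"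
      by (simp add: X_norm_def)
    moreover have "Y - Y = (0, 0, 0, 0)"
      by (simp add: zero_prod_def)
    ultimately show ?thesis
      by (simp only:)
  qed
  show "form_value (B_op e M Z \<sigma> \<theta>) Y (Re (cinner Y (B_fun Y)))"
    unfolding form_value_def B_op_eq
  proof (rule exI[of _ "\<lambda>_. Y"], rule exI[of _ "\<lambda>_. B_fun Y"], intro conjI allI)
    fix n :: nat
    show "(Y, B_fun Y) \<in> operator_on (X_space 2) B_fun"
      using Y by (simp only: in_operator_on fst_conv snd_conv)
    show "(\<lambda>n. X_norm 1 (Y - Y)) \<longlonglongrightarrow> 0"
      unfolding zero by (rule tendsto_const)
    show "(\<lambda>n. cinner Y (B_fun Y)) \<longlonglongrightarrow> of_real (Re (cinner Y (B_fun Y)))"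
      unfolding cinner_B_fun_real[OF Y, symmetric] by (rule tendsto_const)
  qed
qed

lemma norm_le_h1_bound:
  assumes "\<And>F. finite F \<Longrightarrow> h1_sum F Y \<le> c"
  shows "(norm Y)\<^sup>2 \<le> c"
proof -
  obtain f g q p where Y: "Y = (f, g, q, p)" by (cases Y)
  have "(norm f)\<^sup>2 + (norm g)\<^sup>2 \<le> c - (norm q)\<^sup>2 - (norm p)\<^sup>2"
  proof (rule has_sum_le_finite_sums[OF has_sum_add[OF parseval_norm parseval_norm]])
    fix F :: "(int^3) set" assume F: "finite F"
    have "(\<Sum>m\<in>F. (cmod (l2_coeff f m))\<^sup>2 + (cmod (l2_coeff g m))\<^sup>2)
        \<le> (\<Sum>m\<in>F. sobolev_weight m * ((cmod (l2_coeff f m))\<^sup>2 + (cmod (l2_coeff g m))\<^sup>2))"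
      by (intro sum_mono) (use mult_right_mono[OF sobolev_weight_ge_1] in fastforce)
    also have "\<dots> \<le> c - (norm q)\<^sup>2 - (norm p)\<^sup>2"
      using assms[OF F] by (simp add: Y h1_sum_def)
    finally show "(\<Sum>m\<in>F. (cmod (l2_coeff f m))\<^sup>2 + (cmod (l2_coeff g m))\<^sup>2) \<le> c - (norm q)\<^sup>2 - (norm p)\<^sup>2" .
  qed
  then show ?thesis
    by (simp add: Y norm_Pair)
qed

lemma coercive_norm:
  assumes "Y \<in> X_space 2"
  shows "\<kappa> * (norm Y)\<^sup>2 \<le> Re (cinner Y (B_fun Y))"
proof -
  have "(norm Y)\<^sup>2 \<le> (X_norm 1 Y)\<^sup>2"
    using h1_sum_le_X_norm X_space_2_subset_1 assms by (intro norm_le_h1_bound) blast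
  then have "\<kappa> * (norm Y)\<^sup>2 \<le> \<kappa> * (X_norm 1 Y)\<^sup>2"
    using \<kappa>_pos by (intro mult_left_mono) auto
  then show ?thesis
    using coercive[OF assms] by linarith
qed

lemma B_fun_eq_0:
  assumes "Y \<in> X_space 2" "B_fun Y = 0"
  shows "Y = 0"
proof -
  have "\<kappa> * (norm Y)\<^sup>2 \<le> 0"
    using coercive_norm[OF assms(1)] assms(2) by simp
  then show ?thesis
    using \<kappa>_pos by (simp add: mult_le_0_iff)
qed

text \<open>The symbol of the block of \<open>B_op\<close> that acts on \<open>f\<close> alone, that
  is of \<open>2 H0 + 4 e^2 Z G\<close>.\<close>

definition D_coeff :: "int^3 \<Rightarrow> real" where "D_coeff m = (\<omega> m)\<^sup>2 + (\<beta> m)\<^sup>2"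

definition D_inv :: "l2torus \<Rightarrow> l2torus" where
  "D_inv u = of_coeffs (\<lambda>m. of_real (1 / D_coeff m) * l2_coeff u m)"

lemma D_coeff_pos: "D_coeff m > 0"
  using \<omega>_pos[of m] by (simp add: D_coeff_def add_pos_nonneg)

lemma weight_\<omega>_bound: obtains C where "\<And>m. sobolev_weight m / (\<omega> m)\<^sup>2 \<le> C"
proof -
  obtain \<delta> where \<delta>: "\<delta> > 0" "\<And>m. \<delta> \<le> \<omega> m"
    using \<omega>_lower_bound by blast
  have "sobolev_weight m / (\<omega> m)\<^sup>2 \<le> (1 + 24 * pi\<^sup>2) / \<delta>\<^sup>2 + 2" for m
  proof -
    have w: "(\<omega> m)\<^sup>2 > 0"
      using \<omega>_pos[of m] by simp
    have "sobolev_weight m / (\<omega> m)\<^sup>2 \<le> ((1 + 24 * pi\<^sup>2) + 2 * (\<omega> m)\<^sup>2) / (\<omega> m)\<^sup>2"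
      by (rule divide_right_mono[OF weight_le_\<omega>]) simp
    also have "\<dots> = (1 + 24 * pi\<^sup>2) / (\<omega> m)\<^sup>2 + 2"
      using w by (simp add: add_divide_distrib)
    also have "(1 + 24 * pi\<^sup>2) / (\<omega> m)\<^sup>2 \<le> (1 + 24 * pi\<^sup>2) / \<delta>\<^sup>2"
    proof (rule divide_left_mono)
      show "\<delta>\<^sup>2 \<le> (\<omega> m)\<^sup>2"
        using \<delta> by (intro power_mono) auto
    qed (use \<delta> w in \<open>auto simp: add_nonneg_nonneg\<close>)
    finally show ?thesis
      by simp
  qed
  then show ?thesis
    by (rule that)
qed

lemma weight_D_coeff_bound: obtains C where "\<And>m. sobolev_weight m / D_coeff m \<le> C"
proof -
  obtain C where C: "\<And>m. sobolev_weight m / (\<omega> m)\<^sup>2 \<le> C"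
    using weight_\<omega>_bound by blast
  have "sobolev_weight m / D_coeff m \<le> sobolev_weight m / (\<omega> m)\<^sup>2" for m
  proof (rule divide_left_mono)
    show "0 < D_coeff m * (\<omega> m)\<^sup>2"
      using D_coeff_pos[of m] \<omega>_pos[of m] by simp
  qed (simp_all add: D_coeff_def)
  then show ?thesis
    using that C order_trans by blast
qed

lemma D_inv:
  shows l2_coeff_D_inv: "l2_coeff (D_inv u) m = of_real (1 / D_coeff m) * l2_coeff u m"
    and D_inv_in_sobolev: "D_inv u \<in> sobolev_space 2"
proof -
  obtain C where C: "\<And>m. sobolev_weight m / D_coeff m \<le> C"
    using weight_D_coeff_bound by blast
  have le: "1 / D_coeff m \<le> C" for m
    using divide_right_mono[OF sobolev_weight_ge_1[of m], of "D_coeff m"] C[of m] D_coeff_pos[of m] by linarith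
  have "(\<lambda>m. (cmod (of_real (1 / D_coeff m) * l2_coeff u m))\<^sup>2) summable_on UNIV"
  proof (rule square_summable_mult[OF summable_l2_coeff])
    show "cmod (of_real (1 / D_coeff m)) \<le> C" for m
      unfolding norm_of_real using le[of m] D_coeff_pos[of m] by simp
  qed
  from l2_coeff_of_coeffs[OF this] 
  show eq: "l2_coeff (D_inv u) m = of_real (1 / D_coeff m) * l2_coeff u m" for m
    by (simp add: D_inv_def)
  have "(\<lambda>m. (cmod (of_real (sobolev_weight m / D_coeff m) * l2_coeff u m))\<^sup>2) summable_on UNIV"
  proof (rule square_summable_mult[OF summable_l2_coeff])
    show "cmod (of_real (sobolev_weight m / D_coeff m)) \<le> C" for m
      unfolding norm_of_real using C[of m] D_coeff_pos[of m] by simp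
  qed
  moreover have "of_real (sobolev_weight m / D_coeff m) * l2_coeff u m = of_real (sobolev_weight m) * l2_coeff (D_inv u) m" for m
    by (simp add: eq)
  ultimately show "D_inv u \<in> sobolev_space 2"
    by (simp only: in_sobolev_space_2)
qed

text \<open>Eliminating the component \<open>f\<close> reduces the equation \<open>B Y = W\<close> to a linear system in \<open>\<complex>\<^sup>3\<close>
  that is injective by coercivity.\<close>

lemma B_fun_surj: "\<exists>Y \<in> X_space 2. B_fun Y = W"
proof -
  obtain a b c d where W: "W = (a, b, c, d)" by (cases W)
  let ?S = "S_op e Z \<sigma> \<theta>" and ?A = "cadjoint (S_op e Z \<sigma> \<theta>)"
  \<comment> \<open>For given \<open>q\<close> this \<open>f\<close> solves the first equation,
    whatever \<open>g\<close> and \<open>p\<close> are.\<close>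
  have first: "fst (B_fun (D_inv (a - 2 *\<^sub>R ?S q), g, q, p)) = a" for a g q p
  proof (rule l2torus_eqI)
    fix m
    let ?t = "cinner (a_vec m) q"
    have *: "complex_of_real ((\<omega> m)\<^sup>2) * x + of_real (\<beta> m) * (of_real (\<beta> m) * x + y)
        = of_real (D_coeff m) * x + of_real (\<beta> m) * y" for x y
      by (simp add: D_coeff_def algebra_simps power2_eq_square)
    have "l2_coeff (a - 2 *\<^sub>R ?S q) m = l2_coeff a m - of_real (\<beta> m) * ?t"
      by (simp add: l2_coeff_diff l2_coeff_scaleR l2_coeff_S_op scaleR_conv_of_real)
    then show "l2_coeff (fst (B_fun (D_inv (a - 2 *\<^sub>R ?S q), g, q, p))) m = l2_coeff a m"
      unfolding l2_coeff_B_fun_1[OF D_inv_in_sobolev] r_coeff_def * l2_coeff_D_inv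
      using D_coeff_pos[of m] by simp
  qed
  have A_lin: "?A (u + v) = ?A u + ?A v" "?A (r *\<^sub>R u) = r *\<^sub>R ?A u" for u v r
    by (rule cinner_ext, subst (1 2) cinner_commute,
        simp add: cinner_add_right cinner_scaleR_right flip: cadjoint_S_op)+
  have D_lin: "D_inv (u + v) = D_inv u + D_inv v" "D_inv (r *\<^sub>R u) = r *\<^sub>R D_inv u" for u v r
    by (rule l2torus_eqI, simp add: l2_coeff_D_inv l2_coeff_add l2_coeff_scaleR add_divide_distrib)+
  have S_lin: "?S (q + q') = ?S q + ?S q'" "?S (r *\<^sub>R q) = r *\<^sub>R ?S q" for q q' r
    by (rule l2torus_eqI, simp add: l2_coeff_S_op l2_coeff_add l2_coeff_scaleR cinner_add_right
        cinner_scaleR_right distrib_left)+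
  \<comment> \<open>The Schur complement of the \<open>f\<close> block: what remains of the third
    equation once \<open>f\<close> is eliminated.\<close>
  define \<Phi> where "\<Phi> q = 2 *\<^sub>R ?A (D_inv ((- 2) *\<^sub>R ?S q)) + Sigma_mat \<sigma> \<theta> *v q" for q
  have "linear \<Phi>"
  proof (rule linearI)
    show "\<Phi> (q + q') = \<Phi> q + \<Phi> q'" for q q'
      by (simp add: \<Phi>_def S_lin D_lin A_lin scaleR_add_right matrix_vector_right_distrib del: scaleR_minus_left)
    show "\<Phi> (r *\<^sub>R q) = r *\<^sub>R \<Phi> q" for r q
    proof -
      have "Sigma_mat \<sigma> \<theta> *v (r *\<^sub>R q) = r *\<^sub>R (Sigma_mat \<sigma> \<theta> *v q)"
        by (simp add: matrix_vector_mult_def vec_eq_iff scaleR_sum_right)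
      then show ?thesis
        by (simp add: \<Phi>_def S_lin D_lin A_lin scaleR_add_right del: scaleR_minus_left)
    qed
  qed
  moreover have "inj \<Phi>"
  proof (rule linear_injective_0[OF \<open>linear \<Phi>\<close>, THEN iffD2], intro allI impI)
    \<comment> \<open>A kernel vector of the reduced system lifts to a kernel vector of
      \<open>B_fun\<close>.\<close>
    fix q assume q: "\<Phi> q = 0"
    let ?Y = "(D_inv (0 - 2 *\<^sub>R ?S q), 0, q, 0) :: xtorus"
    have "?Y \<in> X_space 2"
      by (simp add: X_space_def D_inv_in_sobolev zero_in_sobolev_space_2)
    moreover have "B_fun ?Y = 0"
    proof -
      have "H0_op \<theta> 0 = 0"
        by (rule l2torus_eqI) (simp add: l2_coeff_H0_op[OF zero_in_sobolev_space_2] l2_coeff_zero)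
      moreover have "2 *\<^sub>R ?A (D_inv (0 - 2 *\<^sub>R ?S q)) + Sigma_mat \<sigma> \<theta> *v q = 0"
        using q by (simp add: \<Phi>_def)
      ultimately show ?thesis
        using first[of 0 q 0 0] by (simp add: B_fun_def prod_eq_iff)
    qed
    ultimately have "?Y = 0"
      by (rule B_fun_eq_0)
    then show "q = 0"
      by (simp add: zero_prod_def)
  qed
  ultimately have "surj \<Phi>"
    by (rule linear_injective_imp_surjective) simp
  then obtain q where q: "\<Phi> q = c - 2 *\<^sub>R ?A (D_inv a)"
    by (metis surjD)
  let ?f = "D_inv (a - 2 *\<^sub>R ?S q)"
  define g where "g = of_coeffs (\<lambda>m. of_real (1 / (\<omega> m)\<^sup>2) * l2_coeff b m)"
  have g: "l2_coeff g m = of_real (1 / (\<omega> m)\<^sup>2) * l2_coeff b m" for m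
    using l2_coeff_G_op[of b m] unfolding g_def G_op_def fourier_multiplier_def \<omega>_def .
  have g2: "g \<in> sobolev_space 2"
  proof -
    obtain C where C: "\<And>m. sobolev_weight m / (\<omega> m)\<^sup>2 \<le> C"
      using weight_\<omega>_bound by blast
    have "(\<lambda>m. (cmod (of_real (sobolev_weight m / (\<omega> m)\<^sup>2) * l2_coeff b m))\<^sup>2) summable_on UNIV"
    proof (rule square_summable_mult[OF summable_l2_coeff])
      show "cmod (of_real (sobolev_weight m / (\<omega> m)\<^sup>2)) \<le> C" for m
        unfolding norm_of_real using C[of m] by simp
    qed
    moreover have "of_real (sobolev_weight m / (\<omega> m)\<^sup>2) * l2_coeff b m = of_real (sobolev_weight m) * l2_coeff g m" for m
      by (simp add: g)
    ultimately show ?thesis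
      by (simp only: in_sobolev_space_2)
  qed
  have "2 *\<^sub>R H0_op \<theta> g = b"
    by (rule l2torus_eqI)
       (use \<omega>_pos in \<open>simp add: l2_coeff_scaleR l2_coeff_H0_op[OF g2] g scaleR_conv_of_real less_imp_neq[symmetric]\<close>)
  moreover have "2 *\<^sub>R ?A ?f + Sigma_mat \<sigma> \<theta> *v q = c"
  proof -
    have "?f = D_inv a + D_inv ((- 2) *\<^sub>R ?S q)"
      unfolding D_lin(1)[symmetric] by simp
    then show ?thesis
      using q by (simp add: \<Phi>_def A_lin scaleR_add_right algebra_simps)
  qed
  ultimately have "B_fun (?f, g, q, M *\<^sub>R d) = W"
    using first[of a q g "M *\<^sub>R d"] pos by (simp add: W B_fun_def prod_eq_iff)
  moreover have "(?f, g, q, M *\<^sub>R d) \<in> X_space 2"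
    by (simp add: X_space_def g2 D_inv_in_sobolev)
  ultimately show ?thesis
    by blast
qed

definition R :: "xtorus \<Rightarrow> xtorus" where
  "R W = (SOME Y. Y \<in> X_space 2 \<and> B_fun Y = W)"

lemma R: "R W \<in> X_space 2" "B_fun (R W) = W"
  using someI_ex[of "\<lambda>Y. Y \<in> X_space 2 \<and> B_fun Y = W"] B_fun_surj[of W] unfolding R_def by blast+

lemma symmetric_R: "symmetric_map R"
  using B_fun_symmetric[OF R(1) R(1)] by (simp add: symmetric_map_def R(2))

lemma R_energy: "cinner W (R W) = cinner (R W) (B_fun (R W))"
  by (simp add: R(2) symmetric_mapD[OF symmetric_R])

lemma R_pos: "\<kappa> * (norm (R W))\<^sup>2 \<le> Re (cinner W (R W))"
  unfolding R_energy by (rule coercive_norm[OF R(1)])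

lemma norm_R: "norm (R W) \<le> (1 / \<kappa>) * norm W"
proof (cases "R W = 0")
  case False
  have "\<kappa> * (norm (R W))\<^sup>2 \<le> norm W * norm (R W)"
    using R_pos[of W] norm_cauchy_schwarz[of W "R W"] by (simp add: Re_cinner)
  then have "\<kappa> * norm (R W) \<le> norm W"
    using False by (simp add: power2_eq_square)
  then show ?thesis
    using \<kappa>_pos by (simp add: field_simps)
qed (use \<kappa>_pos in simp)

lemma B_fun_R:
  assumes "Y \<in> X_space 2"
  shows "R (B_fun Y) = Y"
proof (rule cinner_ext)
  fix W
  have "cinner (R (B_fun Y)) W = cinner (B_fun Y) (R W)"
    by (rule symmetric_mapD[OF symmetric_R])
  also have "\<dots> = cinner Y W"
    using B_fun_symmetric[OF R(1) assms] by (simp add: R(2))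
  finally show "cinner (R (B_fun Y)) W = cinner Y W" .
qed

lemma B_op_inverse_graph: "B_op e M Z \<sigma> \<theta> = inverse_graph R"
proof (rule set_eqI)
  fix P :: "xtorus \<times> xtorus"
  have "P \<in> B_op e M Z \<sigma> \<theta> \<longleftrightarrow> fst P \<in> X_space 2 \<and> snd P = B_fun (fst P)"
    unfolding B_op_eq by (rule in_operator_on)
  also have "\<dots> \<longleftrightarrow> fst P = R (snd P)"
  proof
    assume "fst P \<in> X_space 2 \<and> snd P = B_fun (fst P)"
    then show "fst P = R (snd P)"
      using B_fun_R[of "fst P"] by metis
  next
    assume "fst P = R (snd P)"
    then show "fst P \<in> X_space 2 \<and> snd P = B_fun (fst P)"
      using R[of "snd P"] by metis
  qed
  also have "\<dots> \<longleftrightarrow> P \<in> inverse_graph R"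
    using in_inverse_graph[of "fst P" "snd P" R] by (simp only: prod.collapse)
  finally show "P \<in> B_op e M Z \<sigma> \<theta> \<longleftrightarrow> P \<in> inverse_graph R" .
qed

lemma range_R: "range R = X_space 2"
proof
  show "range R \<subseteq> X_space 2"
    using R(1) by blast
  show "X_space 2 \<subseteq> range R"
    using B_fun_R by (metis rangeI subsetI)
qed

lemma inj_R: "inj R"
  by (metis R(2) injI)

section \<open>The inverse of the chosen root\<close>

definition S :: "xtorus \<Rightarrow> xtorus" where
  "S = (SOME S. Lambda_op e M Z \<sigma> \<theta> = inverse_graph S \<and> symmetric_map S \<and>
     (\<forall>x. S (S x) = R x) \<and> closure (range S) = UNIV)"

lemma S: "Lambda_op e M Z \<sigma> \<theta> = inverse_graph S" "symmetric_map S" "S (S x) = R x" "closure (range S) = UNIV"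
proof -
  have p: "0 \<le> Re (cinner x (R x))" for x
    using R_pos[of x] \<kappa>_pos by (meson mult_nonneg_nonneg less_imp_le order_trans zero_le_power2)
  have c: "1 / \<kappa> > 0"
    using \<kappa>_pos by simp
  have d: "closure (range R) = UNIV"
    unfolding range_R by (rule closure_X_space_2)
  obtain S' where S': "sqrt_operator (inverse_graph R) = inverse_graph S'" "symmetric_map S'"
    "\<And>x. S' (S' x) = R x" "closure (range S') = UNIV"
    using sqrt_operator_inverse_graph[OF symmetric_R p inj_R c norm_R d] by blast
  have "Lambda_op e M Z \<sigma> \<theta> = inverse_graph S'"
    unfolding Lambda_op_def B_op_inverse_graph by (rule S')
  then have "\<exists>S. Lambda_op e M Z \<sigma> \<theta> = inverse_graph S \<and> symmetric_map S \<and>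
     (\<forall>x. S (S x) = R x) \<and> closure (range S) = UNIV"
    using S'(2-4) by (intro exI[of _ S'] conjI allI)
  from someI_ex[OF this]
  show "Lambda_op e M Z \<sigma> \<theta> = inverse_graph S" "symmetric_map S" "S (S x) = R x" "closure (range S) = UNIV"
    unfolding S_def by blast+
qed

lemma norm_S_square: "(norm (S x))\<^sup>2 = Re (cinner x (R x))"
proof -
  have "Re (cinner (S x) (S x)) = Re (cinner x (R x))"
    by (simp only: symmetric_mapD[OF S(2)] S(3))
  then show ?thesis
    by (simp add: cinner_same)
qed

lemma norm_S_le: "(norm (S x))\<^sup>2 \<le> (1 / \<kappa>) * (norm x)\<^sup>2"
proof -
  have "(norm (S x))\<^sup>2 \<le> norm x * norm (R x)"
    unfolding norm_S_square using norm_cauchy_schwarz[of x "R x"] by (simp add: Re_cinner)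
  also have "\<dots> \<le> norm x * ((1 / \<kappa>) * norm x)"
    by (intro mult_left_mono norm_R) simp
  finally show ?thesis
    by (simp add: power2_eq_square mult_ac)
qed

lemma continuous_on_S: "continuous_on A S"
proof -
  have "norm (S x) \<le> sqrt (1 / \<kappa>) * norm x" for x
  proof -
    have "norm (S x) \<le> sqrt ((1 / \<kappa>) * (norm x)\<^sup>2)"
      by (rule real_le_rsqrt[OF norm_S_le])
    then show ?thesis
      by (simp only: real_sqrt_mult real_sqrt_pow2_iff) simp
  qed
  then have "bounded_linear S"
    by (rule symmetric_map_bounded_linear[OF S(2)])
  then show ?thesis
    by (rule linear_continuous_on)
qed

text \<open>Tested on a unit vector with only a \<open>p\<close> component, where the form equals
  \<open>1 / M\<close>. Later this turns bounds without \<open>1 / \<kappa>\<close> into bounds with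
  it.\<close>

lemma \<kappa>_le: "\<kappa> \<le> 1 / M"
proof -
  let ?p = "axis 1 1 :: complex^3"
  let ?Y = "(0, 0, 0, ?p) :: xtorus"
  have Y: "?Y \<in> X_space 2"
    by (simp add: X_space_def zero_in_sobolev_space_2)
  have n: "norm ?p = 1"
    by (intro norm_Basis) (auto simp: Basis_vec_def Basis_complex_def)
  have "Re (cinner ?Y (B_fun ?Y)) = 1 / M"
  proof -
    have "cinner ?Y (B_fun ?Y) = cinner ?p ((1 / M) *\<^sub>R ?p)"
      by (simp add: B_fun_def cinner_prod_def del: scaleR_one)
    then show ?thesis
      by (simp only: cinner_scaleR_right cinner_same n) simp
  qed
  moreover have "norm ?Y = 1"
    by (simp add: norm_Pair n)
  ultimately show ?thesis
    using coercive_norm[OF Y] by simp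
qed

end

section \<open>Energy estimates and duality\<close>

context bloch_coercive
begin

text \<open>Two bounds of different quality: the energy parts carry no loss, the Sobolev parts cost
  a factor \<open>\<kappa>\<close>. Both concern partial sums and therefore persist under limits in
  the norm of the whole space.\<close>

definition energy_le :: "xtorus \<Rightarrow> real \<Rightarrow> bool" where
  "energy_le Y b \<longleftrightarrow> (\<forall>F. finite F \<longrightarrow> energy_sum F Y \<le> b \<and> \<kappa> * h1_sum F Y \<le> b)"

lemma energy_le_X_space_2:
  assumes "Y \<in> X_space 2"
  shows "energy_le Y (Re (cinner Y (B_fun Y)))"
  unfolding energy_le_def
proof (intro allI impI conjI)
  fix F :: "(int^3) set" assume F: "finite F"
  show "energy_sum F Y \<le> Re (cinner Y (B_fun Y))"
    by (rule energy_sum_le[OF assms F])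
  have "h1_sum F Y \<le> (X_norm 1 Y)\<^sup>2"
    using h1_sum_le_X_norm X_space_2_subset_1 assms F by blast
  then have "\<kappa> * h1_sum F Y \<le> \<kappa> * (X_norm 1 Y)\<^sup>2"
    using \<kappa>_pos by (intro mult_left_mono) auto
  then show "\<kappa> * h1_sum F Y \<le> Re (cinner Y (B_fun Y))"
    using coercive[OF assms] by linarith
qed

lemma continuous_on_energy_sum: "continuous_on UNIV (energy_sum F)"
  unfolding energy_sum_def r_coeff_def case_prod_unfold
  using pos by (intro continuous_intros bounded_bilinear.continuous_on[OF bounded_bilinear_cinner]) auto

text \<open>The energy identity \<open>\<parallel>\<Lambda> Y\<parallel>\<^sup>2 = \<langle>Y, B Y\<rangle>\<close> holds on the domain of \<open>B\<close>; the inequality extends to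
  the domain of \<open>\<Lambda>\<close> because finite parts of the sums are continuous.\<close>

lemma energy_le_S: "energy_le (S w) ((norm w)\<^sup>2)"
proof -
  have range: "energy_le (S (S v)) ((norm (S v))\<^sup>2)" for v
    using energy_le_X_space_2[OF R(1)[of v]] by (simp add: norm_S_square S(3) R_energy)
  have "w \<in> {w. \<phi> (S w) \<le> (norm w)\<^sup>2}"
    if \<phi>: "continuous_on UNIV \<phi>" "\<And>v. \<phi> (S (S v)) \<le> (norm (S v))\<^sup>2" for \<phi> :: "xtorus \<Rightarrow> real"
  proof -
    have "closed {w. \<phi> (S w) \<le> (norm w)\<^sup>2}"
      by (intro closed_Collect_le continuous_on_compose2[OF \<phi>(1)] continuous_on_S continuous_intros) auto
    moreover have "range S \<subseteq> {w. \<phi> (S w) \<le> (norm w)\<^sup>2}"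
      using \<phi>(2) by blast
    ultimately have "closure (range S) \<subseteq> {w. \<phi> (S w) \<le> (norm w)\<^sup>2}"
      by (intro closure_minimal)
    then show ?thesis
      using S(4) by blast
  qed
  note * = this
  show ?thesis
    unfolding energy_le_def
  proof (intro allI impI conjI)
    fix F :: "(int^3) set" assume F: "finite F"
    show "energy_sum F (S w) \<le> (norm w)\<^sup>2"
      using *[OF continuous_on_energy_sum[of F]] range F by (simp add: energy_le_def)
    have "continuous_on UNIV (\<lambda>Y. \<kappa> * h1_sum F Y)"
      by (intro continuous_intros continuous_on_h1_sum)
    from *[OF this] show "\<kappa> * h1_sum F (S w) \<le> (norm w)\<^sup>2"
      using range F by (simp add: energy_le_def)
  qed
qed

text \<open>\<open>q\<close> enters the energy only through \<open>r_coeff\<close>, so it is bounded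
  by coercivity, at the price of \<open>1 / \<kappa>\<close>; the empty index set isolates the
  finite dimensional part.\<close>

lemma norm_q_bound:
  assumes "energy_le (f, g, q, p) b"
  shows "(norm q)\<^sup>2 \<le> b / \<kappa>"
proof -
  have "h1_sum {} (f, g, q, p) \<ge> (norm q)\<^sup>2"
    by (simp add: h1_sum_def)
  then have "\<kappa> * (norm q)\<^sup>2 \<le> \<kappa> * h1_sum {} (f, g, q, p)"
    using \<kappa>_pos by (intro mult_left_mono) auto
  also have "\<dots> \<le> b"
    using assms by (simp add: energy_le_def)
  finally show "(norm q)\<^sup>2 \<le> b / \<kappa>"
    using \<kappa>_pos by (simp add: field_simps)
qed

text \<open>Here \<open>2 e^2 Z\<close> is half of \<open>(\<beta> \<omega>)^2\<close>. The summands
  stem from the kinetic energy, from the square of \<open>r_coeff\<close>, and from the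
  \<open>q\<close> term at the one possible short frequency; the division by \<open>M\<close> comes
  from \<open>\<kappa>_le\<close>.\<close>

definition C_f :: real where
  "C_f = (1 + 1 / (2 * e\<^sup>2 * Z)) / M + (\<integral>x. \<bar>\<sigma> x\<bar> \<partial>lebesgue)\<^sup>2 / (2 * e\<^sup>2 * Z)"

text \<open>Small denominators occur for at most one lattice point; there the square \<open>r_coeff\<close> in the energy
  controls \<open>f / \<omega>\<close> up to a term in \<open>q\<close>.\<close>

lemma f_div_\<omega>_bound:
  assumes "energy_le (f, g, q, p) b" "finite F"
  shows "(\<Sum>m\<in>F. (cmod (l2_coeff f m))\<^sup>2 / (\<omega> m)\<^sup>2) \<le> C_f / \<kappa> * b"
proof -
  define N where "N = (\<integral>x. \<bar>\<sigma> x\<bar> \<partial>lebesgue)"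
  define \<gamma> where "\<gamma> = 2 * e\<^sup>2 * Z"
  have \<gamma>: "\<gamma> > 0"
    using pos by (simp add: \<gamma>_def)
  have en: "(\<Sum>m\<in>F. (\<omega> m)\<^sup>2 * ((cmod (l2_coeff f m))\<^sup>2 + (cmod (l2_coeff g m))\<^sup>2) + (cmod (r_coeff f q m))\<^sup>2) + (norm p)\<^sup>2 / M \<le> b"
    using assms by (simp add: energy_le_def energy_sum_def)
  have nn: "0 \<le> (norm p)\<^sup>2 / M"
    using pos by simp
  note q = norm_q_bound[OF assms(1)]
  have b: "b \<ge> 0"
    using en nn by (smt (verit) sum_nonneg mult_nonneg_nonneg zero_le_power2 add_nonneg_nonneg)
  \<comment> \<open>An energy bound without loss is weakened to one with
    \<open>1 / \<kappa>\<close>, so that it can be added to the bound on \<open>q\<close>.\<close>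
  have bM: "b \<le> (1 / M) * (b / \<kappa>)"
  proof -
    have "\<kappa> * b \<le> (1 / M) * b"
      by (rule mult_right_mono[OF \<kappa>_le b])
    then have "b * \<kappa> \<le> (1 / M) * b"
      by (simp only: mult.commute)
    then have "b \<le> (1 / M) * b / \<kappa>"
      using \<kappa>_pos by (simp only: pos_le_divide_eq)
    then show ?thesis
      by simp
  qed
  let ?small = "\<lambda>m. if \<omega> m < 1 then N\<^sup>2 * (norm q)\<^sup>2 / \<gamma> else 0"
  \<comment> \<open>For \<open>\<omega> m \<ge> 1\<close> the kinetic term suffices. Otherwise
    \<open>f\<close> is recovered from \<open>r_coeff\<close> by subtracting the \<open>q\<close>
    part and dividing by \<open>\<beta> m\<close>, where
    \<open>(\<beta> m)^2 = 2 \<gamma> / (\<omega> m)^2\<close>.\<close>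
  have pt: "(cmod (l2_coeff f m))\<^sup>2 / (\<omega> m)\<^sup>2 \<le> (\<omega> m)\<^sup>2 * ((cmod (l2_coeff f m))\<^sup>2 + (cmod (l2_coeff g m))\<^sup>2)
      + (cmod (r_coeff f q m))\<^sup>2 / \<gamma> + ?small m" for m
  proof (cases "\<omega> m < 1")
    case False
    then have "1 \<le> (\<omega> m)\<^sup>2"
      by (simp add: one_le_power)
    then have "(cmod (l2_coeff f m))\<^sup>2 / (\<omega> m)\<^sup>2 \<le> (cmod (l2_coeff f m))\<^sup>2"
      by (simp add: divide_le_eq mult_le_cancel_left1)
    also have "\<dots> \<le> (\<omega> m)\<^sup>2 * (cmod (l2_coeff f m))\<^sup>2"
      using mult_right_mono[OF \<open>1 \<le> (\<omega> m)\<^sup>2\<close>, of "(cmod (l2_coeff f m))\<^sup>2"] by simp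
    also have "\<dots> \<le> (\<omega> m)\<^sup>2 * ((cmod (l2_coeff f m))\<^sup>2 + (cmod (l2_coeff g m))\<^sup>2)"
      by (intro mult_left_mono) auto
    finally show ?thesis
      using False \<gamma> by (simp add: add_increasing2)
  next
    case True
    have "(\<beta> m)\<^sup>2 * (cmod (l2_coeff f m))\<^sup>2 = (cmod (r_coeff f q m + - cinner (a_vec m) q))\<^sup>2"
      by (simp add: r_coeff_def norm_mult power_mult_distrib)
    also have "\<dots> \<le> 2 * (cmod (r_coeff f q m))\<^sup>2 + 2 * (cmod (cinner (a_vec m) q))\<^sup>2"
      using norm_add_square_le[of "r_coeff f q m" "- cinner (a_vec m) q"] by simp
    also have "(cmod (cinner (a_vec m) q))\<^sup>2 \<le> (N * norm q)\<^sup>2"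
    proof (rule power_mono)
      have "cmod (cinner (a_vec m) q) \<le> norm (a_vec m) * norm q"
        by (rule cmod_cinner_le)
      also have "\<dots> \<le> N * norm q"
        unfolding N_def norm_a_vec by (intro mult_right_mono cmod_fourier_transform_le \<sigma>) simp
      finally show "cmod (cinner (a_vec m) q) \<le> N * norm q" .
    qed simp
    also have "(\<beta> m)\<^sup>2 = 2 * \<gamma> / (\<omega> m)\<^sup>2"
      using pos by (simp add: \<beta>_def \<gamma>_def power_divide power_mult_distrib)
    finally have "2 * \<gamma> / (\<omega> m)\<^sup>2 * (cmod (l2_coeff f m))\<^sup>2 \<le> 2 * (cmod (r_coeff f q m))\<^sup>2 + 2 * (N * norm q)\<^sup>2"
      by simp
    moreover have "2 * \<gamma> / (\<omega> m)\<^sup>2 * (cmod (l2_coeff f m))\<^sup>2 = 2 * ((cmod (l2_coeff f m))\<^sup>2 / (\<omega> m)\<^sup>2 * \<gamma>)"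
      by simp
    ultimately have "(cmod (l2_coeff f m))\<^sup>2 / (\<omega> m)\<^sup>2 * \<gamma> \<le> (cmod (r_coeff f q m))\<^sup>2 + N\<^sup>2 * (norm q)\<^sup>2"
      unfolding power_mult_distrib by linarith
    then have "(cmod (l2_coeff f m))\<^sup>2 / (\<omega> m)\<^sup>2 \<le> ((cmod (r_coeff f q m))\<^sup>2 + N\<^sup>2 * (norm q)\<^sup>2) / \<gamma>"
      using \<gamma> by (simp only: pos_le_divide_eq)
    also have "\<dots> \<le> (\<omega> m)\<^sup>2 * ((cmod (l2_coeff f m))\<^sup>2 + (cmod (l2_coeff g m))\<^sup>2)
      + (cmod (r_coeff f q m))\<^sup>2 / \<gamma> + N\<^sup>2 * (norm q)\<^sup>2 / \<gamma>"
      by (simp add: add_divide_distrib)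
    finally show ?thesis
      using True by simp
  qed
  let ?A = "\<Sum>m\<in>F. (\<omega> m)\<^sup>2 * ((cmod (l2_coeff f m))\<^sup>2 + (cmod (l2_coeff g m))\<^sup>2)"
  let ?R = "\<Sum>m\<in>F. (cmod (r_coeff f q m))\<^sup>2"
  have "?A \<ge> 0" "?R \<ge> 0"
    by (auto intro!: sum_nonneg mult_nonneg_nonneg)
  moreover have "?A + ?R \<le> b"
    using en nn by (simp add: sum.distrib)
  ultimately have AR: "?A \<le> b" "?R \<le> b"
    by linarith+
  have small: "(\<Sum>m\<in>F. ?small m) \<le> N\<^sup>2 * (norm q)\<^sup>2 / \<gamma>"
  proof -
    \<comment> \<open>At most one frequency is short, so the \<open>q\<close> term is paid for once,
      whatever \<open>F\<close> is.\<close>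
    have "card {m \<in> F. \<omega> m < 1} \<le> Suc 0"
      by (subst card_le_Suc0_iff_eq) (use assms(2) \<omega>_less_1_unique in auto)
    then have "real (card {m \<in> F. \<omega> m < 1}) \<le> 1"
      by simp
    then have "real (card {m \<in> F. \<omega> m < 1}) * (N\<^sup>2 * (norm q)\<^sup>2 / \<gamma>) \<le> 1 * (N\<^sup>2 * (norm q)\<^sup>2 / \<gamma>)"
      using \<gamma> by (intro mult_right_mono) auto
    moreover have "(\<Sum>m\<in>F. ?small m) = real (card {m \<in> F. \<omega> m < 1}) * (N\<^sup>2 * (norm q)\<^sup>2 / \<gamma>)"
      using assms(2) by (simp add: sum.If_cases Int_def)
    ultimately show ?thesis
      by simp
  qed
  have "(\<Sum>m\<in>F. (cmod (l2_coeff f m))\<^sup>2 / (\<omega> m)\<^sup>2)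
      \<le> (\<Sum>m\<in>F. (\<omega> m)\<^sup>2 * ((cmod (l2_coeff f m))\<^sup>2 + (cmod (l2_coeff g m))\<^sup>2)
        + (cmod (r_coeff f q m))\<^sup>2 / \<gamma> + ?small m)"
    by (rule sum_mono) (rule pt)
  also have "\<dots> = ?A + ?R / \<gamma> + (\<Sum>m\<in>F. ?small m)"
    by (simp only: sum.distrib sum_divide_distrib)
  also have "\<dots> \<le> b + b / \<gamma> + N\<^sup>2 * (norm q)\<^sup>2 / \<gamma>"
    using AR small \<gamma> by (intro add_mono divide_right_mono) auto
  also have "\<dots> = (1 + 1 / \<gamma>) * b + (N\<^sup>2 / \<gamma>) * (norm q)\<^sup>2"
    by (simp add: algebra_simps)
  also have "\<dots> \<le> (1 + 1 / \<gamma>) * ((1 / M) * (b / \<kappa>)) + (N\<^sup>2 / \<gamma>) * (b / \<kappa>)"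
    using \<gamma> by (intro add_mono mult_left_mono bM q) auto
  also have "\<dots> = C_f / \<kappa> * b"
  proof -
    have "C_f = (1 + 1 / \<gamma>) / M + N\<^sup>2 / \<gamma>"
      by (simp add: C_f_def N_def \<gamma>_def)
    then show ?thesis
      by (simp add: add_divide_distrib distrib_right)
  qed
  finally show ?thesis .
qed

lemma C_f_nonneg: "C_f \<ge> 0"
  using pos by (simp add: C_f_def)

lemma sum_mult_le_sqrt:
  fixes x y :: "'i \<Rightarrow> real"
  assumes "(\<Sum>m\<in>F. (x m)\<^sup>2) \<le> a" "(\<Sum>m\<in>F. (y m)\<^sup>2) \<le> b"
  shows "(\<Sum>m\<in>F. \<bar>x m * y m\<bar>) \<le> sqrt a * sqrt b"
proof -
  have "(\<Sum>m\<in>F. \<bar>x m * y m\<bar>) \<le> L2_set x F * L2_set y F"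
    using L2_set_mult_ineq[of x y F] by (simp add: abs_mult)
  also have "\<dots> \<le> sqrt a * sqrt b"
    unfolding L2_set_def
  proof (rule mult_mono)
    have "0 \<le> (\<Sum>m\<in>F. (x m)\<^sup>2)"
      by (rule sum_nonneg) simp
    then show "0 \<le> sqrt a"
      using assms(1) by simp
    show "0 \<le> sqrt (\<Sum>m\<in>F. (y m)\<^sup>2)"
      by (simp add: sum_nonneg)
  qed (use assms in simp_all)
  finally show ?thesis .
qed

lemma norm_has_sum_le:
  fixes f :: "'i \<Rightarrow> complex"
  assumes "(f has_sum s) UNIV" "\<And>F. finite F \<Longrightarrow> norm (sum f F) \<le> B"
  shows "norm s \<le> B"
proof (rule tendsto_upperbound)
  show "((\<lambda>F. norm (sum f F)) \<longlongrightarrow> norm s) (finite_subsets_at_top UNIV)"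
    using assms(1) unfolding has_sum_def by (rule tendsto_norm)
  show "\<forall>\<^sub>F F in finite_subsets_at_top UNIV. norm (sum f F) \<le> B"
    by (rule eventually_finite_subsets_at_top_weakI) (use assms(2) in auto)
qed simp

text \<open>Splitting \<open>f g = (f / \<omega>) (\<omega> g)\<close> costs only one factor \<open>\<kappa>\<^sup>-\<^sup>1\<^sup>/\<^sup>2\<close>, because \<open>\<omega> g\<close> is bounded by the energy
  without loss.\<close>

lemma cinner_f_g_bound:
  assumes "energy_le (f, g, q, p) b" "energy_le (f', g', q', p') b'"
  shows "cmod (cinner f g') \<le> sqrt (C_f / \<kappa> * b) * sqrt b'"
proof (rule norm_has_sum_le[OF parseval])
  fix F :: "(int^3) set" assume F: "finite F"
  have en: "(\<Sum>m\<in>F. (\<omega> m)\<^sup>2 * ((cmod (l2_coeff f' m))\<^sup>2 + (cmod (l2_coeff g' m))\<^sup>2) + (cmod (r_coeff f' q' m))\<^sup>2)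
      + (norm p')\<^sup>2 / M \<le> b'"
    using assms(2) F by (simp add: energy_le_def energy_sum_def)
  have "(\<Sum>m\<in>F. (\<omega> m * cmod (l2_coeff g' m))\<^sup>2)
      \<le> (\<Sum>m\<in>F. (\<omega> m)\<^sup>2 * ((cmod (l2_coeff f' m))\<^sup>2 + (cmod (l2_coeff g' m))\<^sup>2) + (cmod (r_coeff f' q' m))\<^sup>2)"
    by (intro sum_mono) (simp add: power_mult_distrib distrib_left)
  also have "\<dots> \<le> b'"
    using en pos by (smt (verit) divide_nonneg_pos zero_le_power2)
  finally have g: "(\<Sum>m\<in>F. (\<omega> m * cmod (l2_coeff g' m))\<^sup>2) \<le> b'" .
  have f: "(\<Sum>m\<in>F. (cmod (l2_coeff f m) / \<omega> m)\<^sup>2) \<le> C_f / \<kappa> * b"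
    using f_div_\<omega>_bound[OF assms(1) F] by (simp add: power_divide)
  have "norm (\<Sum>m\<in>F. cnj (l2_coeff f m) * l2_coeff g' m)
      \<le> (\<Sum>m\<in>F. norm (cnj (l2_coeff f m) * l2_coeff g' m))"
    by (rule norm_sum)
  also have "\<dots> = (\<Sum>m\<in>F. \<bar>cmod (l2_coeff f m) / \<omega> m * (\<omega> m * cmod (l2_coeff g' m))\<bar>)"
    using \<omega>_pos by (intro sum.cong refl) (simp add: norm_mult abs_mult less_imp_neq[symmetric])
  also have "\<dots> \<le> sqrt (C_f / \<kappa> * b) * sqrt b'"
    by (rule sum_mult_le_sqrt[OF f g])
  finally show "norm (\<Sum>m\<in>F. cnj (l2_coeff f m) * l2_coeff g' m) \<le> sqrt (C_f / \<kappa> * b) * sqrt b'" .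
qed

text \<open>Only \<open>q\<close> costs a factor \<open>1 / sqrt \<kappa>\<close>; \<open>p'\<close>
  is bounded by its own energy term.\<close>

lemma cinner_q_p_bound:
  assumes "energy_le (f, g, q, p) b" "energy_le (f', g', q', p') b'"
  shows "cmod (cinner q p') \<le> sqrt (b / \<kappa>) * sqrt (M * b')"
proof -
  have q: "norm q \<le> sqrt (b / \<kappa>)"
    by (rule real_le_rsqrt[OF norm_q_bound[OF assms(1)]])
  have "energy_sum {} (f', g', q', p') \<le> b'"
    using assms(2) unfolding energy_le_def by blast
  then have "(norm p')\<^sup>2 \<le> M * b'"
    using pos by (simp add: energy_sum_def field_simps)
  then have p: "norm p' \<le> sqrt (M * b')"
    by (rule real_le_rsqrt)
  have "cmod (cinner q p') \<le> norm q * norm p'"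
    by (rule cmod_cinner_le)
  also have "\<dots> \<le> sqrt (b / \<kappa>) * sqrt (M * b')"
    by (intro mult_mono q p norm_ge_zero order_trans[OF norm_ge_zero q])
  finally show ?thesis .
qed

text \<open>The square of \<open>norm (S v)\<close> is the scalar product of \<open>R v\<close> with
  \<open>v\<close>, which pairs the components of \<open>R v\<close> and \<open>S w\<close>
  crosswise. As the energy of \<open>R v\<close> is again that square, every pairing is at most a
  constant times \<open>norm w * norm (S v) / sqrt \<kappa>\<close>, and one factor
  \<open>norm (S v)\<close> cancels.\<close>

lemma norm_S_J_bound:
  assumes y: "S w = (f, g, q, p)"
  defines "v \<equiv> ((2 * \<i>) *\<^sub>C g, (- 2 * \<i>) *\<^sub>C f, \<i> *\<^sub>C p, (- \<i>) *\<^sub>C q)"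
  shows "(norm (S v))\<^sup>2 \<le> (4 * sqrt C_f + 2 * sqrt M)\<^sup>2 / \<kappa> * (norm w)\<^sup>2"
proof -
  define b where "b = (norm w)\<^sup>2"
  obtain f' g' q' p' where Y: "R v = (f', g', q', p')" by (cases "R v")
  define b' where "b' = (norm (S v))\<^sup>2"
  have b': "b' = Re (cinner (R v) (B_fun (R v)))"
    unfolding b'_def norm_S_square R_energy ..
  have e1: "energy_le (f, g, q, p) b"
    using energy_le_S[of w] by (simp add: y b_def)
  have e2: "energy_le (f', g', q', p') b'"
    using energy_le_X_space_2[OF R(1)[of v]] unfolding b' by (simp add: Y)
  have "b' = Re (cinner (R v) v)"
    unfolding b' by (simp only: R(2))
  also have "\<dots> \<le> cmod (cinner (R v) v)"
    by (rule complex_Re_le_cmod)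
  also have "cinner (R v) v = 2 * \<i> * cinner f' g - 2 * \<i> * cinner g' f + \<i> * cinner q' p - \<i> * cinner p' q"
    unfolding Y by (simp add: v_def cinner_prod_def cinner_scaleC_right)
  also have "cmod \<dots> \<le> 2 * cmod (cinner f' g) + 2 * cmod (cinner g' f) + cmod (cinner q' p) + cmod (cinner p' q)"
  proof -
    have "cmod (A - B + C - D) \<le> cmod A + cmod B + cmod C + cmod D" for A B C D
      by (smt (verit) norm_triangle_ineq norm_triangle_ineq4)
    from this[of "2 * \<i> * cinner f' g" "2 * \<i> * cinner g' f" "\<i> * cinner q' p" "\<i> * cinner p' q"]
    show ?thesis
      by (simp add: norm_mult)
  qed
  also have "\<dots> \<le> 2 * (sqrt (C_f / \<kappa> * b') * sqrt b) + 2 * (sqrt (C_f / \<kappa> * b) * sqrt b')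
      + sqrt (b' / \<kappa>) * sqrt (M * b) + sqrt (b / \<kappa>) * sqrt (M * b')"
  proof -
    have "cmod (cinner g' f) = cmod (cinner f g')" "cmod (cinner p' q) = cmod (cinner q p')"
      by (simp_all add: cinner_commute[of g' f] cinner_commute[of p' q])
    then show ?thesis
      using cinner_f_g_bound[OF e2 e1] cinner_f_g_bound[OF e1 e2] cinner_q_p_bound[OF e2 e1] cinner_q_p_bound[OF e1 e2]
      by linarith
  qed
  \<comment> \<open>Two field pairings with weight 2 and two \<open>q\<close>-\<open>p\<close>
    pairings with weight 1.\<close>
  also have "\<dots> = (4 * sqrt C_f + 2 * sqrt M) / sqrt \<kappa> * sqrt b * sqrt b'"
    by (simp add: real_sqrt_mult real_sqrt_divide add_divide_distrib algebra_simps)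
  finally have le: "b' \<le> (4 * sqrt C_f + 2 * sqrt M) / sqrt \<kappa> * sqrt b * sqrt b'" .
  have nn: "b \<ge> 0" "b' \<ge> 0"
    by (simp_all add: b_def b'_def)
  have "sqrt b' \<le> (4 * sqrt C_f + 2 * sqrt M) / sqrt \<kappa> * sqrt b"
  proof (cases "b' = 0")
    case True
    then show ?thesis
      using C_f_nonneg pos \<kappa>_pos nn by simp
  next
    case False
    have "sqrt b' * sqrt b' \<le> ((4 * sqrt C_f + 2 * sqrt M) / sqrt \<kappa> * sqrt b) * sqrt b'"
      using le nn by simp
    then show ?thesis
      by (rule mult_right_le_imp_le) (use False nn in simp)
  qed
  then have "(sqrt b')\<^sup>2 \<le> ((4 * sqrt C_f + 2 * sqrt M) / sqrt \<kappa> * sqrt b)\<^sup>2"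
    using nn by (intro power_mono) auto
  then show ?thesis
    using nn \<kappa>_pos by (simp add: power_mult_distrib power_divide b_def b'_def)
qed

section \<open>The inverse of \<open>K_op\<close> and its Sobolev bound\<close>

definition J_inv :: "xtorus \<Rightarrow> xtorus" where
  "J_inv = (\<lambda>(f, g, q, p). ((2 * \<i>) *\<^sub>C g, (- 2 * \<i>) *\<^sub>C f, \<i> *\<^sub>C p, (- \<i>) *\<^sub>C q))"

lemma iJ_eq_iff: "\<i> *\<^sub>C J_op Y = W \<longleftrightarrow> Y = J_inv W"
proof -
  have half: "r *\<^sub>R x = complex_of_real r *\<^sub>C x" for r and x :: "'z::complex_inner"
    by (rule scaleC_of_real[symmetric])
  have neg: "- u = (- 1) *\<^sub>C u" "- q = (- 1) *\<^sub>C q" for u :: l2torus and q :: "complex^3"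
    using scaleC_of_real[of "-1" u] scaleC_of_real[of "-1" q] by simp_all
  have 1: "\<i> *\<^sub>C J_op (J_inv W) = W"
    by (cases W) (simp add: J_op_def J_inv_def scaleC_prod_def half neg scaleC_scaleC)
  have 2: "J_inv (\<i> *\<^sub>C J_op Y) = Y"
    by (cases Y) (simp add: J_op_def J_inv_def scaleC_prod_def half neg scaleC_scaleC)
  show ?thesis
    using 1 2 by metis
qed

lemma symmetric_J_inv: "symmetric_map J_inv"
  by (simp add: symmetric_map_def J_inv_def cinner_prod_def cinner_scaleC_left cinner_scaleC_right)

lemma continuous_on_J_inv: "continuous_on A J_inv"
  unfolding J_inv_def case_prod_unfold
  by (intro continuous_intros bounded_bilinear.continuous_on[OF bounded_bilinear_scaleC])

lemma surj_J_inv: "surj J_inv"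
  by (rule surjI[of _ "\<lambda>Y. \<i> *\<^sub>C J_op Y"]) (use iJ_eq_iff in metis)

lemma norm_J_inv: "(norm (J_inv Y))\<^sup>2 \<le> 4 * (norm Y)\<^sup>2"
  by (cases Y) (simp add: J_inv_def norm_Pair norm_scaleC norm_mult power_mult_distrib)

definition T :: "xtorus \<Rightarrow> xtorus" where "T W = S (J_inv (S W))"

text \<open>Since \<open>S\<close> and \<open>J_inv\<close> are defined everywhere, the natural
  domain of the triple composition is exactly the range of \<open>T\<close>.\<close>

lemma K_op_eq: "K_op e M Z \<sigma> \<theta> = inverse_graph T"
proof (rule set_eqI)
  fix P :: "xtorus \<times> xtorus"
  obtain x z where P: "P = (x, z)" by (cases P)
  have "(x, z) \<in> K_op e M Z \<sigma> \<theta> \<longleftrightarrow> (\<exists>y. x = S y \<and> \<i> *\<^sub>C J_op y = S z)"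
    unfolding K_op_def S(1) relcomp_unfold mem_Collect_eq case_prod_conv in_inverse_graph in_operator_on fst_conv snd_conv
    by blast
  also have "\<dots> \<longleftrightarrow> x = T z"
    unfolding iJ_eq_iff T_def by blast
  finally show "P \<in> K_op e M Z \<sigma> \<theta> \<longleftrightarrow> P \<in> inverse_graph T"
    unfolding P in_inverse_graph .
qed

lemma symmetric_T: "symmetric_map T"
  unfolding T_def by (rule symmetric_map_compose3[OF S(2) symmetric_J_inv])

lemma inj_S: "inj S"
proof (rule injI)
  fix a b assume "S a = S b"
  then have "R a = R b"
    by (simp flip: S(3))
  then show "a = b"
    by (rule injD[OF inj_R])
qed

lemma inj_J_inv: "inj J_inv"
  by (rule inj_on_inverseI[of _ "\<lambda>Y. \<i> *\<^sub>C J_op Y"]) (use iJ_eq_iff in metis)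

lemma inj_T: "inj T"
proof (rule injI)
  fix a b assume "T a = T b"
  then show "a = b"
    unfolding T_def by (rule injD[OF inj_S, THEN injD[OF inj_J_inv], THEN injD[OF inj_S]])
qed

text \<open>\<open>J_inv\<close> and \<open>S\<close> are continuous with dense range, so each
  carries dense sets to dense sets.\<close>

lemma closure_range_T: "closure (range T) = UNIV"
proof -
  have "closure (J_inv ` range S) = UNIV"
    by (rule closure_image_dense[OF S(4) continuous_on_J_inv]) (simp add: surj_J_inv)
  then have "closure (S ` J_inv ` range S) = UNIV"
    by (rule closure_image_dense[OF _ continuous_on_S S(4)])
  moreover have "range T = S ` J_inv ` range S"
    by (auto simp: T_def)
  ultimately show ?thesis
    by simp
qed

text \<open>\<open>1 + 24 \<pi>^2\<close> is the additive constant of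
  \<open>weight_le_\<omega>\<close> and multiplies the bound of \<open>norm_S_J_bound\<close>; 8 is
  the factor 2 before \<open>\<omega>^2\<close> there times the factor 4 of
  \<open>norm_J_inv\<close>.\<close>

definition C_T :: real where
  "C_T = (1 + 24 * pi\<^sup>2) * (4 * sqrt C_f + 2 * sqrt M)\<^sup>2 + 8"

text \<open>The constant part of the weight is met by the duality bound for \<open>S v\<close>, the
  part with \<open>\<omega>^2\<close> by the energy of \<open>S v\<close>, which is at most the
  square of \<open>norm v\<close>. Each part spends one factor \<open>1 / \<kappa>\<close>.\<close>

lemma h1_sum_T:
  assumes F: "finite F"
  shows "h1_sum F (T W) \<le> C_T / \<kappa> * (norm W)\<^sup>2"
proof -
  obtain f g q p where y: "S W = (f, g, q, p)" by (cases "S W")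
  define v where "v = J_inv (S W)"
  have v: "v = ((2 * \<i>) *\<^sub>C g, (- 2 * \<i>) *\<^sub>C f, \<i> *\<^sub>C p, (- \<i>) *\<^sub>C q)"
    by (simp add: v_def y J_inv_def)
  obtain f' g' q' p' where x: "S v = (f', g', q', p')" by (cases "S v")
  let ?s = "\<lambda>m. (cmod (l2_coeff f' m))\<^sup>2 + (cmod (l2_coeff g' m))\<^sup>2"
  have x_bound: "(norm (S v))\<^sup>2 \<le> (4 * sqrt C_f + 2 * sqrt M)\<^sup>2 / \<kappa> * (norm W)\<^sup>2"
    unfolding v by (rule norm_S_J_bound[OF y])
  have v_bound: "(norm v)\<^sup>2 \<le> 4 / \<kappa> * (norm W)\<^sup>2"
    using norm_J_inv[of "S W"] norm_S_le[of W] unfolding v_def by simp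
  have "energy_sum F (S v) \<le> (norm v)\<^sup>2"
    using energy_le_S[of v] F unfolding energy_le_def by blast
  then have "(\<Sum>m\<in>F. (\<omega> m)\<^sup>2 * ?s m + (cmod (r_coeff f' q' m))\<^sup>2) + (norm p')\<^sup>2 / M \<le> (norm v)\<^sup>2"
    by (simp add: x energy_sum_def)
  moreover have "(\<Sum>m\<in>F. (\<omega> m)\<^sup>2 * ?s m) \<le> (\<Sum>m\<in>F. (\<omega> m)\<^sup>2 * ?s m + (cmod (r_coeff f' q' m))\<^sup>2)"
    by (intro sum_mono) simp
  moreover have "0 \<le> (norm p')\<^sup>2 / M"
    using pos by simp
  ultimately have en: "(\<Sum>m\<in>F. (\<omega> m)\<^sup>2 * ?s m) \<le> (norm v)\<^sup>2"
    by linarith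
  have l2: "(\<Sum>m\<in>F. ?s m) \<le> (norm f')\<^sup>2 + (norm g')\<^sup>2"
    unfolding sum.distrib by (intro add_mono bessel F)
  have nx: "(norm (S v))\<^sup>2 = (norm f')\<^sup>2 + (norm g')\<^sup>2 + (norm q')\<^sup>2 + (norm p')\<^sup>2"
    by (simp add: x norm_Pair)
  have "(\<Sum>m\<in>F. sobolev_weight m * ?s m) \<le> (\<Sum>m\<in>F. ((1 + 24 * pi\<^sup>2) + 2 * (\<omega> m)\<^sup>2) * ?s m)"
    by (intro sum_mono mult_right_mono weight_le_\<omega>) auto
  also have "\<dots> = (1 + 24 * pi\<^sup>2) * (\<Sum>m\<in>F. ?s m) + 2 * (\<Sum>m\<in>F. (\<omega> m)\<^sup>2 * ?s m)"
    unfolding sum_distrib_left sum.distrib[symmetric] by (intro sum.cong refl) (simp add: distrib_right)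
  also have "\<dots> \<le> (1 + 24 * pi\<^sup>2) * ((norm f')\<^sup>2 + (norm g')\<^sup>2) + 2 * (norm v)\<^sup>2"
    using en l2 by (intro add_mono mult_left_mono) auto
  finally have "h1_sum F (S v) \<le> (1 + 24 * pi\<^sup>2) * ((norm f')\<^sup>2 + (norm g')\<^sup>2) + 2 * (norm v)\<^sup>2 + ((norm q')\<^sup>2 + (norm p')\<^sup>2)"
    by (simp add: x h1_sum_def)
  also have "\<dots> \<le> (1 + 24 * pi\<^sup>2) * ((norm f')\<^sup>2 + (norm g')\<^sup>2) + 2 * (norm v)\<^sup>2 + (1 + 24 * pi\<^sup>2) * ((norm q')\<^sup>2 + (norm p')\<^sup>2)"
    using mult_right_mono[of 1 "1 + 24 * pi\<^sup>2" "(norm q')\<^sup>2 + (norm p')\<^sup>2"] by simp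
  also have "\<dots> = (1 + 24 * pi\<^sup>2) * (norm (S v))\<^sup>2 + 2 * (norm v)\<^sup>2"
    unfolding nx by (simp add: algebra_simps)
  also have "\<dots> \<le> (1 + 24 * pi\<^sup>2) * ((4 * sqrt C_f + 2 * sqrt M)\<^sup>2 / \<kappa> * (norm W)\<^sup>2) + 2 * (4 / \<kappa> * (norm W)\<^sup>2)"
    by (intro add_mono mult_left_mono x_bound v_bound) auto
  also have "\<dots> = C_T / \<kappa> * (norm W)\<^sup>2"
    using \<kappa>_pos by (simp add: C_T_def add_divide_distrib distrib_right)
  finally show ?thesis
    by (simp add: T_def v_def)
qed

lemma C_T_pos: "C_T > 0"
  by (simp add: C_T_def add_nonneg_pos)

lemma compact_inverse_K: "compact_operator ((inverse_graph T)\<inverse>)"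
  unfolding compact_operator_def
proof (intro conjI)
  show "linear_operator ((inverse_graph T)\<inverse>)"
    by (rule linear_operator_converse_inverse_graph[OF symmetric_T])
  show "Domain ((inverse_graph T)\<inverse>) = UNIV"
    by (metis (no_types, lifting) Domain_iff UNIV_eq_I converse_iff in_inverse_graph)
  show "compact (closure ((inverse_graph T)\<inverse> `` ball 0 1))"
  proof (rule compact_closure_h1_bounded)
    fix Y and F :: "(int^3) set" assume Y: "Y \<in> (inverse_graph T)\<inverse> `` ball 0 1" and F: "finite F"
    obtain W where "W \<in> ball 0 1" "(W, Y) \<in> (inverse_graph T)\<inverse>"
      using Y by (rule ImageE)
    then have W: "norm W < 1" "Y = T W"
      by (simp only: mem_ball_0, simp only: converse_iff in_inverse_graph)
    have "h1_sum F Y \<le> C_T / \<kappa> * (norm W)\<^sup>2"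
      unfolding W(2) by (rule h1_sum_T[OF F])
    also have "\<dots> \<le> C_T / \<kappa> * 1"
      using W(1) C_T_pos \<kappa>_pos by (intro mult_left_mono) (auto simp: power_le_one)
    finally show "h1_sum F Y \<le> C_T / \<kappa>"
      by simp
  qed
qed

lemma X_norm_T: "T W \<in> X_space 1" "(X_norm 1 (T W))\<^sup>2 \<le> C_T / \<kappa> * (norm W)\<^sup>2"
  using X_space_1_of_h1_sum[OF h1_sum_T] by blast+

end

theorem lemma2p7:
  fixes e M Z :: real and \<sigma> :: "real^3 \<Rightarrow> real" and \<kappa> :: "real^3 \<Rightarrow> real"
  assumes "e > 0" and "M > 0" and "Z > 0"
    and "integrable lebesgue \<sigma>"
    and "(\<integral>x. \<sigma> x \<partial>lebesgue) = e * Z"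
    and "laplacian_minus_one_in_L1 \<sigma>"
    and "Wiener_condition \<sigma>"
    and "Jellium_condition \<sigma>"
    and kappa_pos: "\<And>\<theta>. \<theta> \<in> Pi_star_plus \<sigma> \<Longrightarrow> \<kappa> \<theta> > 0"
    and kappa_bound: "\<And>\<theta> Y b. \<theta> \<in> Pi_star_plus \<sigma> \<Longrightarrow> Y \<in> X_space 1 \<Longrightarrow>
           form_value (B_op e M Z \<sigma> \<theta>) Y b \<Longrightarrow> b \<ge> \<kappa> \<theta> * (X_norm 1 Y)\<^sup>2"
  shows "\<exists>C>0. \<forall>\<theta> \<in> Pi_star_plus \<sigma>.
           (selfadjoint (K_op e M Z \<sigma> \<theta>) \<and>
            closure (Domain (K_op e M Z \<sigma> \<theta>)) = UNIV \<and>
            Domain (K_op e M Z \<sigma> \<theta>) \<subseteq> X_space 1) \<and>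
           (compact_operator ((K_op e M Z \<sigma> \<theta>)\<inverse>) \<and>
            selfadjoint ((K_op e M Z \<sigma> \<theta>)\<inverse>) \<and>
            (\<forall>(W, Y) \<in> (K_op e M Z \<sigma> \<theta>)\<inverse>.
               Y \<in> X_space 1 \<and> (X_norm 1 Y)\<^sup>2 \<le> C / \<kappa> \<theta> * (norm W)\<^sup>2))"
proof -
  \<comment> \<open>The value of \<open>C_T\<close>, written out before \<open>\<theta>\<close> is
    fixed, which displays that it depends on \<open>e\<close>, \<open>M\<close>, \<open>Z\<close>
    and \<open>\<sigma>\<close> alone.\<close>
  define C where "C = (1 + 24 * pi\<^sup>2) * (4 * sqrt ((1 + 1 / (2 * e\<^sup>2 * Z)) / M
      + (\<integral>x. \<bar>\<sigma> x\<bar> \<partial>lebesgue)\<^sup>2 / (2 * e\<^sup>2 * Z)) + 2 * sqrt M)\<^sup>2 + 8"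
  have "C > 0"
    by (simp add: C_def add_nonneg_pos)
  moreover have "(selfadjoint (K_op e M Z \<sigma> \<theta>) \<and>
            closure (Domain (K_op e M Z \<sigma> \<theta>)) = UNIV \<and>
            Domain (K_op e M Z \<sigma> \<theta>) \<subseteq> X_space 1) \<and>
           (compact_operator ((K_op e M Z \<sigma> \<theta>)\<inverse>) \<and>
            selfadjoint ((K_op e M Z \<sigma> \<theta>)\<inverse>) \<and>
            (\<forall>(W, Y) \<in> (K_op e M Z \<sigma> \<theta>)\<inverse>.
               Y \<in> X_space 1 \<and> (X_norm 1 Y)\<^sup>2 \<le> C / \<kappa> \<theta> * (norm W)\<^sup>2))"
    if \<theta>: "\<theta> \<in> Pi_star_plus \<sigma>" for \<theta>
  proof -
    interpret bloch_coercive e M Z \<sigma> \<theta> "\<kappa> \<theta>"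
      using assms(1-4) \<theta> kappa_pos[OF \<theta>] kappa_bound[OF \<theta>]
      by (intro bloch_coercive.intro bloch.intro bloch_coercive_axioms.intro)
    have C: "C_T = C"
      by (simp only: C_T_def C_f_def C_def)
    show ?thesis
      unfolding K_op_eq Domain_inverse_graph
    proof (intro conjI)
      show "selfadjoint (inverse_graph T)"
        by (rule selfadjoint_inverse_graph[OF symmetric_T inj_T closure_range_T])
      show "closure (range T) = UNIV"
        by (rule closure_range_T)
      show "range T \<subseteq> X_space 1"
        using X_norm_T(1) by blast
      show "compact_operator ((inverse_graph T)\<inverse>)"
        by (rule compact_inverse_K)
      show "selfadjoint ((inverse_graph T)\<inverse>)"
        by (rule selfadjoint_converse_inverse_graph[OF symmetric_T])
      show "\<forall>(W, Y) \<in> (inverse_graph T)\<inverse>.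
          Y \<in> X_space 1 \<and> (X_norm 1 Y)\<^sup>2 \<le> C / \<kappa> \<theta> * (norm W)\<^sup>2"
      proof (rule ballI)
        fix P assume "P \<in> (inverse_graph T)\<inverse>"
        then obtain W where P: "P = (W, T W)"
          by (metis converseE in_inverse_graph)
        show "case P of (W, Y) \<Rightarrow> Y \<in> X_space 1 \<and> (X_norm 1 Y)\<^sup>2 \<le> C / \<kappa> \<theta> * (norm W)\<^sup>2"
          unfolding P prod.case using X_norm_T[of W] by (simp only: C)
      qed
    qed
  qed
  ultimately show ?thesis
    by blast
qed

end
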